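(* Let $M$ be a locally compact, but not compact, Polish space with a positive, locally finite Borel measure $\mu$ of full topological support, and let $\{U_t:t\ge 0\}$ be a strongly continuous semigroup of bounded, positivity preserving linear operators on $L^2(M,\mu)$ with adjoint semigroup $\{U_t^*:t\ge 0\}$, both given for $t>0$ by a real-valued measurable kernel $u_t(x,y)$. Fix $t_0>0$ and assume: every $U_t$, $t>0$, is compact on $L^2(M,\mu)$; $U_{t_0}$ is positivity improving; both semigroups have the strong Feller property; $U_{t_0},U_{t_0}^*:L^2(M,\mu)\to L^\infty(M,\mu)$ are bounded; and for every $t\ge t_0$ and $\epsilon>0$ there is a compact set $K\subset M$ satisfying $U_t\mathbf 1_M(x)\le\epsilon$ or $U_t^*\mathbf 1_M(x)\le\epsilon$, for every $x\in M\setminus K$. Let $\lambda_0,\phi_0,\psi_0,\gamma$ be as in the context, and assume that $\phi_0$ and $\psi_0$ are strictly positive everywhere on $M$. Let $\{K_t:t\ge t_0\}$ be an exhausting family of compact sets in $M$. Set $$h(t):=\min\Big\{\inf_{x\in K_t}\phi_0(x),\ \inf_{x\in K_t}\psi_0(x)\Big\},\quad t\ge t_0,$$ $h^{-1}(s):=\inf\{t\ge t_0: h(t)<s\}$ for $s\in(0,h(t_0)]$, $\eta(t):=h^{-1}(e^{-\gamma t})$ for $t\ge-\gamma^{-1}\log h(t_0)$, and $\widetilde t_0:=\max\{0,-\gamma^{-1}\log h(t_0)\}$. If there is some $t_1\ge t_0$ such that the heat content $Z(t_1)<\infty$, then: (a) Both semigroups $\{U_t\}$ and $\{U_t^*\}$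 are progressively ground state dominated (pGSD) for the exhausting family $\{K_{\eta(t)}:t\ge\widetilde t_0\}$, i.e. there are $C,t'>0$ such that for all $t\ge \max\{t',\widetilde t_0\}$ and $x\in K_{\eta(t)}$ $$U_t\mathbf 1_M(x)\le Ce^{-\lambda_0t}\phi_0(x)\quad\text{and}\quad U_t^*\mathbf 1_M(x)\le Ce^{-\lambda_0t}\psi_0(x).$$ (b) Both semigroups are exponentially progressively uniformly quasi-ergodic: for every $p\in[1,\infty]$ there exists some $C>0$ such that for all $t>6t_1$ (with $t\ge 2\widetilde t_0$, so that $\eta(t/2)$ is defined) $$\sup_\sigma\sup_{f\in L^p(M,\mu),\ \|f\|_p\le1}\left|\frac{\sigma(U_tf)}{\sigma(U_t\mathbf 1_M)}-m(f)\right|\le Ce^{-(\gamma/2)t} \quad\text{and}\quad \sup_\sigma\sup_{f\in L^p(M,\mu),\ \|f\|_p\le1}\left|\frac{\sigma(U_t^*f)}{\sigma(U_t^*\mathbf 1_M)}-m^*(f)\right|\le Ce^{-(\gamma/2)t},$$ where $\sigma$ ranges over all probability measures on the Borel sets of $M$ with $\operatorname{supp}\sigma\subset K_{\eta(t/2)}$.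
   Context: For a measure $\sigma$ write $\sigma(g)=\int g\,d\sigma$; $\mathbf 1_M$ is the constant function $1$; $\|\cdot\|_p$ is the $L^p(M,\mu)$ norm. Kernels: $U_tf(x)=\int u_t(x,y)f(y)\,\mu(dy)$ and $U_t^*g(y)=\int u_t(x,y)g(x)\,\mu(dx)$, $t>0$; these formulas also define $U_t,U_t^*$ on other $L^p$ spaces. Positivity preserving: $f\ge0$ a.e. implies $U_tf\ge 0$ a.e. Positivity improving: $f\ge 0$, $f\not\equiv 0$ in $L^2$ implies $U_{t_0}f>0$ $\mu$-a.e. Strong Feller property: for every $t>0$ and $f\in L^\infty(M,\mu)$ one has $U_tf,U_t^*f\in C_b(M)$. Under the assumptions $U_t,U_t^*$ map $L^p(M,\mu)$ into $C_b(M)$ for all $t>2t_0$, $p\in[1,\infty]$; $U_tf$, $U_t^*f$ are always understood as these continuous functions. Ground states: with $A$ the generator of $\{U_t\}$ and $A^*$ that of $\{U_t^*\}$, $\lambda_0:=\inf\mathrm{Re}(\mathrm{Spec}(-A))=\inf\mathrm{Re}(\mathrm{Spec}(-A^* ))$ is a joint isolated simple eigenvalue of $-A$ and $-A^*$, with $L^2$-normalized, $\mu$-a.e. strictly positive eigenfunctions $\phi_0$ (of $-A$) and $\psi_0$ (of $-A^*$), so $U_t\phi_0=e^{-\lambda_0t}\phi_0$, $U_t^*\psi_0=e^{-\lambda_0t}\psi_0$; they have continuous bounded versions, which are used. Set $\Lambda:=\int\phi_0\psi_0\,d\mu$. The constant $\gamma$: under the assumptions there are constants $C_0,\gamma>0$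 (known result) such that $|e^{\lambda_0t}u_t(x,y)-\Lambda^{-1}\phi_0(x)\psi_0(y)|\le C_0e^{-\gamma t}$ for all $t>2t_0$ and $\mu\otimes\mu$-a.a. $(x,y)$; such a $\gamma$ is fixed. Heat content: $Z(t):=\int U_t\mathbf 1_M\,d\mu=\int U_t^*\mathbf 1_M\,d\mu\in(0,\infty]$. If $Z(t_1)<\infty$ for some $t_1\ge t_0$, then $\phi_0,\psi_0\in L^1(M,\mu)$ and one defines the probability measures $m(E)=\int_E\psi_0\,d\mu/\int_M\psi_0\,d\mu$ and $m^*(E)=\int_E\phi_0\,d\mu/\int_M\phi_0\,d\mu$. Exhausting family: a family $\{K_t:t\ge t_1\}$ (for some $t_1\ge 0$) of compact subsets of $M$ with $K_t\subset K_s$ for $t_1\le t<s$, $\bigcup_{t\ge t_1}K_t=M$, and such that every compact $K\subset M$ is contained in some $K_t$.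
   Formalization: The function h is additionally assumed left-continuous on (t_0,∞); without this h(h^{-1}(s)) ≥ s can fail and (a) is false, e.g. for the harmonic oscillator on R with a right-continuous step family K_t of rapidly growing intervals. *)

theory Defs
  imports "HOL-Probability.Probability"
begin

subsection \<open>Measures on the state space\<close>

definition locally_finite_measure :: "'a::topological_space measure \<Rightarrow> bool" where
  "locally_finite_measure \<mu> \<longleftrightarrow> (\<forall>x. \<exists>V. open V \<and> x \<in> V \<and> emeasure \<mu> V < \<infinity>)"

definition measure_support :: "'a::topological_space measure \<Rightarrow> 'a set" where
  "measure_support \<mu> = {x. \<forall>V. open V \<longrightarrow> x \<in> V \<longrightarrow> 0 < emeasure \<mu> V}"

definition probs_supported_in :: "'a::topological_space set \<Rightarrow> 'a measure set" where
  "probs_supported_in S = {\<sigma>. sets \<sigma> = sets borel \<and> prob_space \<sigma> \<and> measure_support \<sigma> \<subseteq> S}"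

subsection \<open>Lebesgue spaces\<close>

text \<open>Elements of \<open>L\<^sup>p(M, \<mu>)\<close> are represented by measurable functions; equality in
  \<open>L\<^sup>p\<close> is equality almost everywhere. The exponent ranges over \<open>[1, \<infinity>]\<close>.\<close>

definition Lp_space :: "'a measure \<Rightarrow> ennreal \<Rightarrow> ('a \<Rightarrow> 'b::{banach, second_countable_topology}) set" where
  "Lp_space \<mu> p = {f \<in> borel_measurable \<mu>.
     if p = \<infinity> then (\<exists>c. AE x in \<mu>. norm (f x) \<le> c)
     else integrable \<mu> (\<lambda>x. norm (f x) powr enn2real p)}"

definition Lp_norm :: "'a measure \<Rightarrow> ennreal \<Rightarrow> ('a \<Rightarrow> 'b::{banach, second_countable_topology}) \<Rightarrow> real" where
  "Lp_norm \<mu> p f =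
     (if p = \<infinity> then enn2real (esssup \<mu> (\<lambda>x. ennreal (norm (f x))))
      else (LINT x|\<mu>. norm (f x) powr enn2real p) powr (1 / enn2real p))"

text \<open>Spectral theory takes place in the complex Hilbert space \<open>L\<^sup>2(M, \<mu>)\<close>.\<close>

abbreviation L2 :: "'a measure \<Rightarrow> ('a \<Rightarrow> complex) set" where
  "L2 \<mu> \<equiv> Lp_space \<mu> 2"

abbreviation L2_norm :: "'a measure \<Rightarrow> ('a \<Rightarrow> complex) \<Rightarrow> real" where
  "L2_norm \<mu> \<equiv> Lp_norm \<mu> 2"

definition L2_inner :: "'a measure \<Rightarrow> ('a \<Rightarrow> complex) \<Rightarrow> ('a \<Rightarrow> complex) \<Rightarrow> complex" where
  "L2_inner \<mu> f g = (LINT x|\<mu>. f x * cnj (g x))"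

definition Cb :: "('a::topological_space \<Rightarrow> 'b::real_normed_vector) set" where
  "Cb = {g. continuous_on UNIV g \<and> bounded (range g)}"

subsection \<open>Operators and semigroups on the space of square integrable functions\<close>

definition bounded_op_L2 :: "'a measure \<Rightarrow> (('a \<Rightarrow> complex) \<Rightarrow> ('a \<Rightarrow> complex)) \<Rightarrow> bool" where
  "bounded_op_L2 \<mu> T \<longleftrightarrow>
     (\<forall>f\<in>L2 \<mu>. T f \<in> L2 \<mu>) \<and>
     (\<forall>f\<in>L2 \<mu>. \<forall>g\<in>L2 \<mu>. \<forall>a b. AE x in \<mu>. T (\<lambda>y. a * f y + b * g y) x = a * T f x + b * T g x) \<and>
     (\<exists>c. \<forall>f\<in>L2 \<mu>. L2_norm \<mu> (T f) \<le> c * L2_norm \<mu> f)"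

definition compact_op_L2 :: "'a measure \<Rightarrow> (('a \<Rightarrow> complex) \<Rightarrow> ('a \<Rightarrow> complex)) \<Rightarrow> bool" where
  "compact_op_L2 \<mu> T \<longleftrightarrow>
     (\<forall>f :: nat \<Rightarrow> 'a \<Rightarrow> complex. (\<forall>n. f n \<in> L2 \<mu> \<and> L2_norm \<mu> (f n) \<le> 1) \<longrightarrow>
        (\<exists>g\<in>L2 \<mu>. \<exists>r :: nat \<Rightarrow> nat. strict_mono r \<and>
           (\<lambda>n. L2_norm \<mu> (\<lambda>x. T (f (r n)) x - g x)) \<longlonglongrightarrow> 0))"

definition adjoint_ops_L2 ::
  "'a measure \<Rightarrow> (('a \<Rightarrow> complex) \<Rightarrow> ('a \<Rightarrow> complex)) \<Rightarrow> (('a \<Rightarrow> complex) \<Rightarrow> ('a \<Rightarrow> complex)) \<Rightarrow> bool" where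
  "adjoint_ops_L2 \<mu> T S \<longleftrightarrow> bounded_op_L2 \<mu> S \<and>
     (\<forall>f\<in>L2 \<mu>. \<forall>g\<in>L2 \<mu>. L2_inner \<mu> (T f) g = L2_inner \<mu> f (S g))"

definition C0_semigroup_L2 :: "'a measure \<Rightarrow> (real \<Rightarrow> ('a \<Rightarrow> complex) \<Rightarrow> ('a \<Rightarrow> complex)) \<Rightarrow> bool" where
  "C0_semigroup_L2 \<mu> T \<longleftrightarrow>
     (\<forall>t\<ge>0. bounded_op_L2 \<mu> (T t)) \<and>
     (\<forall>f\<in>L2 \<mu>. AE x in \<mu>. T 0 f x = f x) \<and>
     (\<forall>s\<ge>0. \<forall>t\<ge>0. \<forall>f\<in>L2 \<mu>. AE x in \<mu>. T (s + t) f x = T s (T t f) x) \<and>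
     (\<forall>f\<in>L2 \<mu>. ((\<lambda>t. L2_norm \<mu> (\<lambda>x. T t f x - f x)) \<longlongrightarrow> 0) (at_right 0))"

text \<open>The generator \<open>A\<close> is unbounded, and only determined up to null sets; it is given by its
  graph: \<open>generator \<mu> T f g\<close> means that \<open>f\<close> is in the domain of \<open>A\<close> and \<open>A f = g\<close>.\<close>

definition generator ::
  "'a measure \<Rightarrow> (real \<Rightarrow> ('a \<Rightarrow> complex) \<Rightarrow> ('a \<Rightarrow> complex)) \<Rightarrow> ('a \<Rightarrow> complex) \<Rightarrow> ('a \<Rightarrow> complex) \<Rightarrow> bool" where
  "generator \<mu> T f g \<longleftrightarrow> f \<in> L2 \<mu> \<and> g \<in> L2 \<mu> \<and>
     ((\<lambda>t. L2_norm \<mu> (\<lambda>x. (T t f x - f x) / of_real t - g x)) \<longlongrightarrow> 0) (at_right 0)"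

definition neg_generator ::
  "'a measure \<Rightarrow> (real \<Rightarrow> ('a \<Rightarrow> complex) \<Rightarrow> ('a \<Rightarrow> complex)) \<Rightarrow> ('a \<Rightarrow> complex) \<Rightarrow> ('a \<Rightarrow> complex) \<Rightarrow> bool" where
  "neg_generator \<mu> T f g \<longleftrightarrow> generator \<mu> T f (\<lambda>x. - g x)"

text \<open>Spectrum of an operator on \<open>L\<^sup>2\<close> given by its graph \<open>B\<close>: \<open>z\<close> is in the resolvent set iff
  \<open>z - B\<close> is a bijection from the domain onto \<open>L\<^sup>2\<close> with bounded inverse.\<close>

definition resolvent_set_L2 ::
  "'a measure \<Rightarrow> (('a \<Rightarrow> complex) \<Rightarrow> ('a \<Rightarrow> complex) \<Rightarrow> bool) \<Rightarrow> complex set" where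
  "resolvent_set_L2 \<mu> B = {z.
     (\<forall>f h. B f h \<longrightarrow> (AE x in \<mu>. z * f x - h x = 0) \<longrightarrow> (AE x in \<mu>. f x = 0)) \<and>
     (\<exists>c. \<forall>g\<in>L2 \<mu>. \<exists>f h. B f h \<and> (AE x in \<mu>. z * f x - h x = g x) \<and> L2_norm \<mu> f \<le> c * L2_norm \<mu> g)}"

definition spectrum_L2 ::
  "'a measure \<Rightarrow> (('a \<Rightarrow> complex) \<Rightarrow> ('a \<Rightarrow> complex) \<Rightarrow> bool) \<Rightarrow> complex set" where
  "spectrum_L2 \<mu> B = - resolvent_set_L2 \<mu> B"

text \<open>The generalized eigenspace \<open>\<Union>\<^sub>n ker (z - B)\<^sup>n\<close>. An eigenvalue is simple if this space is
  one-dimensional (algebraic multiplicity one).\<close>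

inductive_set gen_eigenspace_L2 ::
  "'a measure \<Rightarrow> (('a \<Rightarrow> complex) \<Rightarrow> ('a \<Rightarrow> complex) \<Rightarrow> bool) \<Rightarrow> complex \<Rightarrow> ('a \<Rightarrow> complex) set"
  for \<mu> :: "'a measure" and B :: "('a \<Rightarrow> complex) \<Rightarrow> ('a \<Rightarrow> complex) \<Rightarrow> bool" and z :: complex where
  zero: "f \<in> L2 \<mu> \<Longrightarrow> AE x in \<mu>. f x = 0 \<Longrightarrow> f \<in> gen_eigenspace_L2 \<mu> B z"
| step: "B f h \<Longrightarrow> (\<lambda>x. z * f x - h x) \<in> gen_eigenspace_L2 \<mu> B z \<Longrightarrow> f \<in> gen_eigenspace_L2 \<mu> B z"

definition simple_eigenvalue_L2 ::
  "'a measure \<Rightarrow> (('a \<Rightarrow> complex) \<Rightarrow> ('a \<Rightarrow> complex) \<Rightarrow> bool) \<Rightarrow> complex \<Rightarrow> bool" where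
  "simple_eigenvalue_L2 \<mu> B z \<longleftrightarrow>
     (\<exists>e\<in>gen_eigenspace_L2 \<mu> B z. \<not> (AE x in \<mu>. e x = 0) \<and>
        (\<forall>f\<in>gen_eigenspace_L2 \<mu> B z. \<exists>c. AE x in \<mu>. f x = c * e x))"

text \<open>\<open>l\<close> is the bottom of the real part of the spectrum of \<open>-A\<close>, an isolated simple eigenvalue,
  and \<open>\<phi>\<close> is (the continuous bounded version of) the normalized positive eigenfunction.\<close>

definition ground_state ::
  "'a::topological_space measure \<Rightarrow> (real \<Rightarrow> ('a \<Rightarrow> complex) \<Rightarrow> ('a \<Rightarrow> complex)) \<Rightarrow> real \<Rightarrow> ('a \<Rightarrow> real) \<Rightarrow> bool" where
  "ground_state \<mu> T l \<phi> \<longleftrightarrow>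
     l = Inf (Re ` spectrum_L2 \<mu> (neg_generator \<mu> T)) \<and>
     complex_of_real l isolated_in spectrum_L2 \<mu> (neg_generator \<mu> T) \<and>
     simple_eigenvalue_L2 \<mu> (neg_generator \<mu> T) (complex_of_real l) \<and>
     neg_generator \<mu> T (\<lambda>x. complex_of_real (\<phi> x)) (\<lambda>x. complex_of_real (l * \<phi> x)) \<and>
     Lp_norm \<mu> 2 \<phi> = 1 \<and> (AE x in \<mu>. 0 < \<phi> x) \<and> \<phi> \<in> Cb"

subsection \<open>Kernel operators\<close>

definition kernel_op ::
  "'a measure \<Rightarrow> (real \<Rightarrow> 'a \<Rightarrow> 'a \<Rightarrow> real) \<Rightarrow> real \<Rightarrow> ('a \<Rightarrow> 'b::{banach, second_countable_topology}) \<Rightarrow> 'a \<Rightarrow> 'b" where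
  "kernel_op \<mu> u t f x = (LINT y|\<mu>. u t x y *\<^sub>R f y)"

text \<open>Absolute convergence of the integral for almost every \<open>x\<close>; needed because the Bochner
  integral of a non-integrable function is \<open>0\<close>.\<close>

definition kernel_converges ::
  "'a measure \<Rightarrow> (real \<Rightarrow> 'a \<Rightarrow> 'a \<Rightarrow> real) \<Rightarrow> real \<Rightarrow> ('a \<Rightarrow> 'b::{banach, second_countable_topology}) \<Rightarrow> bool" where
  "kernel_converges \<mu> u t f \<longleftrightarrow> (AE x in \<mu>. integrable \<mu> (\<lambda>y. u t x y *\<^sub>R f y))"

text \<open>The kernel of the adjoint \<open>U\<^sub>t\<^sup>*\<close>.\<close>

definition adj_kernel :: "(real \<Rightarrow> 'a \<Rightarrow> 'a \<Rightarrow> real) \<Rightarrow> real \<Rightarrow> 'a \<Rightarrow> 'a \<Rightarrow> real" where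
  "adj_kernel u t x y = u t y x"

definition kernel_semigroup ::
  "'a measure \<Rightarrow> (real \<Rightarrow> 'a \<Rightarrow> 'a \<Rightarrow> real) \<Rightarrow> real \<Rightarrow> ('a \<Rightarrow> complex) \<Rightarrow> 'a \<Rightarrow> complex" where
  "kernel_semigroup \<mu> u t f = (if t = 0 then f else kernel_op \<mu> u t f)"

definition measurable_kernel :: "'a measure \<Rightarrow> (real \<Rightarrow> 'a \<Rightarrow> 'a \<Rightarrow> real) \<Rightarrow> bool" where
  "measurable_kernel \<mu> u \<longleftrightarrow> (\<forall>t>0. (\<lambda>(x, y). u t x y) \<in> borel_measurable (\<mu> \<Otimes>\<^sub>M \<mu>))"

definition positivity_preserving :: "'a measure \<Rightarrow> (real \<Rightarrow> 'a \<Rightarrow> 'a \<Rightarrow> real) \<Rightarrow> real \<Rightarrow> bool" where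
  "positivity_preserving \<mu> u t \<longleftrightarrow>
     (\<forall>f :: 'a \<Rightarrow> real. f \<in> Lp_space \<mu> 2 \<longrightarrow> (AE x in \<mu>. 0 \<le> f x) \<longrightarrow>
        (AE x in \<mu>. 0 \<le> kernel_op \<mu> u t f x))"

definition positivity_improving :: "'a measure \<Rightarrow> (real \<Rightarrow> 'a \<Rightarrow> 'a \<Rightarrow> real) \<Rightarrow> real \<Rightarrow> bool" where
  "positivity_improving \<mu> u t \<longleftrightarrow>
     (\<forall>f :: 'a \<Rightarrow> real. f \<in> Lp_space \<mu> 2 \<longrightarrow> (AE x in \<mu>. 0 \<le> f x) \<longrightarrow> \<not> (AE x in \<mu>. f x = 0) \<longrightarrow>
        (AE x in \<mu>. 0 < kernel_op \<mu> u t f x))"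

definition strong_Feller :: "'a::topological_space measure \<Rightarrow> (real \<Rightarrow> 'a \<Rightarrow> 'a \<Rightarrow> real) \<Rightarrow> bool" where
  "strong_Feller \<mu> u \<longleftrightarrow>
     (\<forall>t>0. \<forall>f :: 'a \<Rightarrow> complex. f \<in> Lp_space \<mu> \<infinity> \<longrightarrow>
        kernel_converges \<mu> u t f \<and> (\<exists>g\<in>Cb. AE x in \<mu>. kernel_op \<mu> u t f x = g x))"

definition bounded_L2_Linf :: "'a measure \<Rightarrow> (('a \<Rightarrow> complex) \<Rightarrow> ('a \<Rightarrow> complex)) \<Rightarrow> bool" where
  "bounded_L2_Linf \<mu> T \<longleftrightarrow>
     (\<forall>f\<in>L2 \<mu>. T f \<in> Lp_space \<mu> \<infinity>) \<and>
     (\<exists>c. \<forall>f\<in>L2 \<mu>. Lp_norm \<mu> \<infinity> (T f) \<le> c * L2_norm \<mu> f)"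

text \<open>Pointwise values of \<open>U\<^sub>t f\<close> are those of its continuous version, which is unique because the
  reference measure has full support.\<close>

definition continuous_version ::
  "'a::topological_space measure \<Rightarrow> ('a \<Rightarrow> 'b::topological_space) \<Rightarrow> 'a \<Rightarrow> 'b" where
  "continuous_version \<mu> f = (THE g. continuous_on UNIV g \<and> (AE x in \<mu>. f x = g x))"

definition semi ::
  "'a::topological_space measure \<Rightarrow> (real \<Rightarrow> 'a \<Rightarrow> 'a \<Rightarrow> real) \<Rightarrow> real \<Rightarrow> ('a \<Rightarrow> 'b::{banach, second_countable_topology}) \<Rightarrow> 'a \<Rightarrow> 'b" where
  "semi \<mu> u t f = continuous_version \<mu> (kernel_op \<mu> u t f)"

abbreviation semi1 ::
  "'a::topological_space measure \<Rightarrow> (real \<Rightarrow> 'a \<Rightarrow> 'a \<Rightarrow> real) \<Rightarrow> real \<Rightarrow> 'a \<Rightarrow> real" where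
  "semi1 \<mu> u t \<equiv> semi \<mu> u t (\<lambda>_. 1 :: real)"

definition heat_content :: "'a::topological_space measure \<Rightarrow> (real \<Rightarrow> 'a \<Rightarrow> 'a \<Rightarrow> real) \<Rightarrow> real \<Rightarrow> ennreal" where
  "heat_content \<mu> u t = (\<integral>\<^sup>+ x. ennreal (semi1 \<mu> u t x) \<partial>\<mu>)"

text \<open>The probability measure with \<open>\<mu>\<close>-density proportional to \<open>\<psi>\<close>.\<close>

definition normalized_measure :: "'a measure \<Rightarrow> ('a \<Rightarrow> real) \<Rightarrow> 'a measure" where
  "normalized_measure \<mu> \<psi> = density \<mu> (\<lambda>x. ennreal (\<psi> x / (LINT y|\<mu>. \<psi> y)))"

subsection \<open>Exhausting families and the propagation rate\<close>

definition exhausting_family :: "real \<Rightarrow> (real \<Rightarrow> 'a::topological_space set) \<Rightarrow> bool" where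
  "exhausting_family a K \<longleftrightarrow> 0 \<le> a \<and> (\<forall>t\<ge>a. compact (K t)) \<and>
     (\<forall>t s. a \<le> t \<longrightarrow> t < s \<longrightarrow> K t \<subseteq> K s) \<and> (\<Union>t\<in>{a..}. K t) = UNIV \<and>
     (\<forall>C. compact C \<longrightarrow> (\<exists>t\<ge>a. C \<subseteq> K t))"

text \<open>Extended real values, so that \<open>h t = \<infinity>\<close> if \<open>K t\<close> is empty.\<close>

definition h_fun :: "('a \<Rightarrow> real) \<Rightarrow> ('a \<Rightarrow> real) \<Rightarrow> (real \<Rightarrow> 'a set) \<Rightarrow> real \<Rightarrow> ereal" where
  "h_fun \<phi> \<psi> K t = min (INF x\<in>K t. ereal (\<phi> x)) (INF x\<in>K t. ereal (\<psi> x))"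

text \<open>For a nonincreasing \<open>h\<close> that is left-continuous on \<open>(t0, \<infinity>)\<close> this generalized inverse
  satisfies \<open>s \<le> h (gen_inverse t0 h s)\<close> for \<open>0 < s \<le> h t0\<close> (provided the set is nonempty); at a
  point where \<open>h\<close> jumps down from its left limit the inequality fails.\<close>

definition gen_inverse :: "real \<Rightarrow> (real \<Rightarrow> ereal) \<Rightarrow> real \<Rightarrow> real" where
  "gen_inverse t0 h s = Inf {t. t0 \<le> t \<and> h t < ereal s}"

definition eta :: "real \<Rightarrow> real \<Rightarrow> (real \<Rightarrow> ereal) \<Rightarrow> real \<Rightarrow> real" where
  "eta t0 \<gamma> h t = gen_inverse t0 h (exp (- \<gamma> * t))"

text \<open>The convention \<open>- log \<infinity> = - \<infinity>\<close> applies when \<open>h t0 = \<infinity>\<close>.\<close>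

definition t0_tilde :: "real \<Rightarrow> real \<Rightarrow> (real \<Rightarrow> ereal) \<Rightarrow> real" where
  "t0_tilde t0 \<gamma> h = (if h t0 = \<infinity> then 0 else max 0 (- (1 / \<gamma>) * ln (real_of_ereal (h t0))))"

subsection \<open>Progressive ground state domination and quasi-ergodicity\<close>

text \<open>\<open>pGSD\<close> for two semigroups simultaneously, with common constants; \<open>l\<close> is the common
  ground state eigenvalue and \<open>\<phi>\<close>, \<open>\<psi>\<close> are the ground states of \<open>U\<close> and \<open>U\<^sup>*\<close>.\<close>

definition pGSD_both ::
  "'a::topological_space measure \<Rightarrow> (real \<Rightarrow> 'a \<Rightarrow> 'a \<Rightarrow> real) \<Rightarrow> real \<Rightarrow> ('a \<Rightarrow> real) \<Rightarrow> ('a \<Rightarrow> real)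
    \<Rightarrow> real \<Rightarrow> (real \<Rightarrow> 'a set) \<Rightarrow> bool" where
  "pGSD_both \<mu> u l \<phi> \<psi> a L \<longleftrightarrow> exhausting_family a L \<and>
     (\<exists>C>0. \<exists>t'>0. \<forall>t\<ge>max t' a. \<forall>x\<in>L t.
        semi1 \<mu> u t x \<le> C * exp (- l * t) * \<phi> x \<and>
        semi1 \<mu> (adj_kernel u) t x \<le> C * exp (- l * t) * \<psi> x)"

definition quasi_ergodic_error ::
  "'a::topological_space measure \<Rightarrow> (real \<Rightarrow> 'a \<Rightarrow> 'a \<Rightarrow> real) \<Rightarrow> 'a measure \<Rightarrow> ennreal \<Rightarrow> 'a set \<Rightarrow> real \<Rightarrow> ennreal" where
  "quasi_ergodic_error \<mu> u m p S t =
     (SUP \<sigma>\<in>probs_supported_in S. SUP f\<in>{f :: 'a \<Rightarrow> complex. f \<in> Lp_space \<mu> p \<and> Lp_norm \<mu> p f \<le> 1}.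
        ennreal (cmod ((LINT x|\<sigma>. semi \<mu> u t f x) / complex_of_real (LINT x|\<sigma>. semi1 \<mu> u t x)
                       - (LINT x|m. f x))))"

end

theory Submission
  imports Defs
begin

text \<open>Write \<open>\<kappa> = \<Lambda>\<^sup>-\<^sup>1\<close>, \<open>\<lambda> = \<lambda>\<^sub>0\<close>, \<open>\<phi> = \<phi>\<^sub>0\<close> and \<open>\<psi> = \<psi>\<^sub>0\<close>. Everything rests on one estimate
  (\<open>semi_asymptotics\<close>): for \<open>t > 2 t\<^sub>0 + t\<^sub>1\<close> and all points \<open>x\<close>,
  \<open>\<bar>e\<^bsup>\<lambda> t\<^esup> U\<^sub>t f(x) - \<kappa> \<phi>(x) \<integral> \<psi> f d\<mu>\<bar> \<le> D e\<^bsup>-\<gamma> t\<^esup>\<close>,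
  with one constant \<open>D\<close> for all \<open>f\<close> in the unit balls of all spaces \<open>L\<^sup>p(\<mu>)\<close>. The given asymptotics of the
  kernel yield such a bound for \<open>U\<^sub>s F\<close> with \<open>F\<close> bounded in \<open>L\<^sup>1\<close>. Finite heat content is what reduces to
  this situation: as \<open>\<bar>f\<bar> \<le> 1 + \<bar>f\<bar>\<^sup>p\<close>, the function \<open>f\<close> is dominated by \<open>1 + g\<close> with \<open>g\<close> in the unit ball of
  \<open>L\<^sup>1\<close>, and so \<open>F = U\<^sub>t f\<close> at the time \<open>t = t\<^sub>1\<close> lies in a fixed ball of \<open>L\<^sup>1\<close>. The remaining ingredient, the
  eigenvalue equations of \<open>\<phi>\<close> and \<open>\<psi>\<close>, is also read off from the asymptotics of the kernel, by letting \<open>t\<close>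
  tend to infinity in \<open>U\<^bsub>s + t\<^esub> 1\<^sub>A = U\<^sub>s (U\<^sub>t 1\<^sub>A)\<close> (\<open>eigenfunction\<close>).

  For \<open>f = 1\<close> the estimate gives domination by the ground state wherever \<open>\<phi>(x) \<ge> e\<^bsup>-\<gamma> t\<^esup>\<close>
  (\<open>semi1_le_ground_state\<close>), in particular on \<open>K (\<eta> t)\<close>. For quasi-ergodicity
  (\<open>quasi_ergodic_error_le\<close>) it is integrated over \<open>\<sigma>\<close> and applied to numerator and denominator. The
  denominator satisfies \<open>e\<^bsup>\<lambda> t\<^esup> \<sigma>(U\<^sub>t 1) \<ge> \<sigma>(\<phi>) / sup \<phi>\<close>, because \<open>\<phi> = e\<^bsup>\<lambda> t\<^esup> U\<^sub>t \<phi>\<close>, and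
  \<open>\<sigma>(\<phi>) \<ge> e\<^bsup>-\<gamma> t / 2\<^esup>\<close> if \<open>\<sigma>\<close> is supported in \<open>K (\<eta> (t / 2))\<close>; dividing \<open>e\<^bsup>-\<gamma> t\<^esup>\<close> by this leaves the
  rate \<open>\<gamma> / 2\<close>.

  That \<open>\<phi>\<close> and \<open>\<psi>\<close> are at least \<open>e\<^bsup>-\<gamma> t\<^esup>\<close> on \<open>K (\<eta> t)\<close> follows from left continuity of \<open>h\<close>, and the sets
  \<open>K (\<eta> t)\<close> exhaust the space since \<open>h\<close> is positive and tends to \<open>0\<close> (\<open>exhausting_family_eta\<close>); the latter
  uses that \<open>U\<^sub>t 1\<close> or \<open>U\<^sub>t\<^sup>* 1\<close> becomes small outside compact sets while the space is not compact. All
  assumptions on the kernel that are used are invariant under transposition, so every statement about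
  \<open>U\<^sub>t\<close> and \<open>\<phi>\<close> is also one about \<open>U\<^sub>t\<^sup>*\<close> and \<open>\<psi>\<close>.\<close>

section \<open>Measures with full support and locally finite measures\<close>

lemma full_support_everywhere:
  fixes \<mu> :: "'a::topological_space measure"
  assumes sets: "sets \<mu> = sets borel" and supp: "measure_support \<mu> = UNIV"
    and ae: "AE x in \<mu>. P x" and op: "open {x. \<not> P x}"
  shows "P x"
proof (rule ccontr)
  assume "\<not> P x"
  have sp: "space \<mu> = UNIV" using sets_eq_imp_space_eq[OF sets] by simp
  have "{x. \<not> P x} \<in> sets \<mu>" using op sets by simp
  then have "emeasure \<mu> {x. \<not> P x} = 0"
    using ae by (subst (asm) AE_iff_measurable[of "{x. \<not> P x}"]) (auto simp: sp)
  moreover have "0 < emeasure \<mu> {x. \<not> P x}"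
    using supp op \<open>\<not> P x\<close> unfolding measure_support_def by blast
  ultimately show False by simp
qed

lemma continuous_version_eqI:
  fixes \<mu> :: "'a::topological_space measure" and g :: "'a \<Rightarrow> 'b::t2_space"
  assumes sets: "sets \<mu> = sets borel" and supp: "measure_support \<mu> = UNIV"
    and g: "continuous_on UNIV g" "AE x in \<mu>. f x = g x"
  shows "continuous_version \<mu> f = g"
  unfolding continuous_version_def
proof (rule the_equality)
  show "continuous_on UNIV g \<and> (AE x in \<mu>. f x = g x)" using g by simp
  fix g' assume g': "continuous_on UNIV g' \<and> (AE x in \<mu>. f x = g' x)"
  have "g' x = g x" for x
  proof (rule full_support_everywhere[OF sets supp, where P = "\<lambda>x. g' x = g x"])
    from g' have "AE x in \<mu>. f x = g' x" by simp
    with g(2) show "AE x in \<mu>. g' x = g x" by eventually_elim simp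
    show "open {x. \<not> g' x = g x}" using g' g(1) by (intro open_Collect_neq) auto
  qed
  then show "g' = g" by auto
qed

lemma full_support_le:
  fixes \<mu> :: "'a::topological_space measure" and f g :: "'a \<Rightarrow> real"
  assumes "sets \<mu> = sets borel" "measure_support \<mu> = UNIV"
    and "continuous_on UNIV f" "continuous_on UNIV g" "AE x in \<mu>. f x \<le> g x"
  shows "f x \<le> g x"
proof (rule full_support_everywhere[OF assms(1,2,5)])
  have "{x. \<not> f x \<le> g x} = {x. g x < f x}" by auto
  then show "open {x. \<not> f x \<le> g x}" using open_Collect_less[OF assms(4,3)] by simp
qed

lemma locally_finite_countable_base:
  fixes \<mu> :: "'a::second_countable_topology measure"
  assumes "locally_finite_measure \<mu>" and sets: "sets \<mu> = sets borel"
  obtains B where "countable B" "\<And>b. b \<in> B \<Longrightarrow> open b" "\<And>b. b \<in> B \<Longrightarrow> emeasure \<mu> b < \<infinity>"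
    "\<And>S x. open S \<Longrightarrow> x \<in> S \<Longrightarrow> \<exists>b\<in>B. x \<in> b \<and> b \<subseteq> S"
proof -
  obtain B0 :: "'a set set" where B0: "countable B0" "topological_basis B0"
    using ex_countable_basis by auto
  define B where "B = {b \<in> B0. emeasure \<mu> b < \<infinity>}"
  have base: "\<exists>b\<in>B. x \<in> b \<and> b \<subseteq> S" if S: "open S" "x \<in> S" for S x
  proof -
    obtain V where V: "open V" "x \<in> V" "emeasure \<mu> V < \<infinity>"
      using assms(1) unfolding locally_finite_measure_def by blast
    obtain b where b: "b \<in> B0" "x \<in> b" "b \<subseteq> S \<inter> V"
      using topological_basisE[OF B0(2), of "S \<inter> V" x] S V by auto
    have "emeasure \<mu> b \<le> emeasure \<mu> V" using b V sets by (intro emeasure_mono) auto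
    then have "emeasure \<mu> b < \<infinity>" using V by (auto intro: le_less_trans)
    then show ?thesis using b unfolding B_def by auto
  qed
  show ?thesis
  proof (rule that[OF _ _ _ base])
    show "countable B" using B0(1) unfolding B_def by (auto intro: countable_subset[rotated])
    show "open b" if "b \<in> B" for b
      using that B0(2) topological_basis_open unfolding B_def by auto
    show "emeasure \<mu> b < \<infinity>" if "b \<in> B" for b using that unfolding B_def by auto
  qed
qed

lemma locally_finite_imp_sigma_finite:
  fixes \<mu> :: "'a::second_countable_topology measure"
  assumes "locally_finite_measure \<mu>" and sets: "sets \<mu> = sets borel"
  shows "sigma_finite_measure \<mu>"
proof -
  obtain B where B: "countable B" "\<And>b. b \<in> B \<Longrightarrow> open b" "\<And>b. b \<in> B \<Longrightarrow> emeasure \<mu> b < \<infinity>"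
    "\<And>S x. open S \<Longrightarrow> x \<in> S \<Longrightarrow> \<exists>b\<in>B. x \<in> b \<and> b \<subseteq> S"
    using locally_finite_countable_base[OF assms] by metis
  have "\<Union>B = space \<mu>"
    using B(4)[of UNIV] sets_eq_imp_space_eq[OF sets] by auto
  then show ?thesis
    using B sets by (intro sigma_finite_measure.intro exI[of _ B]) (auto simp: less_top)
qed

section \<open>Kernels of positivity preserving operators are nonnegative\<close>

text \<open>The Jordan parts of the signed measure with density \<open>f\<close> are finite Borel measures on a Polish
  space, hence outer regular; so the inequality between them passes from open sets to all Borel
  sets, in particular to the set where \<open>f\<close> is negative.\<close>

lemma AE_nonneg_of_open_set_integrals:
  fixes \<mu> :: "'a::polish_space measure" and f :: "'a \<Rightarrow> real"
  assumes sets: "sets \<mu> = sets borel" and f: "integrable \<mu> f"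
    and open_nonneg: "\<And>S. open S \<Longrightarrow> 0 \<le> (LINT x:S|\<mu>. f x)"
  shows "AE x in \<mu>. 0 \<le> f x"
proof -
  have f_meas[measurable]: "f \<in> borel_measurable \<mu>" using f by auto
  define P where "P = density \<mu> (\<lambda>x. ennreal (f x))"
  define N where "N = density \<mu> (\<lambda>x. ennreal (- f x))"
  have fin: "(\<integral>\<^sup>+x. ennreal (f x) \<partial>\<mu>) < \<infinity>" "(\<integral>\<^sup>+x. ennreal (- f x) \<partial>\<mu>) < \<infinity>"
    using f unfolding real_integrable_def by (auto simp: less_top)
  have sets_PN: "sets P = sets borel" "sets N = sets borel"
    unfolding P_def N_def using sets by auto
  have le_open: "emeasure N S \<le> emeasure P S" if S: "open S" for S
  proof -
    have [measurable]: "S \<in> sets \<mu>" using S sets by auto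
    have int: "integrable \<mu> (\<lambda>x. indicator S x *\<^sub>R f x)"
      by (rule integrable_mult_indicator) (use f in auto)
    have eq: "emeasure P S = (\<integral>\<^sup>+x. ennreal (indicator S x *\<^sub>R f x) \<partial>\<mu>)"
      "emeasure N S = (\<integral>\<^sup>+x. ennreal (- (indicator S x *\<^sub>R f x)) \<partial>\<mu>)"
      unfolding P_def N_def
      by (auto simp: emeasure_density intro!: nn_integral_cong split: split_indicator)
    have finS: "emeasure P S < top" "emeasure N S < top"
      using int unfolding eq real_integrable_def by (auto simp: less_top)
    have "0 \<le> enn2real (emeasure P S) - enn2real (emeasure N S)"
      using open_nonneg[OF S] real_lebesgue_integral_def[OF int]
      unfolding eq set_lebesgue_integral_def by simp
    then have "ennreal (enn2real (emeasure N S)) \<le> ennreal (enn2real (emeasure P S))"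
      by (intro ennreal_leI) simp
    then show ?thesis using finS by simp
  qed
  define E where "E = {x. f x < 0}"
  have E[measurable]: "E \<in> sets \<mu>"
  proof -
    have "E = {x \<in> space \<mu>. f x < 0}"
      unfolding E_def using sets_eq_imp_space_eq[OF sets] by auto
    show ?thesis unfolding \<open>E = {x \<in> space \<mu>. f x < 0}\<close> by measurable
  qed
  have zero: "(\<lambda>x. ennreal (f x) * indicator E x) = (\<lambda>x. 0)"
    by (auto simp: E_def ennreal_neg fun_eq_iff split: split_indicator)
  have P0: "emeasure P E = 0"
    unfolding P_def by (subst emeasure_density) (simp_all add: zero)
  have "emeasure P (space P) \<noteq> \<infinity>"
    unfolding P_def using fin sets by (auto simp: emeasure_density less_top cong: nn_integral_cong)
  then have "emeasure P E = (INF U\<in>{U. E \<subseteq> U \<and> open U}. emeasure P U)"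
    using E sets by (intro outer_regular[OF sets_PN(1)]) auto
  moreover have "emeasure N E \<le> (INF U\<in>{U. E \<subseteq> U \<and> open U}. emeasure P U)"
  proof (rule INF_greatest)
    fix U assume "U \<in> {U. E \<subseteq> U \<and> open U}"
    then have "emeasure N E \<le> emeasure N U" "emeasure N U \<le> emeasure P U"
      using sets_PN by (auto intro!: emeasure_mono le_open)
    then show "emeasure N E \<le> emeasure P U" by order
  qed
  ultimately have "emeasure N E = 0" using P0 by simp
  then have "AE x in \<mu>. ennreal (- f x) * indicator E x = 0"
    unfolding N_def by (subst (asm) emeasure_density) (auto simp: nn_integral_0_iff_AE)
  then show ?thesis
    by eventually_elim (auto simp: E_def split: split_indicator_asm)
qed

text \<open>An exceptional null set can be chosen uniformly for countably many sets only. Finite unions from a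
  countable base are enough, because every open set is an increasing union of them.\<close>

lemma set_integral_nonneg_of_countable_base:
  fixes \<mu> :: "'a::second_countable_topology measure" and f :: "'a \<Rightarrow> real"
  assumes sets: "sets \<mu> = sets borel" and f: "integrable \<mu> f"
    and B: "countable B" "\<And>b. b \<in> B \<Longrightarrow> open b"
      "\<And>S x. open S \<Longrightarrow> x \<in> S \<Longrightarrow> \<exists>b\<in>B. x \<in> b \<and> b \<subseteq> S"
    and nonneg: "\<And>F. finite F \<Longrightarrow> F \<subseteq> B \<Longrightarrow> 0 \<le> (LINT x:\<Union>F|\<mu>. f x)"
    and S: "open S"
  shows "0 \<le> (LINT x:S|\<mu>. f x)"
proof -
  define BS where "BS = {b \<in> B. b \<subseteq> S}"
  have count: "countable BS" using B(1) unfolding BS_def by (auto intro: countable_subset[rotated])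
  have S_eq: "S = \<Union>BS" unfolding BS_def using B(3)[OF S] by blast
  show ?thesis
  proof (cases "BS = {}")
    case True
    then show ?thesis using S_eq by (simp add: set_lebesgue_integral_def)
  next
    case False
    define e where "e = from_nat_into BS"
    have e: "range e = BS" unfolding e_def using range_from_nat_into[OF False count] .
    define A where "A n = \<Union>(e ` {..n})" for n
    have A_Un: "(\<Union>n. A n) = S" unfolding A_def S_eq e[symmetric] by auto
    have "(\<lambda>n. LINT x:A n|\<mu>. f x) \<longlonglongrightarrow> (LINT x:(\<Union>n. A n)|\<mu>. f x)"
    proof (rule set_integral_cont_up)
      show "A n \<in> sets \<mu>" for n
      proof -
        have "open (e m)" for m using e B(2) unfolding BS_def by blast
        then show ?thesis unfolding A_def sets by (intro borel_open open_UN) auto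
      qed
      show "incseq A" unfolding A_def incseq_def by fastforce
      show "set_integrable \<mu> (\<Union>n. A n) f"
        unfolding A_Un set_integrable_def using f S sets
        by (intro integrable_mult_indicator) auto
    qed
    moreover have "0 \<le> (LINT x:A n|\<mu>. f x)" for n
      unfolding A_def using e by (intro nonneg) (auto simp: BS_def)
    ultimately show ?thesis unfolding A_Un by (metis LIMSEQ_le_const)
  qed
qed

section \<open>Nonnegative kernels acting on nonnegative functions\<close>

text \<open>On functions with values in \<open>[0, \<infinity>]\<close> the semigroup law, duality and monotone limits can be stated
  without any concern for convergence. The estimates are made there and transferred afterwards to the
  Bochner integrals of \<open>kernel_op\<close>. Note that \<open>ennreal\<close> truncates negative kernel values to \<open>0\<close>; this
  is harmless because the kernels in question are nonnegative almost everywhere.\<close>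

definition nn_kernel_op ::
  "'a measure \<Rightarrow> (real \<Rightarrow> 'a \<Rightarrow> 'a \<Rightarrow> real) \<Rightarrow> real \<Rightarrow> ('a \<Rightarrow> ennreal) \<Rightarrow> 'a \<Rightarrow> ennreal" where
  "nn_kernel_op \<mu> u t f x = (\<integral>\<^sup>+y. ennreal (u t x y) * f y \<partial>\<mu>)"

locale measurable_kernel_family = sigma_finite_measure \<mu> for \<mu> :: "'a measure" +
  fixes u :: "real \<Rightarrow> 'a \<Rightarrow> 'a \<Rightarrow> real"
  assumes kernel_measurable: "measurable_kernel \<mu> u"
begin

sublocale pair: pair_sigma_finite \<mu> \<mu> ..

abbreviation P where "P \<equiv> nn_kernel_op \<mu> u"
abbreviation Q where "Q \<equiv> nn_kernel_op \<mu> (adj_kernel u)"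

lemma measurable_u: "0 < t \<Longrightarrow> (\<lambda>(x, y). u t x y) \<in> borel_measurable (\<mu> \<Otimes>\<^sub>M \<mu>)"
  using kernel_measurable unfolding measurable_kernel_def by auto

lemma measurable_kernel_adj: "measurable_kernel \<mu> (adj_kernel u)"
  unfolding measurable_kernel_def adj_kernel_def
proof (intro allI impI)
  fix t :: real assume "0 < t"
  note [measurable] = measurable_u[OF this]
  show "(\<lambda>(x, y). u t y x) \<in> borel_measurable (\<mu> \<Otimes>\<^sub>M \<mu>)" by measurable
qed

lemma measurable_kernel_family_adj: "measurable_kernel_family \<mu> (adj_kernel u)"
  by unfold_locales (rule measurable_kernel_adj)

lemma measurable_P:
  assumes "0 < t" "f \<in> borel_measurable \<mu>"
  shows "P t f \<in> borel_measurable \<mu>"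
proof -
  note [measurable] = measurable_u[OF assms(1)] assms(2)
  show ?thesis unfolding nn_kernel_op_def[abs_def] by measurable
qed

lemma P_add:
  assumes "0 < t" and [measurable]: "f \<in> borel_measurable \<mu>" "g \<in> borel_measurable \<mu>"
    and x: "x \<in> space \<mu>"
  shows "P t (\<lambda>y. f y + g y) x = P t f x + P t g x"
proof -
  note [measurable] = measurable_u[OF assms(1)] x
  show ?thesis unfolding nn_kernel_op_def by (subst nn_integral_add[symmetric]) (auto simp: distrib_left)
qed

lemma P_cmult:
  assumes "0 < t" and [measurable]: "f \<in> borel_measurable \<mu>" and x: "x \<in> space \<mu>"
  shows "P t (\<lambda>y. c * f y) x = c * P t f x"
proof -
  note [measurable] = measurable_u[OF assms(1)] x
  show ?thesis unfolding nn_kernel_op_def by (subst nn_integral_cmult[symmetric]) (auto simp: mult_ac)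
qed

lemma P_mono_AE:
  assumes "AE y in \<mu>. f y \<le> g y"
  shows "P t f x \<le> P t g x"
  unfolding nn_kernel_op_def
  by (rule nn_integral_mono_AE) (use assms in eventually_elim, auto intro: mult_left_mono)

lemma P_cong_AE:
  assumes "AE y in \<mu>. f y = g y"
  shows "P t f x = P t g x"
  unfolding nn_kernel_op_def
  by (rule nn_integral_cong_AE) (use assms in eventually_elim, auto)

lemma P_SUP:
  assumes "0 < t" and [measurable]: "\<And>i. U i \<in> borel_measurable \<mu>" and U: "incseq U"
    and x: "x \<in> space \<mu>"
  shows "P t (SUP i. U i) x = (SUP i. P t (U i) x)"
proof -
  note [measurable] = measurable_u[OF assms(1)] x
  have "P t (SUP i. U i) x = (\<integral>\<^sup>+y. (SUP i. ennreal (u t x y) * U i y) \<partial>\<mu>)"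
    unfolding nn_kernel_op_def by (simp add: SUP_mult_left_ennreal image_comp)
  also have "\<dots> = (SUP i. P t (U i) x)"
    unfolding nn_kernel_op_def using U
    by (intro nn_integral_monotone_convergence_SUP) (auto simp: incseq_def le_fun_def intro!: mult_left_mono)
  finally show ?thesis .
qed

lemma P_duality:
  assumes "0 < t" and [measurable]: "f \<in> borel_measurable \<mu>" "g \<in> borel_measurable \<mu>"
  shows "(\<integral>\<^sup>+x. g x * P t f x \<partial>\<mu>) = (\<integral>\<^sup>+y. Q t g y * f y \<partial>\<mu>)"
proof -
  note [measurable] = measurable_u[OF assms(1)]
  have "(\<integral>\<^sup>+x. g x * P t f x \<partial>\<mu>) = (\<integral>\<^sup>+x. \<integral>\<^sup>+y. g x * (ennreal (u t x y) * f y) \<partial>\<mu> \<partial>\<mu>)"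
    unfolding nn_kernel_op_def by (intro nn_integral_cong nn_integral_cmult[symmetric]) auto
  also have "\<dots> = (\<integral>\<^sup>+y. \<integral>\<^sup>+x. g x * (ennreal (u t x y) * f y) \<partial>\<mu> \<partial>\<mu>)"
    by (rule pair.Fubini'[symmetric]) measurable
  also have "\<dots> = (\<integral>\<^sup>+y. Q t g y * f y \<partial>\<mu>)"
    unfolding nn_kernel_op_def adj_kernel_def
    by (intro nn_integral_cong, subst nn_integral_multc[symmetric]) (auto simp: mult_ac)
  finally show ?thesis .
qed

definition chapman_kolmogorov :: bool where
  "chapman_kolmogorov \<longleftrightarrow> (\<forall>s>0. \<forall>t>0. \<forall>f\<in>borel_measurable \<mu>. AE x in \<mu>. P (s + t) f x = P s (P t f) x)"

text \<open>Densities with respect to a \<open>\<sigma>\<close>-finite measure are unique, even where they are infinite.\<close>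

lemma AE_eq_of_nn_integrals:
  assumes [measurable]: "f \<in> borel_measurable \<mu>" "g \<in> borel_measurable \<mu>"
    and "\<And>A. A \<in> sets \<mu> \<Longrightarrow> (\<integral>\<^sup>+x. f x * indicator A x \<partial>\<mu>) = (\<integral>\<^sup>+x. g x * indicator A x \<partial>\<mu>)"
  shows "AE x in \<mu>. (f x :: ennreal) = g x"
proof -
  have "density \<mu> f = density \<mu> g"
    by (rule measure_eqI) (auto simp: emeasure_density assms(3))
  then show ?thesis using density_unique[OF assms(1,2)] by simp
qed

text \<open>Testing against indicators and moving all operators to the other side by Tonelli turns the law for
  the kernel into the law for the transposed kernel.\<close>

lemma chapman_kolmogorov_adj:
  assumes chapman_kolmogorov
  shows "measurable_kernel_family.chapman_kolmogorov \<mu> (adj_kernel u)"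
proof -
  interpret adj: measurable_kernel_family \<mu> "adj_kernel u" by (rule measurable_kernel_family_adj)
  show ?thesis unfolding adj.chapman_kolmogorov_def
  proof (intro allI impI ballI)
    fix s t :: real and g :: "'a \<Rightarrow> ennreal"
    assume st: "0 < s" "0 < t" and g[measurable]: "g \<in> borel_measurable \<mu>"
    note m = measurable_P adj.measurable_P
    show "AE x in \<mu>. Q (s + t) g x = Q s (Q t g) x"
    proof (rule AE_eq_of_nn_integrals)
      fix A assume A[measurable]: "A \<in> sets \<mu>"
      have "AE x in \<mu>. P (t + s) (indicator A) x = P t (P s (indicator A)) x"
        using assms st unfolding chapman_kolmogorov_def by auto
      then have "(\<integral>\<^sup>+x. g x * P (t + s) (indicator A) x \<partial>\<mu>) = (\<integral>\<^sup>+x. g x * P t (P s (indicator A)) x \<partial>\<mu>)"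
        by (intro nn_integral_cong_AE) auto
      then show "(\<integral>\<^sup>+x. Q (s + t) g x * indicator A x \<partial>\<mu>) = (\<integral>\<^sup>+x. Q s (Q t g) x * indicator A x \<partial>\<mu>)"
        using st m by (simp add: P_duality add.commute)
    qed (use st m in auto)
  qed
qed

text \<open>Sets of finite measure are what the semigroup law on \<open>L\<^sup>2\<close> can be applied to; monotone limits along
  an exhaustion by such sets, and then the usual induction over measurable functions, do the rest.\<close>

lemma chapman_kolmogorov_of_finite_sets:
  assumes fin: "\<And>s t A. 0 < s \<Longrightarrow> 0 < t \<Longrightarrow> A \<in> sets \<mu> \<Longrightarrow> emeasure \<mu> A < \<infinity> \<Longrightarrow>
     AE x in \<mu>. P (s + t) (indicator A) x = P s (P t (indicator A)) x"
  shows chapman_kolmogorov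
  unfolding chapman_kolmogorov_def
proof (intro allI impI ballI)
  fix s t :: real and f :: "'a \<Rightarrow> ennreal"
  assume st: "0 < s" "0 < t" and f: "f \<in> borel_measurable \<mu>"
  then have st': "0 < s + t" by simp
  have monotone_limit: "AE x in \<mu>. P (s + t) (SUP i. U i) x = P s (P t (SUP i. U i)) x"
    if [measurable]: "\<And>i. U i \<in> borel_measurable \<mu>" and U: "incseq U"
      and ck: "\<And>i. AE x in \<mu>. P (s + t) (U i) x = P s (P t (U i)) x" for U :: "nat \<Rightarrow> 'a \<Rightarrow> ennreal"
  proof -
    have inc: "incseq (\<lambda>i. P t (U i))"
      using U by (auto simp: incseq_def le_fun_def intro!: P_mono_AE)
    have "P t (SUP i. U i) x = (SUP i. P t (U i)) x" if "x \<in> space \<mu>" for x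
      by (subst P_SUP[OF st(2) _ U that]) (auto simp: image_comp)
    then have "P s (P t (SUP i. U i)) x = P s (SUP i. P t (U i)) x" for x
      by (intro P_cong_AE) auto
    then have eq: "P s (P t (SUP i. U i)) x = (SUP i. P s (P t (U i)) x)" if "x \<in> space \<mu>" for x
      using P_SUP[OF st(1) _ inc that] measurable_P[OF st(2)] by simp
    have "AE x in \<mu>. \<forall>i. P (s + t) (U i) x = P s (P t (U i)) x" using ck by (simp add: AE_all_countable)
    then show ?thesis
      using AE_space
    proof eventually_elim
      case (elim x)
      have "P (s + t) (SUP i. U i) x = (SUP i. P (s + t) (U i) x)"
        by (rule P_SUP[OF st' _ U elim(2)]) measurable
      then show ?case using elim eq by simp
    qed
  qed
  show "AE x in \<mu>. P (s + t) f x = P s (P t f) x"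
    using f
  proof (induct rule: borel_measurable_induct)
    case (cong f g)
    have "P r f = P r g" for r
      by (intro ext P_cong_AE AE_I2) (rule cong(3))
    then show ?case using cong by simp
  next
    case (set A)
    obtain D :: "nat \<Rightarrow> 'a set" where D: "range D \<subseteq> sets \<mu>" "(\<Union>i. D i) = space \<mu>"
      "\<And>i. emeasure \<mu> (D i) \<noteq> \<infinity>" "incseq D"
      by (rule sigma_finite_incseq) (rule that)
    define U where "U i = (indicator (A \<inter> D i) :: 'a \<Rightarrow> ennreal)" for i
    have "AE x in \<mu>. P (s + t) (SUP i. U i) x = P s (P t (SUP i. U i)) x"
    proof (rule monotone_limit)
      show "U i \<in> borel_measurable \<mu>" for i
        unfolding U_def using D(1) set by auto
      show "incseq U" unfolding U_def using D(4)
        by (auto simp: incseq_def le_fun_def split: split_indicator)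
      have "emeasure \<mu> (A \<inter> D i) < \<infinity>" for i
      proof -
        have "emeasure \<mu> (A \<inter> D i) \<le> emeasure \<mu> (D i)" using D(1) by (intro emeasure_mono) auto
        then show ?thesis using D(3)[of i] by (auto simp: less_top intro: le_less_trans)
      qed
      then show "AE x in \<mu>. P (s + t) (U i) x = P s (P t (U i)) x" for i
        unfolding U_def using D(1) set st by (intro fin) auto
    qed
    moreover have "(SUP i. U i) = indicator A"
    proof
      fix x
      have "(SUP i. indicator (A \<inter> D i) x) = (indicator A x :: ennreal)"
      proof (rule antisym)
        show "(SUP i. indicator (A \<inter> D i) x) \<le> (indicator A x :: ennreal)"
          by (rule SUP_least) (auto split: split_indicator)
        show "(indicator A x :: ennreal) \<le> (SUP i. indicator (A \<inter> D i) x)"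
        proof (cases "x \<in> A")
          case True
          then obtain i where "x \<in> D i" using D(2) sets.sets_into_space[OF set] by auto
          then show ?thesis using True by (intro SUP_upper2[of i]) auto
        qed simp
      qed
      then show "(SUP i. U i) x = indicator A x" by (simp add: U_def image_comp)
    qed
    ultimately show ?case by simp
  next
    case (mult f c)
    have "P s (P t (\<lambda>x. c * f x)) x = P s (\<lambda>x. c * P t f x) x" for x
      using mult st by (intro P_cong_AE) (auto simp: P_cmult)
    note inner = this
    show ?case using mult(4) AE_space
    proof eventually_elim
      case (elim x)
      then show ?case using mult by (simp add: inner P_cmult st st' measurable_P)
    qed
  next
    case (add f g)
    have "P s (P t (\<lambda>x. g x + f x)) x = P s (\<lambda>x. P t g x + P t f x) x" for x
      using add st by (intro P_cong_AE) (auto simp: P_add)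
    note inner = this
    show ?case using add(3,7) AE_space
    proof eventually_elim
      case (elim x)
      then show ?case using add by (simp add: inner P_add st st' measurable_P)
    qed
  next
    case (seq U)
    then show ?case by (intro monotone_limit)
  qed
qed

end

section \<open>Nonnegative strong Feller kernels\<close>

locale nonneg_kernel = measurable_kernel_family \<mu> u
  for \<mu> :: "'a::polish_space measure" and u +
  assumes sets_mu: "sets \<mu> = sets borel"
    and kernel_nonneg: "0 < t \<Longrightarrow> AE x in \<mu>. AE y in \<mu>. 0 \<le> u t x y"
begin

lemma space_mu [simp]: "space \<mu> = UNIV"
  using sets_eq_imp_space_eq[OF sets_mu] by simp

lemma measurable_continuous: "continuous_on UNIV (f :: 'a \<Rightarrow> 'c::topological_space) \<Longrightarrow> f \<in> borel_measurable \<mu>"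
  using borel_measurable_continuous_onI[of f] measurable_cong_sets[OF sets_mu refl] by blast

lemma measurable_section: "0 < t \<Longrightarrow> (\<lambda>y. u t x y) \<in> borel_measurable \<mu>"
proof -
  assume "0 < t"
  note [measurable] = measurable_u[OF this]
  have [measurable]: "x \<in> space \<mu>" by simp
  show ?thesis by measurable
qed

lemma measurable_kernel_op:
  fixes f :: "'a \<Rightarrow> 'c::{banach, second_countable_topology}"
  assumes "0 < t" and [measurable]: "f \<in> borel_measurable \<mu>"
  shows "kernel_op \<mu> u t f \<in> borel_measurable \<mu>"
proof -
  note [measurable] = measurable_u[OF assms(1)]
  show ?thesis unfolding kernel_op_def[abs_def] by measurable
qed

lemma kernel_op_cong_AE:
  fixes f g :: "'a \<Rightarrow> 'c::{banach, second_countable_topology}"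
  assumes "0 < t" and [measurable]: "f \<in> borel_measurable \<mu>" "g \<in> borel_measurable \<mu>"
    and ae: "AE y in \<mu>. f y = g y"
  shows "kernel_op \<mu> u t f x = kernel_op \<mu> u t g x"
proof -
  note [measurable] = measurable_section[OF assms(1)]
  show ?thesis unfolding kernel_op_def
    by (rule integral_cong_AE) (measurable, use ae in eventually_elim, simp)
qed

lemma nn_integral_norm_section:
  fixes f :: "'a \<Rightarrow> 'c::{banach, second_countable_topology}"
  assumes "0 < t"
  shows "AE x in \<mu>. (\<integral>\<^sup>+y. ennreal (norm (u t x y *\<^sub>R f y)) \<partial>\<mu>) = P t (\<lambda>y. ennreal (norm (f y))) x"
  using kernel_nonneg[OF assms]
proof eventually_elim
  case (elim x)
  then show ?case unfolding nn_kernel_op_def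
    by (intro nn_integral_cong_AE) (use elim in eventually_elim, simp add: ennreal_mult)
qed

lemma integrable_section:
  fixes f :: "'a \<Rightarrow> 'c::{banach, second_countable_topology}"
  assumes "0 < t" and [measurable]: "f \<in> borel_measurable \<mu>"
    and fin: "AE x in \<mu>. P t (\<lambda>y. ennreal (norm (f y))) x < \<infinity>"
  shows "AE x in \<mu>. integrable \<mu> (\<lambda>y. u t x y *\<^sub>R f y)"
  using fin nn_integral_norm_section[OF assms(1), of f]
proof eventually_elim
  case (elim x)
  note [measurable] = measurable_section[OF assms(1)]
  show ?case using elim by (intro integrableI_bounded) auto
qed

text \<open>Where the integral diverges, \<open>kernel_op\<close> has the default value \<open>0\<close>, so the bound is trivial there.\<close>

lemma norm_kernel_op_le:
  fixes f :: "'a \<Rightarrow> 'c::{banach, second_countable_topology}"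
  assumes "0 < t"
  shows "AE x in \<mu>. ennreal (norm (kernel_op \<mu> u t f x)) \<le> P t (\<lambda>y. ennreal (norm (f y))) x"
  using nn_integral_norm_section[OF assms(1), of f]
proof eventually_elim
  case (elim x)
  show ?case
  proof (cases "integrable \<mu> (\<lambda>y. u t x y *\<^sub>R f y)")
    case True
    from integral_norm_bound_ennreal[OF this] show ?thesis unfolding elim kernel_op_def .
  next
    case False
    then show ?thesis by (simp add: kernel_op_def not_integrable_integral_eq)
  qed
qed

lemma kernel_op_eq_enn2real:
  fixes f :: "'a \<Rightarrow> real"
  assumes "0 < t" and [measurable]: "f \<in> borel_measurable \<mu>" and f: "AE x in \<mu>. 0 \<le> f x"
  shows "AE x in \<mu>. kernel_op \<mu> u t f x = enn2real (P t (\<lambda>y. ennreal (f y)) x)"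
  using kernel_nonneg[OF assms(1)]
proof eventually_elim
  case (elim x)
  note [measurable] = measurable_section[OF assms(1)]
  have "kernel_op \<mu> u t f x = enn2real (\<integral>\<^sup>+y. ennreal (u t x y *\<^sub>R f y) \<partial>\<mu>)"
    unfolding kernel_op_def
    by (rule integral_eq_nn_integral) (measurable, use elim f in eventually_elim, simp)
  also have "(\<integral>\<^sup>+y. ennreal (u t x y *\<^sub>R f y) \<partial>\<mu>) = P t (\<lambda>y. ennreal (f y)) x"
    unfolding nn_kernel_op_def
    by (rule nn_integral_cong_AE) (use elim f in eventually_elim, simp add: ennreal_mult)
  finally show ?case .
qed

lemma kernel_op_of_real: "kernel_op \<mu> u t (\<lambda>y. complex_of_real (f y)) x = complex_of_real (kernel_op \<mu> u t f x)"
  unfolding kernel_op_def by (simp flip: integral_complex_of_real add: scaleR_conv_of_real)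

lemma nn_finite_of_kernel_converges:
  fixes f :: "'a \<Rightarrow> complex"
  assumes "0 < t" "kernel_converges \<mu> u t f"
  shows "AE x in \<mu>. P t (\<lambda>y. ennreal (cmod (f y))) x < \<infinity>"
proof -
  have "AE x in \<mu>. integrable \<mu> (\<lambda>y. u t x y *\<^sub>R f y)"
    using assms(2) unfolding kernel_converges_def .
  then show ?thesis
    using nn_integral_norm_section[OF assms(1), of f]
  proof eventually_elim
    case (elim x)
    then show ?case by (simp add: integrable_iff_bounded)
  qed
qed

text \<open>For the indicator of a set of finite measure both sides of the \<open>L\<^sup>2\<close> semigroup law are integrals of
  nonnegative functions that converge almost everywhere, so the law can be read in \<open>[0, \<infinity>]\<close>.\<close>

lemma chapman_kolmogorov_of_L2_semigroup:
  assumes conv: "\<And>t f. 0 < t \<Longrightarrow> f \<in> L2 \<mu> \<Longrightarrow> kernel_converges \<mu> u t f"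
    and semigroup: "C0_semigroup_L2 \<mu> (kernel_semigroup \<mu> u)"
  shows chapman_kolmogorov
proof (rule chapman_kolmogorov_of_finite_sets)
  fix s t :: real and A assume st: "0 < s" "0 < t" and A[measurable]: "A \<in> sets \<mu>" "emeasure \<mu> A < \<infinity>"
  have st': "0 < s + t" using st by simp
  define f :: "'a \<Rightarrow> real" where "f = indicator A"
  have f_meas[measurable]: "f \<in> borel_measurable \<mu>" and f_nonneg: "0 \<le> f y" for y
    unfolding f_def using A by auto
  have f_nn: "(\<lambda>y. ennreal (f y)) = indicator A" unfolding f_def by (auto simp: fun_eq_iff ennreal_indicator)
  let ?f = "\<lambda>y. complex_of_real (f y)"
  have "(\<lambda>y. norm (?f y) powr enn2real 2) = indicator A"
    unfolding f_def by (auto simp: fun_eq_iff split: split_indicator)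
  then have f_L2: "?f \<in> L2 \<mu>" using A unfolding Lp_space_def by auto
  define G where "G = kernel_op \<mu> u t f"
  have G_meas: "G \<in> borel_measurable \<mu>" unfolding G_def by (rule measurable_kernel_op[OF st(2) f_meas])
  have op_t: "kernel_op \<mu> u t ?f = (\<lambda>x. complex_of_real (G x))"
    unfolding G_def by (rule ext) (rule kernel_op_of_real)
  have "kernel_semigroup \<mu> u t ?f \<in> L2 \<mu>"
    using semigroup st f_L2 unfolding C0_semigroup_L2_def bounded_op_L2_def by auto
  then have G_L2: "(\<lambda>x. complex_of_real (G x)) \<in> L2 \<mu>"
    using st op_t unfolding kernel_semigroup_def by simp
  have "AE x in \<mu>. kernel_semigroup \<mu> u (s + t) ?f x = kernel_semigroup \<mu> u s (kernel_semigroup \<mu> u t ?f) x"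
    using semigroup st f_L2 unfolding C0_semigroup_L2_def by auto
  then have law: "AE x in \<mu>. kernel_op \<mu> u (s + t) f x = kernel_op \<mu> u s G x"
    using st unfolding kernel_semigroup_def by (simp add: op_t kernel_op_of_real)
  have fin: "AE x in \<mu>. P r (indicator A) x < \<infinity>" if "0 < r" for r
    using nn_finite_of_kernel_converges[OF that conv[OF that f_L2]] f_nonneg unfolding f_nn[symmetric] by simp
  have eq: "AE x in \<mu>. kernel_op \<mu> u r f x = enn2real (P r (indicator A) x)" if "0 < r" for r
    unfolding f_nn[symmetric] using that f_nonneg by (intro kernel_op_eq_enn2real) auto
  have G_nn: "AE x in \<mu>. ennreal (G x) = P t (indicator A) x"
    using eq[OF st(2)] fin[OF st(2)] unfolding G_def by eventually_elim simp
  have G_nonneg: "AE x in \<mu>. 0 \<le> G x"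
    using eq[OF st(2)] unfolding G_def by eventually_elim simp
  have P_G: "P s (\<lambda>y. ennreal (G y)) x = P s (P t (indicator A)) x" for x
    by (rule P_cong_AE[OF G_nn])
  have "P s (\<lambda>y. ennreal (cmod (complex_of_real (G y)))) x = P s (\<lambda>y. ennreal (G y)) x" for x
    by (rule P_cong_AE) (use G_nonneg in eventually_elim, simp)
  then have fin_G: "AE x in \<mu>. P s (\<lambda>y. ennreal (G y)) x < \<infinity>"
    using nn_finite_of_kernel_converges[OF st(1) conv[OF st(1) G_L2]] by simp
  show "AE x in \<mu>. P (s + t) (indicator A) x = P s (P t (indicator A)) x"
    using law eq[OF st'] fin[OF st'] kernel_op_eq_enn2real[OF st(1) G_meas G_nonneg] fin_G
  proof eventually_elim
    case (elim x)
    have "P (s + t) (indicator A) x = ennreal (enn2real (P (s + t) (indicator A) x))"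
      using elim(3) by simp
    also have "enn2real (P (s + t) (indicator A) x) = enn2real (P s (\<lambda>y. ennreal (G y)) x)"
      using elim(1,2,4) by simp
    also have "ennreal \<dots> = P s (\<lambda>y. ennreal (G y)) x"
      using elim(5) by simp
    finally show ?case unfolding P_G .
  qed
qed

end

text \<open>These assumptions are stable under transposition of the kernel, so whatever is proved for
  \<open>U\<^sub>t\<close> from them holds for \<open>U\<^sub>t\<^sup>*\<close> as well.\<close>

locale nonneg_Feller_kernel = nonneg_kernel \<mu> u
  for \<mu> :: "'a::polish_space measure" and u +
  assumes full_support: "measure_support \<mu> = UNIV"
    and CK: chapman_kolmogorov
    and Feller: "strong_Feller \<mu> u" "strong_Feller \<mu> (adj_kernel u)"
begin

lemma nonneg_Feller_kernel_adj: "nonneg_Feller_kernel \<mu> (adj_kernel u)"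
proof -
  interpret adj: measurable_kernel_family \<mu> "adj_kernel u" by (rule measurable_kernel_family_adj)
  show ?thesis
  proof
    fix t :: real assume t: "0 < t"
    note [measurable] = measurable_u[OF t]
    have "{x \<in> space (\<mu> \<Otimes>\<^sub>M \<mu>). 0 \<le> u t (fst x) (snd x)} \<in> sets (\<mu> \<Otimes>\<^sub>M \<mu>)" by measurable
    then show "AE x in \<mu>. AE y in \<mu>. 0 \<le> adj_kernel u t x y"
      using kernel_nonneg[OF t] pair.AE_commute[of "\<lambda>x y. 0 \<le> u t x y"] unfolding adj_kernel_def by simp
  next
    show "strong_Feller \<mu> (adj_kernel (adj_kernel u))"
      using Feller(1) by (simp add: adj_kernel_def[abs_def])
  qed (use sets_mu full_support chapman_kolmogorov_adj[OF CK] Feller in auto)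
qed

lemma CK_AE: "0 < s \<Longrightarrow> 0 < t \<Longrightarrow> f \<in> borel_measurable \<mu> \<Longrightarrow> AE x in \<mu>. P (s + t) f x = P s (P t f) x"
  using CK unfolding chapman_kolmogorov_def by blast

text \<open>For these functions \<open>kernel_op\<close> is an absolutely convergent integral almost everywhere. They
  include functions outside \<open>L\<^sup>2\<close>, for which the semigroup law has to be established anew.\<close>

definition absolutely_summable_at :: "real \<Rightarrow> ('a \<Rightarrow> complex) set" where
  "absolutely_summable_at t = {f \<in> borel_measurable \<mu>. AE x in \<mu>. P t (\<lambda>y. ennreal (cmod (f y))) x < \<infinity>}"

lemma absolutely_summable_mono:
  assumes "f \<in> absolutely_summable_at t" "g \<in> borel_measurable \<mu>" "\<And>y. cmod (g y) \<le> cmod (f y)"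
  shows "g \<in> absolutely_summable_at t"
proof -
  have "P t (\<lambda>y. ennreal (cmod (g y))) x \<le> P t (\<lambda>y. ennreal (cmod (f y))) x" for x
    using assms(3) by (intro P_mono_AE) (auto intro: ennreal_leI)
  then show ?thesis using assms(1,2) unfolding absolutely_summable_at_def
    by (auto elim!: eventually_mono intro: le_less_trans)
qed

lemma absolutely_summable_lincomb:
  assumes t: "0 < t" and f: "f \<in> absolutely_summable_at t" and g: "g \<in> absolutely_summable_at t"
  shows "(\<lambda>y. f y + c * g y) \<in> absolutely_summable_at t"
proof -
  have [measurable]: "f \<in> borel_measurable \<mu>" "g \<in> borel_measurable \<mu>"
    using f g unfolding absolutely_summable_at_def by auto
  have "P t (\<lambda>y. ennreal (cmod (f y + c * g y))) x
      \<le> P t (\<lambda>y. ennreal (cmod (f y)) + ennreal (cmod c) * ennreal (cmod (g y))) x" for x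
    by (intro P_mono_AE AE_I2)
      (auto simp flip: ennreal_plus ennreal_mult simp: norm_mult intro!: ennreal_leI norm_triangle_le)
  also have "P t (\<lambda>y. ennreal (cmod (f y)) + ennreal (cmod c) * ennreal (cmod (g y))) x
      = P t (\<lambda>y. ennreal (cmod (f y))) x + ennreal (cmod c) * P t (\<lambda>y. ennreal (cmod (g y))) x" for x
    by (simp add: P_add P_cmult t)
  finally have le: "P t (\<lambda>y. ennreal (cmod (f y + c * g y))) x
      \<le> P t (\<lambda>y. ennreal (cmod (f y))) x + ennreal (cmod c) * P t (\<lambda>y. ennreal (cmod (g y))) x" for x .
  have "AE x in \<mu>. P t (\<lambda>y. ennreal (cmod (f y))) x < \<infinity>" "AE x in \<mu>. P t (\<lambda>y. ennreal (cmod (g y))) x < \<infinity>"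
    using f g unfolding absolutely_summable_at_def by auto
  then have "AE x in \<mu>. P t (\<lambda>y. ennreal (cmod (f y + c * g y))) x < \<infinity>"
  proof eventually_elim
    case (elim x)
    then show ?case by (intro le_less_trans[OF le]) (auto simp: ennreal_mult_less_top)
  qed
  then show ?thesis unfolding absolutely_summable_at_def by auto
qed

lemma kernel_op_lincomb:
  assumes t: "0 < t" and f: "f \<in> absolutely_summable_at t" and g: "g \<in> absolutely_summable_at t"
  shows "AE x in \<mu>. kernel_op \<mu> u t (\<lambda>y. f y + c * g y) x = kernel_op \<mu> u t f x + c * kernel_op \<mu> u t g x"
proof -
  have "AE x in \<mu>. integrable \<mu> (\<lambda>y. u t x y *\<^sub>R f y)" "AE x in \<mu>. integrable \<mu> (\<lambda>y. u t x y *\<^sub>R g y)"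
    using integrable_section[OF t] f g unfolding absolutely_summable_at_def by blast+
  then show ?thesis
  proof eventually_elim
    case (elim x)
    have "kernel_op \<mu> u t (\<lambda>y. f y + c * g y) x = (LINT y|\<mu>. u t x y *\<^sub>R f y + c * (u t x y *\<^sub>R g y))"
      unfolding kernel_op_def by (simp add: scaleR_add_right mult.left_commute)
    also have "\<dots> = kernel_op \<mu> u t f x + c * kernel_op \<mu> u t g x"
      unfolding kernel_op_def
      using Bochner_Integration.integral_add[OF elim(1) integrable_mult_right[OF elim(2), of c]]
      by (simp del: mult_scaleR_right)
    finally show ?case .
  qed
qed

lemma kernel_op_absolutely_summable:
  assumes st: "0 < s" "0 < t" and f: "f \<in> absolutely_summable_at (s + t)"
  shows "kernel_op \<mu> u t f \<in> absolutely_summable_at s"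
proof -
  have [measurable]: "f \<in> borel_measurable \<mu>" using f unfolding absolutely_summable_at_def by auto
  have le: "P s (\<lambda>y. ennreal (cmod (kernel_op \<mu> u t f y))) x \<le> P s (P t (\<lambda>y. ennreal (cmod (f y)))) x" for x
    by (intro P_mono_AE norm_kernel_op_le st)
  have "AE x in \<mu>. P (s + t) (\<lambda>y. ennreal (cmod (f y))) x = P s (P t (\<lambda>y. ennreal (cmod (f y)))) x"
    by (intro CK_AE st) auto
  moreover have "AE x in \<mu>. P (s + t) (\<lambda>y. ennreal (cmod (f y))) x < \<infinity>"
    using f unfolding absolutely_summable_at_def by auto
  ultimately have "AE x in \<mu>. P s (\<lambda>y. ennreal (cmod (kernel_op \<mu> u t f y))) x < \<infinity>"
  proof eventually_elim
    case (elim x)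
    then show ?case using le[of x] by (simp add: le_less_trans)
  qed
  then show ?thesis using st(2) unfolding absolutely_summable_at_def by (auto intro!: measurable_kernel_op)
qed

text \<open>For nonnegative functions this is the Chapman--Kolmogorov law, all terms being finite. Both sides
  are linear in \<open>f\<close>, which is a combination of the positive and negative parts of its real and
  imaginary part.\<close>

lemma kernel_op_semigroup:
  assumes st: "0 < s" "0 < t"
    and f: "f \<in> absolutely_summable_at t" "f \<in> absolutely_summable_at (s + t)"
  shows "AE x in \<mu>. kernel_op \<mu> u (s + t) f x = kernel_op \<mu> u s (kernel_op \<mu> u t f) x"
proof -
  define S where "S = absolutely_summable_at t \<inter> absolutely_summable_at (s + t)"
  define law where "law g \<longleftrightarrow> (AE x in \<mu>. kernel_op \<mu> u (s + t) g x = kernel_op \<mu> u s (kernel_op \<mu> u t g) x)"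
    for g :: "'a \<Rightarrow> complex"
  have st': "0 < s + t" using st by simp
  have meas: "g \<in> borel_measurable \<mu>" if "g \<in> S" for g
    using that unfolding S_def absolutely_summable_at_def by auto
  have lincomb: "(\<lambda>y. g y + c * h y) \<in> S \<and> law (\<lambda>y. g y + c * h y)"
    if g: "g \<in> S" "law g" and h: "h \<in> S" "law h" for g h c
  proof
    show "(\<lambda>y. g y + c * h y) \<in> S"
      using g h st st' unfolding S_def by (auto intro!: absolutely_summable_lincomb)
    have "AE x in \<mu>. kernel_op \<mu> u t (\<lambda>y. g y + c * h y) x = kernel_op \<mu> u t g x + c * kernel_op \<mu> u t h x"
      using g h st unfolding S_def by (intro kernel_op_lincomb) auto
    then have 1: "kernel_op \<mu> u s (kernel_op \<mu> u t (\<lambda>y. g y + c * h y)) x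
        = kernel_op \<mu> u s (\<lambda>x. kernel_op \<mu> u t g x + c * kernel_op \<mu> u t h x) x" for x
      using meas[OF g(1)] meas[OF h(1)] st
      by (intro kernel_op_cong_AE) (auto intro!: measurable_kernel_op borel_measurable_add borel_measurable_times)
    have 2: "AE x in \<mu>. kernel_op \<mu> u s (\<lambda>x. kernel_op \<mu> u t g x + c * kernel_op \<mu> u t h x) x
        = kernel_op \<mu> u s (kernel_op \<mu> u t g) x + c * kernel_op \<mu> u s (kernel_op \<mu> u t h) x"
      using g h st unfolding S_def by (intro kernel_op_lincomb kernel_op_absolutely_summable) auto
    have 3: "AE x in \<mu>. kernel_op \<mu> u (s + t) (\<lambda>y. g y + c * h y) x
        = kernel_op \<mu> u (s + t) g x + c * kernel_op \<mu> u (s + t) h x"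
      using g h st' unfolding S_def by (intro kernel_op_lincomb) auto
    from 2 3 g(2) h(2) show "law (\<lambda>y. g y + c * h y)"
      unfolding law_def by eventually_elim (simp add: 1)
  qed
  have nonneg: "(\<lambda>y. complex_of_real (g y)) \<in> S \<and> law (\<lambda>y. complex_of_real (g y))"
    if [measurable]: "g \<in> borel_measurable \<mu>" and g: "\<And>y. 0 \<le> g y" "\<And>y. g y \<le> cmod (f y)" for g
  proof
    show gS: "(\<lambda>y. complex_of_real (g y)) \<in> S"
      unfolding S_def using f g by (auto intro!: absolutely_summable_mono[where g = "\<lambda>y. complex_of_real (g y)"])
    let ?g = "\<lambda>y. ennreal (g y)"
    have fin: "AE x in \<mu>. P t ?g x < \<infinity>" "AE x in \<mu>. P (s + t) ?g x < \<infinity>"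
      using gS g unfolding S_def absolutely_summable_at_def by auto
    have k: "AE x in \<mu>. kernel_op \<mu> u t g x = enn2real (P t ?g x)"
      using g st by (intro kernel_op_eq_enn2real) auto
    have "AE x in \<mu>. ennreal (kernel_op \<mu> u t g x) = P t ?g x"
      using k fin(1) by eventually_elim simp
    then have "P s (\<lambda>x. ennreal (kernel_op \<mu> u t g x)) x = P s (P t ?g) x" for x
      by (rule P_cong_AE)
    moreover have "AE x in \<mu>. kernel_op \<mu> u s (kernel_op \<mu> u t g) x
        = enn2real (P s (\<lambda>x. ennreal (kernel_op \<mu> u t g x)) x)"
      using k st by (intro kernel_op_eq_enn2real measurable_kernel_op) (auto elim!: eventually_mono)
    moreover have "AE x in \<mu>. kernel_op \<mu> u (s + t) g x = enn2real (P (s + t) ?g x)"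
      using g st' by (intro kernel_op_eq_enn2real) auto
    moreover have "AE x in \<mu>. P (s + t) ?g x = P s (P t ?g) x"
      by (intro CK_AE st) auto
    ultimately have "AE x in \<mu>. kernel_op \<mu> u (s + t) g x = kernel_op \<mu> u s (kernel_op \<mu> u t g) x"
      by (auto elim!: eventually_elim2)
    then show "law (\<lambda>y. complex_of_real (g y))"
      unfolding law_def kernel_op_of_real by (elim eventually_mono) (auto simp: kernel_op_of_real)
  qed
  have [measurable]: "f \<in> borel_measurable \<mu>" using f unfolding absolutely_summable_at_def by auto
  let ?p = "\<lambda>r :: real. max r 0"
  have le: "max (Re z) 0 \<le> cmod z" "max (- Re z) 0 \<le> cmod z" "max (Im z) 0 \<le> cmod z" "max (- Im z) 0 \<le> cmod z" for z
    using abs_Re_le_cmod[of z] abs_Im_le_cmod[of z] by auto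
  have parts: "(\<lambda>y. complex_of_real (?p (Re (f y)))) \<in> S \<and> law (\<lambda>y. complex_of_real (?p (Re (f y))))"
    "(\<lambda>y. complex_of_real (?p (- Re (f y)))) \<in> S \<and> law (\<lambda>y. complex_of_real (?p (- Re (f y))))"
    "(\<lambda>y. complex_of_real (?p (Im (f y)))) \<in> S \<and> law (\<lambda>y. complex_of_real (?p (Im (f y))))"
    "(\<lambda>y. complex_of_real (?p (- Im (f y)))) \<in> S \<and> law (\<lambda>y. complex_of_real (?p (- Im (f y))))"
    by (intro nonneg; use le in auto)+
  have re: "(\<lambda>y. complex_of_real (?p (Re (f y))) + (- 1) * complex_of_real (?p (- Re (f y)))) \<in> S \<and>
      law (\<lambda>y. complex_of_real (?p (Re (f y))) + (- 1) * complex_of_real (?p (- Re (f y))))"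
    using parts by (intro lincomb) auto
  have "(\<lambda>y. complex_of_real (?p (Im (f y))) + (- 1) * complex_of_real (?p (- Im (f y)))) \<in> S \<and>
      law (\<lambda>y. complex_of_real (?p (Im (f y))) + (- 1) * complex_of_real (?p (- Im (f y))))"
    using parts by (intro lincomb) auto
  with re have "law (\<lambda>y. (complex_of_real (?p (Re (f y))) + (- 1) * complex_of_real (?p (- Re (f y))))
      + \<i> * (complex_of_real (?p (Im (f y))) + (- 1) * complex_of_real (?p (- Im (f y)))))"
    using lincomb by blast
  also have "(\<lambda>y. (complex_of_real (?p (Re (f y))) + (- 1) * complex_of_real (?p (- Re (f y))))
      + \<i> * (complex_of_real (?p (Im (f y))) + (- 1) * complex_of_real (?p (- Im (f y))))) = f"
    by (auto simp: fun_eq_iff complex_eq_iff max_def)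
  finally show ?thesis unfolding law_def .
qed

lemma Feller_Cb:
  fixes f :: "'a \<Rightarrow> complex"
  assumes t: "0 < t" and f[measurable]: "f \<in> borel_measurable \<mu>" and b: "AE x in \<mu>. cmod (f x) \<le> c"
  shows "semi \<mu> u t f \<in> Cb" "AE x in \<mu>. kernel_op \<mu> u t f x = semi \<mu> u t f x"
proof -
  have "f \<in> Lp_space \<mu> \<infinity>" using b unfolding Lp_space_def by auto
  then obtain g where g: "g \<in> Cb" "AE x in \<mu>. kernel_op \<mu> u t f x = g x"
    using Feller(1) t unfolding strong_Feller_def by blast
  then have "semi \<mu> u t f = g"
    unfolding semi_def by (intro continuous_version_eqI sets_mu full_support) (auto simp: Cb_def)
  then show "semi \<mu> u t f \<in> Cb" "AE x in \<mu>. kernel_op \<mu> u t f x = semi \<mu> u t f x" using g by auto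
qed

text \<open>The strong Feller property speaks of complex functions; here its content for the real constant
  \<open>1\<close> is extracted, and the continuous version is identified with the \<open>[0, \<infinity>]\<close>-valued integral.\<close>

lemma semi_one:
  assumes t: "0 < t"
  shows "semi \<mu> u t (\<lambda>_. 1 :: complex) = (\<lambda>x. complex_of_real (semi1 \<mu> u t x))"
    and "semi1 \<mu> u t \<in> Cb" and "AE x in \<mu>. P t (\<lambda>_. 1) x = ennreal (semi1 \<mu> u t x)"
    and "0 \<le> semi1 \<mu> u t x"
proof -
  let ?g = "semi \<mu> u t (\<lambda>_. 1 :: complex)"
  have g: "?g \<in> Cb" "AE x in \<mu>. kernel_op \<mu> u t (\<lambda>_. 1 :: complex) x = ?g x"
    using Feller_Cb[OF t, of "\<lambda>_. 1" 1] by auto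
  have op: "kernel_op \<mu> u t (\<lambda>_. 1 :: complex) x = complex_of_real (kernel_op \<mu> u t (\<lambda>_. 1 :: real) x)" for x
    using kernel_op_of_real[of t "\<lambda>_. 1" x] by simp
  have "AE x in \<mu>. kernel_op \<mu> u t (\<lambda>_. 1 :: real) x = Re (?g x)"
    using g(2) by eventually_elim (metis Re_complex_of_real op)
  moreover have "continuous_on UNIV (\<lambda>x. Re (?g x))"
    using g(1) by (auto simp: Cb_def intro!: continuous_intros)
  ultimately have s1: "semi1 \<mu> u t = (\<lambda>x. Re (?g x))"
    unfolding semi_def[of \<mu> u t "\<lambda>_. 1 :: real"] by (intro continuous_version_eqI sets_mu full_support)
  have cont: "continuous_on UNIV (semi1 \<mu> u t)" unfolding s1 by fact
  have real: "AE x in \<mu>. kernel_op \<mu> u t (\<lambda>_. 1 :: real) x = semi1 \<mu> u t x" unfolding s1 by fact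
  have eq: "?g x = complex_of_real (semi1 \<mu> u t x)" for x
  proof (rule full_support_everywhere[OF sets_mu full_support])
    show "AE x in \<mu>. ?g x = complex_of_real (semi1 \<mu> u t x)"
      using g(2) real by eventually_elim (simp add: op)
    show "open {x. ?g x \<noteq> complex_of_real (semi1 \<mu> u t x)}"
      using g(1) cont by (intro open_Collect_neq) (auto simp: Cb_def intro!: continuous_intros)
  qed
  then show "?g = (\<lambda>x. complex_of_real (semi1 \<mu> u t x))" by auto
  have "bounded (range (semi1 \<mu> u t))"
  proof -
    obtain c where "\<And>x. cmod (?g x) \<le> c" using g(1) unfolding Cb_def bounded_iff by auto
    then show ?thesis unfolding bounded_iff eq by auto
  qed
  then show "semi1 \<mu> u t \<in> Cb" using cont unfolding Cb_def by auto
  have "(\<lambda>_. 1 :: complex) \<in> Lp_space \<mu> \<infinity>"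
    unfolding Lp_space_def by (auto intro!: exI[of _ 1])
  then have "kernel_converges \<mu> u t (\<lambda>_. 1 :: complex)"
    using Feller(1) t unfolding strong_Feller_def by blast
  then have conv: "AE x in \<mu>. integrable \<mu> (\<lambda>y. u t x y *\<^sub>R (1 :: complex))"
    unfolding kernel_converges_def .
  have "AE x in \<mu>. P t (\<lambda>_. 1) x < \<infinity>"
    using conv nn_integral_norm_section[OF t, of "\<lambda>_. 1 :: complex"]
    by eventually_elim (auto simp: integrable_iff_bounded)
  moreover have op_nn: "AE x in \<mu>. kernel_op \<mu> u t (\<lambda>_. 1) x = enn2real (P t (\<lambda>y. ennreal 1) x)"
    using t by (intro kernel_op_eq_enn2real) auto
  ultimately show "AE x in \<mu>. P t (\<lambda>_. 1) x = ennreal (semi1 \<mu> u t x)"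
    using real by eventually_elim (metis ennreal_enn2real ennreal_1 infinity_ennreal_def)
  have "AE x in \<mu>. 0 \<le> semi1 \<mu> u t x"
    using op_nn real
  proof eventually_elim
    case (elim x)
    show ?case unfolding elim(2)[symmetric] elim(1) by (rule enn2real_nonneg)
  qed
  then show "0 \<le> semi1 \<mu> u t x"
    by (rule full_support_le[OF sets_mu full_support _ cont, where f = "\<lambda>_. 0", rotated])
      (rule continuous_on_const)
qed

lemma P_one_bounded:
  assumes t: "0 < t"
  obtains c where "0 < c" "AE x in \<mu>. P t (\<lambda>_. 1) x \<le> ennreal c"
proof -
  obtain c where c: "\<And>x. \<bar>semi1 \<mu> u t x\<bar> \<le> c"
    using semi_one(2)[OF t] unfolding Cb_def bounded_iff by auto
  have le: "semi1 \<mu> u t x \<le> max 1 c" for x using c[of x] by linarith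
  have "AE x in \<mu>. P t (\<lambda>_. 1) x \<le> ennreal (max 1 c)"
    using semi_one(3)[OF t] by eventually_elim (simp only: ennreal_leI[OF le])
  then show ?thesis using that[of "max 1 c"] by auto
qed

end

section \<open>Kernels that converge exponentially to a rank one kernel\<close>

lemma ennreal_le_of_vanishing_error:
  assumes "\<And>n :: nat. a \<le> b + ennreal (e n) * K" "e \<longlonglongrightarrow> 0" "K < (\<infinity> :: ennreal)"
  shows "a \<le> b"
proof -
  have "(\<lambda>n. ennreal (e n)) \<longlonglongrightarrow> 0" using tendsto_ennrealI[OF assms(2)] by simp
  then have "(\<lambda>n. K * ennreal (e n)) \<longlonglongrightarrow> K * 0" using assms(3) by (intro ennreal_tendsto_cmult) auto
  then have "(\<lambda>n. b + K * ennreal (e n)) \<longlonglongrightarrow> b + 0" by (intro tendsto_add) auto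
  then show ?thesis using assms(1) by (intro LIMSEQ_le_const) (auto simp: mult.commute)
qed

text \<open>\<open>\<phi>\<close> and \<open>\<psi>\<close> play the part of the ground states of \<open>U\<^sub>t\<close> and \<open>U\<^sub>t\<^sup>*\<close>, \<open>lam\<close> that of the
  ground state eigenvalue, \<open>\<kappa>\<close> stands for \<open>\<Lambda>\<^sup>-\<^sup>1\<close> and \<open>T\<close> for \<open>2 t\<^sub>0\<close>. That \<open>\<phi>\<close> and \<open>\<psi>\<close> are eigenfunctions is a
  consequence of the asymptotics of the kernel, see \<open>eigenfunction\<close> below. The assumptions are
  invariant under transposing the kernel and exchanging \<open>\<phi>\<close> with \<open>\<psi>\<close>.\<close>

locale ground_state_kernel = nonneg_Feller_kernel \<mu> u
  for \<mu> :: "'a::polish_space measure" and u +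
  fixes lam \<kappa> \<gamma> C0 T t1 :: real and \<phi> \<psi> :: "'a \<Rightarrow> real"
  assumes const_bounds: "0 < \<kappa>" "0 < \<gamma>" "0 < C0" "0 \<le> T" "0 < t1"
    and asymptotics: "T < t \<Longrightarrow> AE x in \<mu>. AE y in \<mu>.
      \<bar>exp (lam * t) * u t x y - \<kappa> * \<phi> x * \<psi> y\<bar> \<le> C0 * exp (- \<gamma> * t)"
    and \<phi>_Cb: "\<phi> \<in> Cb" and \<phi>_pos: "0 < \<phi> x"
    and \<psi>_Cb: "\<psi> \<in> Cb" and \<psi>_pos: "0 < \<psi> x"
    and heat_finite: "(\<integral>\<^sup>+x. P t1 (\<lambda>_. 1) x \<partial>\<mu>) < \<infinity>"
begin

lemma \<phi>_cont: "continuous_on UNIV \<phi>" and \<psi>_cont: "continuous_on UNIV \<psi>"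
  using \<phi>_Cb \<psi>_Cb by (auto simp: Cb_def)

lemma measurable_\<phi>[measurable]: "\<phi> \<in> borel_measurable \<mu>" and measurable_\<psi>[measurable]: "\<psi> \<in> borel_measurable \<mu>"
  using \<phi>_cont \<psi>_cont by (auto intro: measurable_continuous)

lemma \<phi>_nonneg [simp]: "0 \<le> \<phi> x" and \<psi>_nonneg [simp]: "0 \<le> \<psi> x"
  using \<phi>_pos[of x] \<psi>_pos[of x] by auto

definition B\<phi> where "B\<phi> = Sup (range \<phi>)"
definition B\<psi> where "B\<psi> = Sup (range \<psi>)"

lemma \<phi>_le: "\<phi> x \<le> B\<phi>" and \<psi>_le: "\<psi> x \<le> B\<psi>"
  using \<phi>_Cb \<psi>_Cb unfolding B\<phi>_def B\<psi>_def Cb_def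
  by (auto intro!: cSup_upper bounded_imp_bdd_above)

lemma B_pos: "0 < B\<phi>" "0 < B\<psi>"
  using \<phi>_le \<psi>_le \<phi>_pos \<psi>_pos by (meson less_le_trans)+

text \<open>The total heat content of both semigroups is the double integral of the kernel, so its finiteness
  passes to the transposed kernel.\<close>

lemma ground_state_kernel_adj: "ground_state_kernel \<mu> (adj_kernel u) lam \<kappa> \<gamma> C0 T t1 \<psi> \<phi>"
proof -
  interpret adj: nonneg_Feller_kernel \<mu> "adj_kernel u" by (rule nonneg_Feller_kernel_adj)
  show ?thesis
  proof
    fix t :: real assume t: "T < t"
    then have "0 < t" using const_bounds by simp
    note [measurable] = measurable_u[OF this]
    let ?Q = "\<lambda>x y. \<bar>exp (lam * t) * u t x y - \<kappa> * \<phi> x * \<psi> y\<bar> \<le> C0 * exp (- \<gamma> * t)"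
    have "{x \<in> space (\<mu> \<Otimes>\<^sub>M \<mu>). ?Q (fst x) (snd x)} \<in> sets (\<mu> \<Otimes>\<^sub>M \<mu>)" by measurable
    then have "AE y in \<mu>. AE x in \<mu>. ?Q x y"
      using asymptotics[OF t] pair.AE_commute[of ?Q] by simp
    then show "AE x in \<mu>. AE y in \<mu>.
        \<bar>exp (lam * t) * adj_kernel u t x y - \<kappa> * \<psi> x * \<phi> y\<bar> \<le> C0 * exp (- \<gamma> * t)"
      unfolding adj_kernel_def by (simp add: mult_ac)
  next
    have "(\<integral>\<^sup>+x. P t1 (\<lambda>_. 1) x \<partial>\<mu>) = (\<integral>\<^sup>+x. Q t1 (\<lambda>_. 1) x \<partial>\<mu>)"
      using P_duality[of t1 "\<lambda>_. 1" "\<lambda>_. 1"] const_bounds by simp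
    then show "(\<integral>\<^sup>+x. Q t1 (\<lambda>_. 1) x \<partial>\<mu>) < \<infinity>" using heat_finite by simp
  qed (use const_bounds \<phi>_Cb \<psi>_Cb \<phi>_pos \<psi>_pos in auto)
qed

text \<open>Two one-sided bounds in place of one for the absolute value of a difference: subtraction is not
  available in \<open>[0, \<infinity>]\<close>, and in this form \<open>F\<close> may have infinite integral.\<close>

lemma asymptotics_nn:
  assumes t: "T < t" and [measurable]: "F \<in> borel_measurable \<mu>"
  shows "AE x in \<mu>.
    ennreal (exp (lam * t)) * P t F x
      \<le> ennreal (\<kappa> * \<phi> x) * (\<integral>\<^sup>+y. ennreal (\<psi> y) * F y \<partial>\<mu>) + ennreal (C0 * exp (- \<gamma> * t)) * (\<integral>\<^sup>+y. F y \<partial>\<mu>) \<and>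
    ennreal (\<kappa> * \<phi> x) * (\<integral>\<^sup>+y. ennreal (\<psi> y) * F y \<partial>\<mu>)
      \<le> ennreal (exp (lam * t)) * P t F x + ennreal (C0 * exp (- \<gamma> * t)) * (\<integral>\<^sup>+y. F y \<partial>\<mu>)"
proof -
  have t': "0 < t" using t const_bounds by simp
  note [measurable] = measurable_section[OF t']
  let ?e = "exp (lam * t)" and ?d = "C0 * exp (- \<gamma> * t)"
  show ?thesis
    using asymptotics[OF t] kernel_nonneg[OF t']
  proof eventually_elim
    case (elim x)
    have P_eq: "ennreal ?e * P t F x = (\<integral>\<^sup>+y. ennreal (?e * u t x y) * F y \<partial>\<mu>)"
      unfolding nn_kernel_op_def
      by (subst nn_integral_cmult[symmetric]) (auto intro!: nn_integral_cong simp: ennreal_mult' mult.assoc)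
    have G_eq: "ennreal (\<kappa> * \<phi> x) * (\<integral>\<^sup>+y. ennreal (\<psi> y) * F y \<partial>\<mu>) = (\<integral>\<^sup>+y. ennreal (\<kappa> * \<phi> x * \<psi> y) * F y \<partial>\<mu>)"
      using const_bounds
      by (subst nn_integral_cmult[symmetric]) (auto intro!: nn_integral_cong simp: ennreal_mult mult.assoc)
    have add: "(\<integral>\<^sup>+y. ennreal (h y) * F y \<partial>\<mu>) + ennreal ?d * (\<integral>\<^sup>+y. F y \<partial>\<mu>)
        = (\<integral>\<^sup>+y. ennreal (h y) * F y + ennreal ?d * F y \<partial>\<mu>)"
      if [measurable]: "h \<in> borel_measurable \<mu>" for h
      by (subst nn_integral_cmult[symmetric], simp, subst nn_integral_add[symmetric]) auto
    have "AE y in \<mu>. ennreal (?e * u t x y) * F y \<le> ennreal (\<kappa> * \<phi> x * \<psi> y) * F y + ennreal ?d * F y"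
      using elim
    proof eventually_elim
      case (elim y)
      then have "ennreal (?e * u t x y) \<le> ennreal (\<kappa> * \<phi> x * \<psi> y) + ennreal ?d"
        using const_bounds by (subst ennreal_plus[symmetric]) (auto intro!: ennreal_leI simp del: ennreal_plus)
      then show ?case by (simp flip: distrib_right add: mult_right_mono)
    qed
    moreover have "AE y in \<mu>. ennreal (\<kappa> * \<phi> x * \<psi> y) * F y \<le> ennreal (?e * u t x y) * F y + ennreal ?d * F y"
      using elim
    proof eventually_elim
      case (elim y)
      then have "ennreal (\<kappa> * \<phi> x * \<psi> y) \<le> ennreal (?e * u t x y) + ennreal ?d"
        using const_bounds by (subst ennreal_plus[symmetric]) (auto intro!: ennreal_leI simp del: ennreal_plus)
      then show ?case by (simp flip: distrib_right add: mult_right_mono)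
    qed
    ultimately show ?case
      unfolding P_eq G_eq by (subst (1 2) add) (auto intro!: nn_integral_mono_AE)
  qed
qed

lemma exists_finite_positive_set:
  obtains A where "A \<in> sets \<mu>" "emeasure \<mu> A < \<infinity>" "0 < emeasure \<mu> A"
proof -
  obtain D :: "nat \<Rightarrow> 'a set" where D: "range D \<subseteq> sets \<mu>" "(\<Union>i. D i) = space \<mu>" "\<And>i. emeasure \<mu> (D i) \<noteq> \<infinity>"
    by (rule sigma_finite) (rule that)
  have "0 < emeasure \<mu> UNIV"
    using full_support unfolding measure_support_def by auto
  have "\<exists>i. emeasure \<mu> (D i) \<noteq> 0"
  proof (rule ccontr)
    assume "\<nexists>i. emeasure \<mu> (D i) \<noteq> 0"
    then have "emeasure \<mu> (\<Union>i. D i) = 0" using D(1) by (intro emeasure_UN_eq_0) auto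
    then show False using D(2) \<open>0 < emeasure \<mu> UNIV\<close> by simp
  qed
  then obtain i where "emeasure \<mu> (D i) \<noteq> 0" ..
  then show ?thesis using D that[of "D i"] by (auto simp: less_top zero_less_iff_neq_zero)
qed

text \<open>Let \<open>A\<close> have positive finite measure. By the asymptotics of the kernel, \<open>e\<^bsup>lam t\<^esup> U\<^sub>t 1\<^sub>A\<close> tends uniformly
  to \<open>c \<phi>\<close> with a constant \<open>0 < c < \<infinity>\<close>. Writing \<open>U\<^bsub>s + t\<^esub> 1\<^sub>A = U\<^sub>s (U\<^sub>t 1\<^sub>A)\<close> and letting \<open>t\<close> tend to infinity
  on both sides gives \<open>c \<phi> = e\<^bsup>lam s\<^esup> U\<^sub>s (c \<phi>)\<close>; the limit may be taken inside \<open>U\<^sub>s\<close> because \<open>U\<^sub>s 1\<close> is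
  bounded. Along a sequence of times only countably many null sets occur.\<close>

lemma eigenfunction:
  assumes s: "0 < s"
  shows "AE x in \<mu>. ennreal (\<phi> x) = ennreal (exp (lam * s)) * P s (\<lambda>y. ennreal (\<phi> y)) x"
proof -
  obtain A where A[measurable]: "A \<in> sets \<mu>" and finA: "emeasure \<mu> A < \<infinity>" and posA: "0 < emeasure \<mu> A"
    by (rule exists_finite_positive_set)
  let ?F = "indicator A :: 'a \<Rightarrow> ennreal"
  let ?e = "\<lambda>t. ennreal (exp (lam * t))"
  define I where "I = (\<integral>\<^sup>+y. ennreal (\<psi> y) * ?F y \<partial>\<mu>)"
  have "I \<le> (\<integral>\<^sup>+y. ennreal B\<psi> * ?F y \<partial>\<mu>)"
    unfolding I_def by (intro nn_integral_mono mult_right_mono ennreal_leI \<psi>_le) auto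
  also have "\<dots> < \<infinity>" using finA by (simp add: nn_integral_cmult ennreal_mult_less_top)
  finally have finI: "I < \<infinity>" .
  have "I \<noteq> 0"
  proof
    assume "I = 0"
    then have "AE y in \<mu>. ennreal (\<psi> y) * ?F y = 0" unfolding I_def by (subst (asm) nn_integral_0_iff_AE) auto
    then have "AE y in \<mu>. y \<notin> A"
    proof eventually_elim
      case (elim y)
      then show ?case using \<psi>_pos[of y] by (auto split: split_indicator_asm)
    qed
    then have "emeasure \<mu> A = 0" by (subst (asm) AE_iff_measurable[of A]) auto
    then show False using posA by simp
  qed
  define c where "c = ennreal \<kappa> * I"
  have c: "c \<noteq> 0" "c < \<infinity>"
    using \<open>I \<noteq> 0\<close> finI const_bounds unfolding c_def by (auto simp: ennreal_mult_less_top)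
  have c\<phi>: "ennreal (\<kappa> * \<phi> x) * I = c * ennreal (\<phi> x)" for x
    using const_bounds unfolding c_def by (simp add: ennreal_mult mult_ac)
  define \<tau> where "\<tau> n = T + 1 + real n" for n
  have \<tau>: "T < \<tau> n" "0 < \<tau> n" for n using const_bounds unfolding \<tau>_def by auto
  define d where "d n = C0 * exp (- \<gamma> * \<tau> n)" for n
  define E where "E n = ennreal (d n) * emeasure \<mu> A" for n
  have "d \<longlonglongrightarrow> 0" unfolding d_def \<tau>_def using const_bounds by real_asymp
  have upper: "AE x in \<mu>. ?e (\<tau> n) * P (\<tau> n) ?F x \<le> c * ennreal (\<phi> x) + E n"
    and lower: "AE x in \<mu>. c * ennreal (\<phi> x) \<le> ?e (\<tau> n) * P (\<tau> n) ?F x + E n" for n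
    using asymptotics_nn[OF \<tau>(1)[of n], of ?F] unfolding I_def[symmetric] c\<phi> E_def d_def by auto
  have E_mono: "ennreal (C0 * exp (- \<gamma> * (s + \<tau> n))) * emeasure \<mu> A \<le> E n" for n
    unfolding E_def d_def using const_bounds s by (intro mult_right_mono ennreal_leI) auto
  have s\<tau>: "T < s + \<tau> n" for n using \<tau>[of n] s by simp
  have upper': "AE x in \<mu>. ?e (s + \<tau> n) * P (s + \<tau> n) ?F x \<le> c * ennreal (\<phi> x) + E n"
    and lower': "AE x in \<mu>. c * ennreal (\<phi> x) \<le> ?e (s + \<tau> n) * P (s + \<tau> n) ?F x + E n" for n
  proof -
    define E' where "E' = ennreal (C0 * exp (- \<gamma> * (s + \<tau> n))) * emeasure \<mu> A"
    have le: "b + E' \<le> b + E n" for b using E_mono[of n] unfolding E'_def by (rule add_left_mono)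
    have *: "AE x in \<mu>. ?e (s + \<tau> n) * P (s + \<tau> n) ?F x \<le> c * ennreal (\<phi> x) + E' \<and>
        c * ennreal (\<phi> x) \<le> ?e (s + \<tau> n) * P (s + \<tau> n) ?F x + E'"
      using asymptotics_nn[OF s\<tau>, of ?F n] unfolding I_def[symmetric] c\<phi> E'_def by simp
    show "AE x in \<mu>. ?e (s + \<tau> n) * P (s + \<tau> n) ?F x \<le> c * ennreal (\<phi> x) + E n"
      using * by eventually_elim (rule order_trans[OF conjunct1 le])
    show "AE x in \<mu>. c * ennreal (\<phi> x) \<le> ?e (s + \<tau> n) * P (s + \<tau> n) ?F x + E n"
      using * by eventually_elim (rule order_trans[OF conjunct2 le])
  qed
  have ck: "AE x in \<mu>. ?e (s + \<tau> n) * P (s + \<tau> n) ?F x = ?e s * P s (\<lambda>y. ?e (\<tau> n) * P (\<tau> n) ?F y) x" for n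
  proof -
    have "AE x in \<mu>. P (s + \<tau> n) ?F x = P s (P (\<tau> n) ?F) x" using s \<tau> by (intro CK_AE) auto
    then show ?thesis
    proof eventually_elim
      case (elim x)
      have "P s (\<lambda>y. ?e (\<tau> n) * P (\<tau> n) ?F y) x = ?e (\<tau> n) * P s (P (\<tau> n) ?F) x"
        using s \<tau> by (intro P_cmult measurable_P) auto
      then show ?case using elim by (simp add: distrib_left exp_add ennreal_mult mult_ac)
    qed
  qed
  let ?\<phi> = "\<lambda>y. ennreal (\<phi> y)"
  have lin: "P s (\<lambda>y. a y + b * 1) x = P s a x + b * P s (\<lambda>_. 1) x" if "a \<in> borel_measurable \<mu>" for a b x
    using that s by (subst P_add) (auto simp: P_cmult simp del: mult_1_right)
  have P\<phi>: "P s (\<lambda>y. c * ?\<phi> y) x = c * P s ?\<phi> x" for x using s by (intro P_cmult) auto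
  have mE: "(\<lambda>y. ?e (\<tau> n) * P (\<tau> n) ?F y) \<in> borel_measurable \<mu>" for n
    using measurable_P[OF \<tau>(2), of ?F n] by simp
  have inner_upper: "P s (\<lambda>y. ?e (\<tau> n) * P (\<tau> n) ?F y) x \<le> c * P s ?\<phi> x + E n * P s (\<lambda>_. 1) x" for n x
    using P_mono_AE[OF upper[of n], of s x] lin[of "\<lambda>y. c * ?\<phi> y" "E n" x] P\<phi> by simp
  have inner_lower: "c * P s ?\<phi> x \<le> P s (\<lambda>y. ?e (\<tau> n) * P (\<tau> n) ?F y) x + E n * P s (\<lambda>_. 1) x" for n x
    using P_mono_AE[OF lower[of n], of s x] lin[OF mE, of n "E n" x] P\<phi> by simp
  obtain b where b: "AE x in \<mu>. P s (\<lambda>_. 1) x \<le> ennreal b" using P_one_bounded[OF s] by blast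
  have "AE x in \<mu>. \<forall>n. ?e (s + \<tau> n) * P (s + \<tau> n) ?F x \<le> c * ennreal (\<phi> x) + E n"
    "AE x in \<mu>. \<forall>n. c * ennreal (\<phi> x) \<le> ?e (s + \<tau> n) * P (s + \<tau> n) ?F x + E n"
    "AE x in \<mu>. \<forall>n. ?e (s + \<tau> n) * P (s + \<tau> n) ?F x = ?e s * P s (\<lambda>y. ?e (\<tau> n) * P (\<tau> n) ?F y) x"
    using upper' lower' ck by (simp_all add: AE_all_countable)
  then show ?thesis using b
  proof eventually_elim
    case (elim x)
    define K where "K = emeasure \<mu> A * (?e s * P s (\<lambda>_. 1) x + 1)"
    have K: "K < \<infinity>"
      using elim(4) finA unfolding K_def
      by (auto simp: ennreal_mult_less_top intro: le_less_trans)
    have EK: "?e s * (E n * P s (\<lambda>_. 1) x) + E n = ennreal (d n) * K" for n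
      unfolding E_def K_def by (simp add: distrib_left mult_ac)
    have "c * ?\<phi> x \<le> c * (?e s * P s ?\<phi> x)"
    proof (rule ennreal_le_of_vanishing_error[OF _ \<open>d \<longlonglongrightarrow> 0\<close> K])
      fix n
      have "c * ?\<phi> x \<le> ?e s * P s (\<lambda>y. ?e (\<tau> n) * P (\<tau> n) ?F y) x + E n"
        using elim(2,3) by metis
      also have "\<dots> \<le> ?e s * (c * P s ?\<phi> x + E n * P s (\<lambda>_. 1) x) + E n"
        by (intro add_right_mono mult_left_mono inner_upper) auto
      also have "\<dots> = c * (?e s * P s ?\<phi> x) + ennreal (d n) * K"
        unfolding EK[symmetric] by (simp add: distrib_left mult_ac add_ac)
      finally show "c * ?\<phi> x \<le> c * (?e s * P s ?\<phi> x) + ennreal (d n) * K" .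
    qed
    moreover have "c * (?e s * P s ?\<phi> x) \<le> c * ?\<phi> x"
    proof (rule ennreal_le_of_vanishing_error[OF _ \<open>d \<longlonglongrightarrow> 0\<close> K])
      fix n
      have "c * (?e s * P s ?\<phi> x) = ?e s * (c * P s ?\<phi> x)" by (simp add: mult_ac)
      also have "\<dots> \<le> ?e s * (P s (\<lambda>y. ?e (\<tau> n) * P (\<tau> n) ?F y) x + E n * P s (\<lambda>_. 1) x)"
        by (intro mult_left_mono inner_lower) auto
      also have "\<dots> = ?e (s + \<tau> n) * P (s + \<tau> n) ?F x + ?e s * (E n * P s (\<lambda>_. 1) x)"
        using elim(3) by (metis distrib_left)
      also have "\<dots> \<le> (c * ?\<phi> x + E n) + ?e s * (E n * P s (\<lambda>_. 1) x)"
        using elim(1) by (intro add_right_mono) auto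
      also have "\<dots> = c * ?\<phi> x + ennreal (d n) * K"
        unfolding EK[symmetric] by (simp add: add_ac)
      finally show "c * (?e s * P s ?\<phi> x) \<le> c * ?\<phi> x + ennreal (d n) * K" .
    qed
    ultimately have "c * ?\<phi> x = c * (?e s * P s ?\<phi> x)" by (rule antisym)
    then show ?case using c by (auto simp: ennreal_mult_cancel_left)
  qed
qed

text \<open>Since \<open>\<phi> = e\<^bsup>lam s\<^esup> U\<^sub>s \<phi>\<close> and \<open>\<phi>\<close> is bounded, \<open>U\<^sub>s 1\<close> is bounded below by a multiple of \<open>\<phi>\<close>. This
  controls the denominators of the quasi-ergodic quotients, and carries integrability and decay
  at infinity from \<open>U\<^sub>s 1\<close> over to \<open>\<phi>\<close>.\<close>

lemma \<phi>_le_P_one: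
  assumes s: "0 < s"
  shows "AE x in \<mu>. ennreal (\<phi> x) \<le> ennreal (B\<phi> * exp (lam * s)) * P s (\<lambda>_. 1) x"
  using eigenfunction[OF s]
proof eventually_elim
  case (elim x)
  have "P s (\<lambda>y. ennreal (\<phi> y)) x \<le> P s (\<lambda>y. ennreal B\<phi> * 1) x"
    by (intro P_mono_AE AE_I2) (simp add: \<phi>_le ennreal_leI)
  also have "\<dots> = ennreal B\<phi> * P s (\<lambda>_. 1) x" using s by (intro P_cmult) auto
  finally have "ennreal (\<phi> x) \<le> ennreal (exp (lam * s)) * (ennreal B\<phi> * P s (\<lambda>_. 1) x)"
    unfolding elim by (intro mult_left_mono) auto
  then show ?case using B_pos by (simp add: ennreal_mult mult_ac)
qed

lemma \<phi>_le_semi1: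
  assumes s: "0 < s"
  shows "\<phi> x \<le> B\<phi> * exp (lam * s) * semi1 \<mu> u s x"
proof (rule full_support_le[OF sets_mu full_support])
  show "continuous_on UNIV \<phi>" by (rule \<phi>_cont)
  show "continuous_on UNIV (\<lambda>x. B\<phi> * exp (lam * s) * semi1 \<mu> u s x)"
    using semi_one(2)[OF s] by (auto simp: Cb_def intro!: continuous_intros)
  show "AE x in \<mu>. \<phi> x \<le> B\<phi> * exp (lam * s) * semi1 \<mu> u s x"
    using \<phi>_le_P_one[OF s] semi_one(3)[OF s]
  proof eventually_elim
    case (elim x)
    then have "ennreal (\<phi> x) \<le> ennreal (B\<phi> * exp (lam * s) * semi1 \<mu> u s x)"
      using B_pos semi_one(4)[OF s] by (simp add: ennreal_mult)
    then show ?case using B_pos semi_one(4)[OF s, of x] by (subst (asm) ennreal_le_iff) auto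
  qed
qed

lemma \<phi>_integrable: "integrable \<mu> \<phi>"
proof (rule integrableI_nonneg)
  have "(\<integral>\<^sup>+x. ennreal (\<phi> x) \<partial>\<mu>) \<le> (\<integral>\<^sup>+x. ennreal (B\<phi> * exp (lam * t1)) * P t1 (\<lambda>_. 1) x \<partial>\<mu>)"
    using const_bounds by (intro nn_integral_mono_AE \<phi>_le_P_one) auto
  also have "\<dots> = ennreal (B\<phi> * exp (lam * t1)) * (\<integral>\<^sup>+x. P t1 (\<lambda>_. 1) x \<partial>\<mu>)"
    using const_bounds by (intro nn_integral_cmult measurable_P) auto
  also have "\<dots> < \<infinity>" using heat_finite by (simp add: ennreal_mult_less_top)
  finally show "(\<integral>\<^sup>+x. ennreal (\<phi> x) \<partial>\<mu>) < \<infinity>" .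
qed auto

end

section \<open>Uniform asymptotics on the unit balls\<close>

text \<open>Functions dominated by \<open>1 + g\<close> with \<open>g\<close> in the unit ball of \<open>L\<^sup>1\<close>. This set contains the unit balls
  of all \<open>L\<^sup>p\<close> at once, which makes the constants below independent of \<open>p\<close>.\<close>

definition L1_Linf_ball :: "'a measure \<Rightarrow> ('a \<Rightarrow> complex) set" where
  "L1_Linf_ball \<mu> = {f \<in> borel_measurable \<mu>. \<exists>g \<in> borel_measurable \<mu>.
     (AE x in \<mu>. ennreal (cmod (f x)) \<le> 1 + g x) \<and> (\<integral>\<^sup>+x. g x \<partial>\<mu>) \<le> 1}"

lemma L1_Linf_ball_one: "(\<lambda>_. 1) \<in> L1_Linf_ball \<mu>"
  unfolding L1_Linf_ball_def by (auto intro!: bexI[of _ "\<lambda>_. 0"])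

text \<open>For finite \<open>p\<close> the point is that \<open>\<bar>f\<bar> \<le> 1 + \<bar>f\<bar>\<^sup>p\<close>.\<close>

lemma Lp_ball_subset_L1_Linf_ball:
  assumes p: "1 \<le> p" and f: "f \<in> Lp_space \<mu> p" "Lp_norm \<mu> p f \<le> 1"
  shows "f \<in> L1_Linf_ball \<mu>"
proof -
  have [measurable]: "f \<in> borel_measurable \<mu>" using f(1) unfolding Lp_space_def by auto
  show ?thesis
  proof (cases "p = \<infinity>")
    case True
    have meas: "(\<lambda>x. ennreal (cmod (f x))) \<in> borel_measurable \<mu>" by measurable
    obtain c where c: "AE x in \<mu>. cmod (f x) \<le> c" using f(1) True unfolding Lp_space_def by auto
    have "AE x in \<mu>. ennreal (cmod (f x)) \<le> ennreal c"
      using c by eventually_elim (rule ennreal_leI)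
    then have "esssup \<mu> (\<lambda>x. ennreal (cmod (f x))) \<le> ennreal c" by (rule esssup_I[OF meas])
    then have fin: "esssup \<mu> (\<lambda>x. ennreal (cmod (f x))) < top" by (rule le_less_trans) simp
    have "enn2real (esssup \<mu> (\<lambda>x. ennreal (cmod (f x)))) \<le> 1"
      using f(2) True unfolding Lp_norm_def by simp
    then have "ennreal (enn2real (esssup \<mu> (\<lambda>x. ennreal (cmod (f x))))) \<le> ennreal 1" by (rule ennreal_leI)
    then have le1: "esssup \<mu> (\<lambda>x. ennreal (cmod (f x))) \<le> 1" using fin by simp
    have "AE x in \<mu>. ennreal (cmod (f x)) \<le> 1 + 0"
      using esssup_AE[of "\<lambda>x. ennreal (cmod (f x))" \<mu>]
    proof eventually_elim
      case (elim x)
      from order_trans[OF elim le1] show ?case by simp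
    qed
    then show ?thesis unfolding L1_Linf_ball_def by (auto intro!: bexI[of _ "\<lambda>_. 0"])
  next
    case False
    define q where "q = enn2real p"
    have q: "1 \<le> q"
      using p False enn2real_mono[of 1 p] unfolding q_def by (simp add: less_top)
    have int: "integrable \<mu> (\<lambda>x. cmod (f x) powr q)"
      using f(1) False unfolding Lp_space_def q_def by simp
    have "(LINT x|\<mu>. cmod (f x) powr q) powr (1 / q) \<le> 1"
      using f(2) False unfolding Lp_norm_def q_def by simp
    then have "(LINT x|\<mu>. cmod (f x) powr q) \<le> 1"
    proof (rule contrapos_pp)
      assume "\<not> (LINT x|\<mu>. cmod (f x) powr q) \<le> 1"
      then show "\<not> (LINT x|\<mu>. cmod (f x) powr q) powr (1 / q) \<le> 1"
        using q by (auto simp: not_le intro!: gr_one_powr)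
    qed
    then have "(\<integral>\<^sup>+x. ennreal (cmod (f x) powr q) \<partial>\<mu>) \<le> 1"
      using int by (subst nn_integral_eq_integral) auto
    moreover have "ennreal (cmod (f x)) \<le> 1 + ennreal (cmod (f x) powr q)" for x
    proof -
      have "cmod (f x) \<le> 1 + cmod (f x) powr q"
      proof (cases "cmod (f x) \<le> 1")
        case True
        then show ?thesis using powr_ge_zero[of "cmod (f x)" q] by linarith
      next
        case False
        then have "cmod (f x) powr 1 \<le> cmod (f x) powr q" using q by (intro powr_mono) auto
        then show ?thesis using False by simp
      qed
      then have "ennreal (cmod (f x)) \<le> ennreal (1 + cmod (f x) powr q)" by (rule ennreal_leI)
      then show ?thesis by simp
    qed
    ultimately show ?thesis unfolding L1_Linf_ball_def
      by (auto intro!: bexI[of _ "\<lambda>x. ennreal (cmod (f x) powr q)"])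
  qed
qed

context ground_state_kernel
begin

lemma \<psi>_integrable: "integrable \<mu> \<psi>"
proof -
  interpret adj: ground_state_kernel \<mu> "adj_kernel u" lam \<kappa> \<gamma> C0 T t1 \<psi> \<phi>
    by (rule ground_state_kernel_adj)
  show ?thesis by (rule adj.\<phi>_integrable)
qed

lemma P_L1_Linf_ball:
  assumes t: "0 < t" and [measurable]: "g \<in> borel_measurable \<mu>"
    and le: "AE x in \<mu>. ennreal (cmod (f x)) \<le> 1 + g x"
  shows "P t (\<lambda>x. ennreal (cmod (f x))) x \<le> P t (\<lambda>_. 1) x + P t g x"
  using P_mono_AE[OF le, of t x] P_add[OF t, of "\<lambda>_. 1" g x] by simp

text \<open>The bounded part contributes at most the heat content at time \<open>t1\<close>; the integrable part is
  controlled by duality, since \<open>U\<^sup>* 1\<close> is bounded at time \<open>t1\<close>.\<close>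

lemma P_t1_L1_bound:
  obtains A where "0 < A" "\<And>f. f \<in> L1_Linf_ball \<mu> \<Longrightarrow> (\<integral>\<^sup>+x. P t1 (\<lambda>y. ennreal (cmod (f y))) x \<partial>\<mu>) \<le> ennreal A"
proof -
  interpret adj: ground_state_kernel \<mu> "adj_kernel u" lam \<kappa> \<gamma> C0 T t1 \<psi> \<phi>
    by (rule ground_state_kernel_adj)
  have t1: "0 < t1" using const_bounds by simp
  obtain c where c: "0 < c" "AE x in \<mu>. Q t1 (\<lambda>_. 1) x \<le> ennreal c" by (rule adj.P_one_bounded[OF t1])
  define Z where "Z = enn2real (\<integral>\<^sup>+x. P t1 (\<lambda>_. 1) x \<partial>\<mu>)"
  have Z: "ennreal Z = (\<integral>\<^sup>+x. P t1 (\<lambda>_. 1) x \<partial>\<mu>)" "0 \<le> Z"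
    using heat_finite unfolding Z_def by auto
  show ?thesis
  proof (rule that)
    show "0 < Z + c" using c Z by simp
    fix f assume "f \<in> L1_Linf_ball \<mu>"
    then obtain g where [measurable]: "g \<in> borel_measurable \<mu>"
      and g: "AE x in \<mu>. ennreal (cmod (f x)) \<le> 1 + g x" "(\<integral>\<^sup>+x. g x \<partial>\<mu>) \<le> 1"
      unfolding L1_Linf_ball_def by auto
    have "(\<integral>\<^sup>+x. P t1 (\<lambda>y. ennreal (cmod (f y))) x \<partial>\<mu>) \<le> (\<integral>\<^sup>+x. P t1 (\<lambda>_. 1) x + P t1 g x \<partial>\<mu>)"
      by (intro nn_integral_mono P_L1_Linf_ball t1 g) auto
    also have "\<dots> = ennreal Z + (\<integral>\<^sup>+x. P t1 g x \<partial>\<mu>)"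
      unfolding Z by (intro nn_integral_add measurable_P t1) auto
    also have "(\<integral>\<^sup>+x. P t1 g x \<partial>\<mu>) = (\<integral>\<^sup>+x. Q t1 (\<lambda>_. 1) x * g x \<partial>\<mu>)"
      using P_duality[OF t1, of g "\<lambda>_. 1"] by simp
    also have "\<dots> \<le> (\<integral>\<^sup>+x. ennreal c * g x \<partial>\<mu>)"
      by (intro nn_integral_mono_AE) (use c(2) in eventually_elim, auto intro: mult_right_mono)
    also have "\<dots> = ennreal c * (\<integral>\<^sup>+x. g x \<partial>\<mu>)" by (rule nn_integral_cmult) simp
    also have "\<dots> \<le> ennreal c * 1" by (intro mult_left_mono g) auto
    finally show "(\<integral>\<^sup>+x. P t1 (\<lambda>y. ennreal (cmod (f y))) x \<partial>\<mu>) \<le> ennreal (Z + c)"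
      using c Z(2) by (simp add: add_left_mono)
  qed
qed

text \<open>After time \<open>T\<close> the kernel is essentially bounded, so integrable functions become bounded.\<close>

lemma P_Linf_bound:
  assumes r: "T < r" and f: "f \<in> L1_Linf_ball \<mu>"
  obtains c where "AE x in \<mu>. P r (\<lambda>y. ennreal (cmod (f y))) x \<le> ennreal c"
proof -
  have r': "0 < r" using r const_bounds by simp
  obtain g where g_meas[measurable]: "g \<in> borel_measurable \<mu>"
    and g: "AE x in \<mu>. ennreal (cmod (f x)) \<le> 1 + g x" "(\<integral>\<^sup>+x. g x \<partial>\<mu>) \<le> 1"
    using f unfolding L1_Linf_ball_def by auto
  obtain c where c: "0 < c" "AE x in \<mu>. P r (\<lambda>_. 1) x \<le> ennreal c" by (rule P_one_bounded[OF r'])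
  let ?b = "\<kappa> * B\<phi> * B\<psi> + C0 * exp (- \<gamma> * r)"
  have "AE x in \<mu>. P r (\<lambda>y. ennreal (cmod (f y))) x \<le> ennreal (c + exp (- lam * r) * ?b)"
    using c(2) asymptotics_nn[OF r g_meas]
  proof eventually_elim
    case (elim x)
    have "(\<integral>\<^sup>+y. ennreal (\<psi> y) * g y \<partial>\<mu>) \<le> (\<integral>\<^sup>+y. ennreal B\<psi> * g y \<partial>\<mu>)"
      by (intro nn_integral_mono mult_right_mono ennreal_leI \<psi>_le) auto
    also have "\<dots> = ennreal B\<psi> * (\<integral>\<^sup>+y. g y \<partial>\<mu>)" by (rule nn_integral_cmult) simp
    also have "\<dots> \<le> ennreal B\<psi> * 1" by (intro mult_left_mono g) auto
    finally have "ennreal (\<kappa> * \<phi> x) * (\<integral>\<^sup>+y. ennreal (\<psi> y) * g y \<partial>\<mu>) \<le> ennreal (\<kappa> * B\<phi>) * ennreal B\<psi>"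
      using const_bounds by (intro mult_mono ennreal_leI mult_left_mono \<phi>_le) auto
    moreover have "ennreal (C0 * exp (- \<gamma> * r)) * (\<integral>\<^sup>+y. g y \<partial>\<mu>) \<le> ennreal (C0 * exp (- \<gamma> * r)) * 1"
      by (intro mult_left_mono g) auto
    ultimately have le: "ennreal (exp (lam * r)) * P r g x \<le> ennreal (\<kappa> * B\<phi>) * ennreal B\<psi> + ennreal (C0 * exp (- \<gamma> * r))"
      using elim(2) by (auto intro: order_trans add_mono)
    have "P r g x = ennreal (exp (- lam * r)) * (ennreal (exp (lam * r)) * P r g x)"
      by (simp flip: mult.assoc ennreal_mult exp_add)
    also have "\<dots> \<le> ennreal (exp (- lam * r)) * ennreal ?b"
      using le const_bounds B_pos by (intro mult_left_mono) (auto simp flip: ennreal_mult)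
    also have "\<dots> = ennreal (exp (- lam * r) * ?b)"
      using const_bounds B_pos by (intro ennreal_mult[symmetric]) auto
    finally have "P r g x \<le> ennreal (exp (- lam * r) * ?b)" .
    then have "P r (\<lambda>_. 1) x + P r g x \<le> ennreal c + ennreal (exp (- lam * r) * ?b)"
      using elim(1) by (intro add_mono)
    also have "\<dots> = ennreal (c + exp (- lam * r) * ?b)"
      using c const_bounds B_pos by (intro ennreal_plus[symmetric]) auto
    finally show ?case using P_L1_Linf_ball[OF r' _ g(1), of x] by (auto intro: order_trans)
  qed
  then show ?thesis by (rule that)
qed

lemma L1_Linf_ball_summable:
  assumes f: "f \<in> L1_Linf_ball \<mu>"
  shows "f \<in> absolutely_summable_at t1" and "T < r \<Longrightarrow> f \<in> absolutely_summable_at r"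
proof -
  have m[measurable]: "f \<in> borel_measurable \<mu>" using f unfolding L1_Linf_ball_def by auto
  have t1: "0 < t1" using const_bounds by simp
  obtain A where "\<And>f. f \<in> L1_Linf_ball \<mu> \<Longrightarrow> (\<integral>\<^sup>+x. P t1 (\<lambda>y. ennreal (cmod (f y))) x \<partial>\<mu>) \<le> ennreal A"
    by (rule P_t1_L1_bound) blast
  then have "(\<integral>\<^sup>+x. P t1 (\<lambda>y. ennreal (cmod (f y))) x \<partial>\<mu>) \<noteq> \<infinity>"
    using f by (metis ennreal_neq_top infinity_ennreal_def top_unique)
  then have "AE x in \<mu>. P t1 (\<lambda>y. ennreal (cmod (f y))) x \<noteq> \<infinity>"
    by (intro nn_integral_PInf_AE measurable_P t1) auto
  then show "f \<in> absolutely_summable_at t1"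
    unfolding absolutely_summable_at_def using m by (auto simp: less_top)
  assume r: "T < r"
  obtain c where c: "AE x in \<mu>. P r (\<lambda>y. ennreal (cmod (f y))) x \<le> ennreal c"
    by (rule P_Linf_bound[OF r f])
  have "AE x in \<mu>. P r (\<lambda>y. ennreal (cmod (f y))) x < \<infinity>"
    using c by eventually_elim (auto intro: le_less_trans)
  then show "f \<in> absolutely_summable_at r"
    unfolding absolutely_summable_at_def using m by auto
qed

text \<open>\<open>U\<^sub>t f\<close> is \<open>U\<^bsub>t1\<^esub>\<close> applied to the bounded function \<open>U\<^bsub>t - t1\<^esub> f\<close>, so the strong Feller property applies.\<close>

lemma semi_continuous_version:
  assumes t: "T + t1 < t" and f: "f \<in> L1_Linf_ball \<mu>"
  shows "semi \<mu> u t f \<in> Cb" "AE x in \<mu>. kernel_op \<mu> u t f x = semi \<mu> u t f x"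
proof -
  have f_meas[measurable]: "f \<in> borel_measurable \<mu>" using f unfolding L1_Linf_ball_def by auto
  have t1: "0 < t1" using const_bounds by simp
  define r where "r = t - t1"
  have r: "T < r" "0 < r" "t = t1 + r" using t const_bounds unfolding r_def by auto
  define G where "G = kernel_op \<mu> u r f"
  have [measurable]: "G \<in> borel_measurable \<mu>" unfolding G_def by (rule measurable_kernel_op[OF r(2) f_meas])
  obtain c where c: "AE x in \<mu>. P r (\<lambda>y. ennreal (cmod (f y))) x \<le> ennreal c"
    by (rule P_Linf_bound[OF r(1) f])
  have G_le: "AE x in \<mu>. cmod (G x) \<le> max 0 c"
    using c norm_kernel_op_le[OF r(2), of f]
  proof eventually_elim
    case (elim x)
    then have "ennreal (cmod (G x)) \<le> ennreal c" unfolding G_def by (rule order_trans[rotated])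
    then have "ennreal (cmod (G x)) \<le> ennreal (max 0 c)" by (rule order_trans) (auto intro: ennreal_leI)
    then show ?case by (subst (asm) ennreal_le_iff) auto
  qed
  note GC = Feller_Cb[OF t1 _ G_le]
  have "AE x in \<mu>. kernel_op \<mu> u t f x = kernel_op \<mu> u t1 G x"
    unfolding r(3) G_def
    by (rule kernel_op_semigroup[OF t1 r(2)]) (use r t1 in \<open>auto intro!: L1_Linf_ball_summable f\<close>)
  moreover have "AE x in \<mu>. kernel_op \<mu> u t1 G x = semi \<mu> u t1 G x" by (rule GC) simp
  ultimately have ae: "AE x in \<mu>. kernel_op \<mu> u t f x = semi \<mu> u t1 G x" by eventually_elim simp
  have Cb: "semi \<mu> u t1 G \<in> Cb" by (rule GC) simp
  have "semi \<mu> u t f = semi \<mu> u t1 G"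
    unfolding semi_def[of \<mu> u t f]
    by (rule continuous_version_eqI[OF sets_mu full_support _ ae]) (use Cb in \<open>simp add: Cb_def\<close>)
  then show "semi \<mu> u t f \<in> Cb" "AE x in \<mu>. kernel_op \<mu> u t f x = semi \<mu> u t f x" using ae Cb by auto
qed

text \<open>The error of replacing \<open>e\<^bsup>lam s\<^esup> U\<^sub>s\<close> by the rank one operator is an integral operator whose kernel is
  bounded by \<open>C0 e\<^bsup>-\<gamma> s\<^esup>\<close>, hence maps \<open>L\<^sup>1\<close> to \<open>L\<^sup>\<infinity>\<close> with that norm.\<close>

lemma rank_one_approximation:
  fixes F :: "'a \<Rightarrow> complex"
  assumes s: "T < s" and F[measurable]: "F \<in> borel_measurable \<mu>"
    and A: "(\<integral>\<^sup>+y. ennreal (cmod (F y)) \<partial>\<mu>) \<le> ennreal A" "0 \<le> A"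
  shows "AE x in \<mu>. cmod (exp (lam * s) *\<^sub>R kernel_op \<mu> u s F x - (\<kappa> * \<phi> x) *\<^sub>R (LINT y|\<mu>. \<psi> y *\<^sub>R F y))
    \<le> C0 * exp (- \<gamma> * s) * A"
proof -
  have s': "0 < s" using s const_bounds by simp
  let ?d = "C0 * exp (- \<gamma> * s)" and ?e = "exp (lam * s)"
  have intF: "integrable \<mu> F"
    using A by (intro integrableI_bounded) (auto intro: le_less_trans)
  then have int_norm: "integrable \<mu> (\<lambda>y. cmod (F y))" by simp
  have LA: "(LINT y|\<mu>. cmod (F y)) \<le> A"
    using A nn_integral_eq_integral[OF int_norm] by (auto simp: ennreal_le_iff)
  have int\<psi>: "integrable \<mu> (\<lambda>y. \<psi> y *\<^sub>R F y)"
    by (rule Bochner_Integration.integrable_bound[where f = "\<lambda>y. B\<psi> * cmod (F y)"])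
      (use int_norm \<psi>_le B_pos in \<open>auto intro!: mult_right_mono\<close>)
  show ?thesis
    using asymptotics[OF s]
  proof eventually_elim
    case (elim x)
    note [measurable] = measurable_section[OF s', of x]
    define G where "G y = (?e * u s x y - \<kappa> * \<phi> x * \<psi> y) *\<^sub>R F y" for y
    have G_le: "AE y in \<mu>. cmod (G y) \<le> ?d * cmod (F y)"
      using elim by eventually_elim (auto simp: G_def intro!: mult_right_mono)
    have intG: "integrable \<mu> G"
      by (rule Bochner_Integration.integrable_bound[where f = "\<lambda>y. ?d * cmod (F y)"])
        (use int_norm G_le const_bounds in \<open>auto simp: G_def[abs_def] elim!: eventually_mono\<close>)
    have uF: "?e *\<^sub>R (u s x y *\<^sub>R F y) = G y + (\<kappa> * \<phi> x) *\<^sub>R (\<psi> y *\<^sub>R F y)" for y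
      unfolding G_def by (simp add: scaleR_left_diff_distrib)
    have "?e *\<^sub>R kernel_op \<mu> u s F x = (LINT y|\<mu>. ?e *\<^sub>R (u s x y *\<^sub>R F y))"
      unfolding kernel_op_def by (simp only: integral_scaleR_right)
    also have "\<dots> = (LINT y|\<mu>. G y) + (LINT y|\<mu>. (\<kappa> * \<phi> x) *\<^sub>R (\<psi> y *\<^sub>R F y))"
      unfolding uF by (rule Bochner_Integration.integral_add[OF intG integrable_scaleR_right[OF int\<psi>]])
    also have "(LINT y|\<mu>. (\<kappa> * \<phi> x) *\<^sub>R (\<psi> y *\<^sub>R F y)) = (\<kappa> * \<phi> x) *\<^sub>R (LINT y|\<mu>. \<psi> y *\<^sub>R F y)"
      by (rule integral_scaleR_right)
    finally have "cmod (?e *\<^sub>R kernel_op \<mu> u s F x - (\<kappa> * \<phi> x) *\<^sub>R (LINT y|\<mu>. \<psi> y *\<^sub>R F y)) = cmod (LINT y|\<mu>. G y)"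
      by simp
    also have "\<dots> \<le> (LINT y|\<mu>. cmod (G y))" by (rule integral_norm_bound)
    also have "\<dots> \<le> (LINT y|\<mu>. ?d * cmod (F y))"
      using intG int_norm G_le by (intro integral_mono_AE) auto
    also have "\<dots> = ?d * (LINT y|\<mu>. cmod (F y))" by simp
    also have "\<dots> \<le> ?d * A" using const_bounds LA by (intro mult_left_mono) auto
    finally show ?case .
  qed
qed

text \<open>Fubini and the eigenvalue equation of \<open>\<psi>\<close> for the transposed kernel.\<close>

lemma integral_\<psi>_kernel_op:
  assumes f[measurable]: "f \<in> borel_measurable \<mu>"
    and fin: "(\<integral>\<^sup>+x. P t1 (\<lambda>y. ennreal (cmod (f y))) x \<partial>\<mu>) < \<infinity>"
  shows "(LINT x|\<mu>. \<psi> x *\<^sub>R kernel_op \<mu> u t1 f x) = exp (- lam * t1) *\<^sub>R (LINT y|\<mu>. \<psi> y *\<^sub>R f y)"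
proof -
  interpret adj: ground_state_kernel \<mu> "adj_kernel u" lam \<kappa> \<gamma> C0 T t1 \<psi> \<phi>
    by (rule ground_state_kernel_adj)
  have t1: "0 < t1" using const_bounds by simp
  note [measurable] = measurable_u[OF t1]
  have mP[measurable]: "P t1 (\<lambda>y. ennreal (cmod (f y))) \<in> borel_measurable \<mu>" by (rule measurable_P[OF t1]) simp
  define H where "H x y = \<psi> x *\<^sub>R (u t1 x y *\<^sub>R f y)" for x y
  have mH[measurable]: "case_prod H \<in> borel_measurable (\<mu> \<Otimes>\<^sub>M \<mu>)" unfolding H_def by measurable
  have int: "integrable (\<mu> \<Otimes>\<^sub>M \<mu>) (case_prod H)"
  proof (rule integrableI_bounded[OF mH])
    have "(\<integral>\<^sup>+p. ennreal (norm (case_prod H p)) \<partial>(\<mu> \<Otimes>\<^sub>M \<mu>)) = (\<integral>\<^sup>+x. \<integral>\<^sup>+y. ennreal (norm (H x y)) \<partial>\<mu> \<partial>\<mu>)"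
      by (subst nn_integral_fst[symmetric]) auto
    also have "\<dots> \<le> (\<integral>\<^sup>+x. ennreal B\<psi> * P t1 (\<lambda>y. ennreal (cmod (f y))) x \<partial>\<mu>)"
    proof (rule nn_integral_mono_AE)
      show "AE x in \<mu>. (\<integral>\<^sup>+y. ennreal (norm (H x y)) \<partial>\<mu>) \<le> ennreal B\<psi> * P t1 (\<lambda>y. ennreal (cmod (f y))) x"
        using nn_integral_norm_section[OF t1, of f]
      proof eventually_elim
        case (elim x)
        note [measurable] = measurable_section[OF t1, of x]
        have "(\<integral>\<^sup>+y. ennreal (norm (H x y)) \<partial>\<mu>) = (\<integral>\<^sup>+y. ennreal (\<psi> x) * ennreal (norm (u t1 x y *\<^sub>R f y)) \<partial>\<mu>)"
          unfolding H_def by (intro nn_integral_cong) (simp add: abs_mult flip: ennreal_mult)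
        also have "\<dots> = ennreal (\<psi> x) * (\<integral>\<^sup>+y. ennreal (norm (u t1 x y *\<^sub>R f y)) \<partial>\<mu>)"
          by (rule nn_integral_cmult) measurable
        also have "\<dots> \<le> ennreal B\<psi> * P t1 (\<lambda>y. ennreal (cmod (f y))) x"
          unfolding elim by (intro mult_right_mono ennreal_leI \<psi>_le) auto
        finally show ?case .
      qed
    qed
    also have "\<dots> = ennreal B\<psi> * (\<integral>\<^sup>+x. P t1 (\<lambda>y. ennreal (cmod (f y))) x \<partial>\<mu>)"
      by (rule nn_integral_cmult) simp
    also have "\<dots> < \<infinity>" using fin by (simp add: ennreal_mult_less_top)
    finally show "(\<integral>\<^sup>+p. ennreal (norm (case_prod H p)) \<partial>(\<mu> \<Otimes>\<^sub>M \<mu>)) < \<infinity>" .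
  qed
  have "AE y in \<mu>. kernel_op \<mu> (adj_kernel u) t1 \<psi> y = enn2real (Q t1 (\<lambda>x. ennreal (\<psi> x)) y)"
    using t1 by (intro adj.kernel_op_eq_enn2real) auto
  then have adj_eigen: "AE y in \<mu>. (LINT x|\<mu>. H x y) = (exp (- lam * t1) * \<psi> y) *\<^sub>R f y"
    using adj.eigenfunction[OF t1]
  proof eventually_elim
    case (elim y)
    have "\<psi> y = enn2real (ennreal (\<psi> y))" by simp
    also have "\<dots> = exp (lam * t1) * enn2real (Q t1 (\<lambda>x. ennreal (\<psi> x)) y)"
      unfolding elim(2) by (simp add: enn2real_mult)
    finally have e: "enn2real (Q t1 (\<lambda>x. ennreal (\<psi> x)) y) = exp (- lam * t1) * \<psi> y"
      by (simp add: exp_minus field_simps)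
    have "(LINT x|\<mu>. H x y) = (LINT x|\<mu>. (adj_kernel u t1 y x *\<^sub>R \<psi> x) *\<^sub>R f y)"
      unfolding H_def adj_kernel_def by (simp add: mult.commute)
    also have "\<dots> = kernel_op \<mu> (adj_kernel u) t1 \<psi> y *\<^sub>R f y"
      unfolding kernel_op_def
    proof (cases "f y = 0")
      case False
      then show "(LINT x|\<mu>. (adj_kernel u t1 y x *\<^sub>R \<psi> x) *\<^sub>R f y) = (LINT x|\<mu>. adj_kernel u t1 y x *\<^sub>R \<psi> x) *\<^sub>R f y"
        by (simp add: scaleR_conv_of_real flip: integral_complex_of_real)
    qed simp
    finally show ?case unfolding elim(1) e .
  qed
  have mI: "(\<lambda>y. LINT x|\<mu>. H x y) \<in> borel_measurable \<mu>" by measurable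
  have "(LINT x|\<mu>. \<psi> x *\<^sub>R kernel_op \<mu> u t1 f x) = (LINT x|\<mu>. LINT y|\<mu>. H x y)"
    unfolding H_def kernel_op_def by (simp only: integral_scaleR_right)
  also have "\<dots> = (LINT y|\<mu>. LINT x|\<mu>. H x y)"
    using int by (rule pair.Fubini_integral[symmetric])
  also have "\<dots> = (LINT y|\<mu>. (exp (- lam * t1) * \<psi> y) *\<^sub>R f y)"
    using mI adj_eigen by (intro integral_cong_AE) auto
  also have "\<dots> = exp (- lam * t1) *\<^sub>R (LINT y|\<mu>. \<psi> y *\<^sub>R f y)"
    by (simp flip: scaleR_scaleR)
  finally show ?thesis .
qed

text \<open>The first stretch of time, \<open>t1\<close>, is spent on making \<open>f\<close> integrable; the rank one approximation is
  then applied to \<open>F = U\<^bsub>t1\<^esub> f\<close> for the remaining time \<open>t - t1\<close>. Since \<open>\<psi>\<close> is an eigenfunction of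
  the transposed operator, the integral of \<open>\<psi> F\<close> can be expressed by that of \<open>\<psi> f\<close>. The estimate holds at every
  point because both sides are continuous and the reference measure has full support.\<close>

proposition semi_asymptotics:
  obtains D where "0 < D" "\<And>f t x. f \<in> L1_Linf_ball \<mu> \<Longrightarrow> T + t1 < t \<Longrightarrow>
    cmod (exp (lam * t) *\<^sub>R semi \<mu> u t f x - (\<kappa> * \<phi> x) *\<^sub>R (LINT y|\<mu>. \<psi> y *\<^sub>R f y)) \<le> D * exp (- \<gamma> * t)"
proof -
  obtain A where A: "0 < A"
    "\<And>f. f \<in> L1_Linf_ball \<mu> \<Longrightarrow> (\<integral>\<^sup>+x. P t1 (\<lambda>y. ennreal (cmod (f y))) x \<partial>\<mu>) \<le> ennreal A"
    by (rule P_t1_L1_bound) blast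
  have t1: "0 < t1" using const_bounds by simp
  define D where "D = C0 * A * exp ((lam + \<gamma>) * t1)"
  show ?thesis
  proof (rule that)
    show "0 < D" unfolding D_def using const_bounds A by simp
    fix f t x assume f: "f \<in> L1_Linf_ball \<mu>" and t: "T + t1 < t"
    have f_meas[measurable]: "f \<in> borel_measurable \<mu>" using f unfolding L1_Linf_ball_def by auto
    define s where "s = t - t1"
    have s: "T < s" "0 < s" "t = s + t1" using t const_bounds unfolding s_def by auto
    define F where "F = kernel_op \<mu> u t1 f"
    have F_meas: "F \<in> borel_measurable \<mu>" unfolding F_def by (rule measurable_kernel_op[OF t1 f_meas])
    have "(\<integral>\<^sup>+x. ennreal (cmod (F x)) \<partial>\<mu>) \<le> (\<integral>\<^sup>+x. P t1 (\<lambda>y. ennreal (cmod (f y))) x \<partial>\<mu>)"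
      unfolding F_def by (intro nn_integral_mono_AE norm_kernel_op_le t1)
    also have "\<dots> \<le> ennreal A" by (rule A(2)[OF f])
    finally have F_L1: "(\<integral>\<^sup>+x. ennreal (cmod (F x)) \<partial>\<mu>) \<le> ennreal A" .
    let ?J = "LINT y|\<mu>. \<psi> y *\<^sub>R f y"
    have J: "(LINT y|\<mu>. \<psi> y *\<^sub>R F y) = exp (- lam * t1) *\<^sub>R ?J"
      unfolding F_def by (rule integral_\<psi>_kernel_op[OF f_meas]) (rule le_less_trans[OF A(2)[OF f]], simp)
    have sg: "AE x in \<mu>. kernel_op \<mu> u t f x = kernel_op \<mu> u s F x"
      unfolding F_def s(3)
      by (rule kernel_op_semigroup[OF s(2) t1]) (use s t1 in \<open>auto intro!: L1_Linf_ball_summable f\<close>)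
    have ae: "AE x in \<mu>. cmod (exp (lam * t) *\<^sub>R semi \<mu> u t f x - (\<kappa> * \<phi> x) *\<^sub>R ?J) \<le> D * exp (- \<gamma> * t)"
      using rank_one_approximation[OF s(1) F_meas F_L1 less_imp_le[OF A(1)]] semi_continuous_version(2)[OF t f] sg
    proof eventually_elim
      case (elim x)
      have le: "cmod (exp (lam * s) *\<^sub>R semi \<mu> u t f x - (\<kappa> * \<phi> x) *\<^sub>R exp (- lam * t1) *\<^sub>R ?J)
          \<le> C0 * exp (- \<gamma> * s) * A"
        using elim A(1) unfolding J by simp
      have "exp (lam * t) *\<^sub>R semi \<mu> u t f x - (\<kappa> * \<phi> x) *\<^sub>R ?J
          = exp (lam * t1) *\<^sub>R (exp (lam * s) *\<^sub>R semi \<mu> u t f x - (\<kappa> * \<phi> x) *\<^sub>R exp (- lam * t1) *\<^sub>R ?J)"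
        unfolding s(3) by (simp add: scaleR_right_diff_distrib distrib_left exp_add exp_minus mult_ac)
      then have "cmod (exp (lam * t) *\<^sub>R semi \<mu> u t f x - (\<kappa> * \<phi> x) *\<^sub>R ?J)
          = exp (lam * t1) * cmod (exp (lam * s) *\<^sub>R semi \<mu> u t f x - (\<kappa> * \<phi> x) *\<^sub>R exp (- lam * t1) *\<^sub>R ?J)"
        by (simp only: norm_scaleR) simp
      also have "\<dots> \<le> exp (lam * t1) * (C0 * exp (- \<gamma> * s) * A)"
        by (intro mult_left_mono le) simp
      also have "\<dots> = C0 * A * (exp (lam * t1) * exp (- \<gamma> * s))" by simp
      also have "exp (lam * t1) * exp (- \<gamma> * s) = exp ((lam + \<gamma>) * t1) * exp (- \<gamma> * t)"
        unfolding s(3) exp_add[symmetric] by (simp add: algebra_simps)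
      also have "C0 * A * (exp ((lam + \<gamma>) * t1) * exp (- \<gamma> * t)) = D * exp (- \<gamma> * t)"
        unfolding D_def by simp
      finally show ?case .
    qed
    show "cmod (exp (lam * t) *\<^sub>R semi \<mu> u t f x - (\<kappa> * \<phi> x) *\<^sub>R ?J) \<le> D * exp (- \<gamma> * t)"
    proof (rule full_support_le[OF sets_mu full_support _ _ ae])
      have "continuous_on UNIV (semi \<mu> u t f)"
        using semi_continuous_version(1)[OF t f] by (simp add: Cb_def)
      then show "continuous_on UNIV (\<lambda>x. cmod (exp (lam * t) *\<^sub>R semi \<mu> u t f x - (\<kappa> * \<phi> x) *\<^sub>R ?J))"
        by (intro continuous_intros \<phi>_cont)
    qed (rule continuous_on_const)
  qed
qed

end

section \<open>Domination by the ground state and quasi-ergodicity\<close>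

text \<open>The complement of the support is a union of open null sets, and by the Lindeloef property it is a
  countable such union.\<close>

lemma AE_in_closed_support:
  fixes \<sigma> :: "'a::second_countable_topology measure"
  assumes sets: "sets \<sigma> = sets borel" and supp: "measure_support \<sigma> \<subseteq> S" and S: "closed S"
  shows "AE x in \<sigma>. x \<in> S"
proof -
  define N where "N = {V. open V \<and> emeasure \<sigma> V = 0}"
  have N_open: "open V" if "V \<in> N" for V using that unfolding N_def by simp
  obtain N' where N': "N' \<subseteq> N" "countable N'" "\<Union>N' = \<Union>N"
    using Lindelof[OF N_open] by blast
  have "(\<Union>V\<in>N'. V) \<in> null_sets \<sigma>"
    using N' sets by (intro null_sets_UN') (auto simp: N_def intro!: null_setsI)
  then have "\<Union>N \<in> null_sets \<sigma>" using N'(3) by simp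
  moreover have "{x \<in> space \<sigma>. x \<notin> S} \<subseteq> \<Union>N"
  proof safe
    fix x assume "x \<notin> S"
    then have "x \<notin> measure_support \<sigma>" using supp by auto
    then show "x \<in> \<Union>N" unfolding measure_support_def N_def by (auto simp: not_gr_zero)
  qed
  ultimately show ?thesis by (intro AE_I'[of "\<Union>N"])
qed

lemma integrable_Cb:
  fixes g :: "'a::topological_space \<Rightarrow> 'c::{banach, second_countable_topology}"
  assumes "prob_space \<sigma>" and sets: "sets \<sigma> = sets borel" and g: "g \<in> Cb"
  shows "integrable \<sigma> g"
proof -
  interpret prob_space \<sigma> by fact
  obtain b where b: "\<And>x. norm (g x) \<le> b" using g unfolding Cb_def bounded_iff by auto
  have "g \<in> borel_measurable \<sigma>"
    using g borel_measurable_continuous_onI[of g] measurable_cong_sets[OF sets refl]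
    unfolding Cb_def by blast
  then show ?thesis by (intro integrable_const_bound[where B = b]) (auto simp: b)
qed

text \<open>Numerator and denominator of a quotient are close to \<open>c w\<close> and \<open>c I\<close> with the same unknown factor
  \<open>c\<close>, which cancels; only a lower bound for the denominator \<open>b\<close> itself enters.\<close>

lemma cmod_quotient_diff_le:
  fixes z w :: complex and b c I \<delta> :: real
  assumes I: "0 < I" and b: "0 < b"
    and z: "cmod (z - of_real c * w) \<le> \<delta>" and b_close: "\<bar>b - c * I\<bar> \<le> \<delta>"
  shows "cmod (z / of_real b - w / of_real I) \<le> \<delta> * (1 + cmod w / I) / b"
proof -
  have "z / of_real b - w / of_real I = ((z - of_real c * w) + w / of_real I * of_real (c * I - b)) / of_real b"
    using I b by (simp add: field_simps)
  then have "cmod (z / of_real b - w / of_real I) = cmod ((z - of_real c * w) + w / of_real I * of_real (c * I - b)) / b"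
    using b by (simp add: norm_divide)
  also have "\<dots> \<le> (\<delta> + cmod w / I * \<delta>) / b"
  proof (intro divide_right_mono norm_triangle_le add_mono z)
    have "cmod (w / of_real I * of_real (c * I - b)) = cmod w / I * \<bar>b - c * I\<bar>"
      using I by (simp add: norm_mult norm_divide abs_minus_commute del: of_real_diff of_real_mult)
    also have "\<dots> \<le> cmod w / I * \<delta>" using I b_close by (intro mult_left_mono) auto
    finally show "cmod (w / of_real I * of_real (c * I - b)) \<le> cmod w / I * \<delta>" .
  qed (use b in auto)
  finally show ?thesis by (simp add: algebra_simps)
qed

context ground_state_kernel
begin

lemma integral_\<psi>_pos: "0 < (LINT y|\<mu>. \<psi> y)"
proof -
  have "0 < emeasure \<mu> UNIV" using full_support unfolding measure_support_def by auto
  then have "\<not> (AE x in \<mu>. \<psi> x = 0)"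
    using \<psi>_pos AE_iff_measurable[of UNIV \<mu> "\<lambda>x. \<psi> x = 0"] sets.top[of \<mu>] by (auto simp: less_le)
  then have "(LINT y|\<mu>. \<psi> y) \<noteq> 0" using integral_nonneg_eq_0_iff_AE[OF \<psi>_integrable] by simp
  moreover have "0 \<le> (LINT y|\<mu>. \<psi> y)" by simp
  ultimately show ?thesis by linarith
qed

lemma semi1_asymptotics:
  assumes D: "cmod (exp (lam * t) *\<^sub>R semi \<mu> u t (\<lambda>_. 1) x - (\<kappa> * \<phi> x) *\<^sub>R (LINT y|\<mu>. \<psi> y *\<^sub>R 1)) \<le> b"
    and t: "0 < t"
  shows "\<bar>exp (lam * t) * semi1 \<mu> u t x - \<kappa> * \<phi> x * (LINT y|\<mu>. \<psi> y)\<bar> \<le> b"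
proof -
  have "(LINT y|\<mu>. \<psi> y *\<^sub>R (1 :: complex)) = of_real (LINT y|\<mu>. \<psi> y)"
    by (simp add: scaleR_conv_of_real)
  then have "exp (lam * t) *\<^sub>R semi \<mu> u t (\<lambda>_. 1) x - (\<kappa> * \<phi> x) *\<^sub>R (LINT y|\<mu>. \<psi> y *\<^sub>R 1)
      = complex_of_real (exp (lam * t) * semi1 \<mu> u t x - \<kappa> * \<phi> x * (LINT y|\<mu>. \<psi> y))"
    unfolding semi_one(1)[OF t] by (simp add: scaleR_conv_of_real)
  then show ?thesis using D by (simp only: norm_of_real)
qed

text \<open>Where \<open>\<phi>\<close> is at least \<open>e\<^bsup>-\<gamma> t\<^esup>\<close>, the error term in the asymptotics of \<open>U\<^sub>t 1\<close> is itself dominated by \<open>\<phi>\<close>.\<close>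

proposition semi1_le_ground_state:
  obtains C where "0 < C"
    "\<And>t x. T + t1 < t \<Longrightarrow> exp (- \<gamma> * t) \<le> \<phi> x \<Longrightarrow> semi1 \<mu> u t x \<le> C * exp (- lam * t) * \<phi> x"
proof -
  obtain D where D: "0 < D" "\<And>f t x. f \<in> L1_Linf_ball \<mu> \<Longrightarrow> T + t1 < t \<Longrightarrow>
    cmod (exp (lam * t) *\<^sub>R semi \<mu> u t f x - (\<kappa> * \<phi> x) *\<^sub>R (LINT y|\<mu>. \<psi> y *\<^sub>R f y)) \<le> D * exp (- \<gamma> * t)"
    using semi_asymptotics by blast
  let ?I = "LINT y|\<mu>. \<psi> y"
  show ?thesis
  proof (rule that)
    show "0 < \<kappa> * ?I + D" using D(1) const_bounds integral_\<psi>_pos by (simp add: add_pos_pos)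
    fix t x assume t: "T + t1 < t" and x: "exp (- \<gamma> * t) \<le> \<phi> x"
    have "0 < t" using t const_bounds by simp
    have "exp (lam * t) * semi1 \<mu> u t x \<le> \<kappa> * \<phi> x * ?I + D * exp (- \<gamma> * t)"
      using semi1_asymptotics[OF D(2)[OF L1_Linf_ball_one t] \<open>0 < t\<close>, of x] by (simp add: abs_le_iff)
    also have "\<dots> \<le> \<kappa> * \<phi> x * ?I + D * \<phi> x" using x D(1) by simp
    also have "\<dots> = (\<kappa> * ?I + D) * \<phi> x" by (simp add: algebra_simps)
    finally have le: "exp (lam * t) * semi1 \<mu> u t x \<le> (\<kappa> * ?I + D) * \<phi> x" .
    have "exp (- lam * t) * exp (lam * t) = 1" by (simp flip: exp_add)
    then have "semi1 \<mu> u t x = exp (- lam * t) * (exp (lam * t) * semi1 \<mu> u t x)"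
      by (simp only: mult.assoc[symmetric])
    also have "\<dots> \<le> exp (- lam * t) * ((\<kappa> * ?I + D) * \<phi> x)" by (intro mult_left_mono le) simp
    also have "\<dots> = (\<kappa> * ?I + D) * exp (- lam * t) * \<phi> x" by simp
    finally show "semi1 \<mu> u t x \<le> (\<kappa> * ?I + D) * exp (- lam * t) * \<phi> x" .
  qed
qed

lemma cmod_integral_\<psi>_le:
  assumes f: "f \<in> L1_Linf_ball \<mu>"
  shows "cmod (LINT y|\<mu>. \<psi> y *\<^sub>R f y) \<le> (LINT y|\<mu>. \<psi> y) + B\<psi>"
proof (cases "integrable \<mu> (\<lambda>y. \<psi> y *\<^sub>R f y)")
  case True
  obtain g where [measurable]: "g \<in> borel_measurable \<mu>"
    and g: "AE x in \<mu>. ennreal (cmod (f x)) \<le> 1 + g x" "(\<integral>\<^sup>+x. g x \<partial>\<mu>) \<le> 1"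
    using f unfolding L1_Linf_ball_def by auto
  have "ennreal (cmod (LINT y|\<mu>. \<psi> y *\<^sub>R f y)) \<le> (\<integral>\<^sup>+y. ennreal (cmod (\<psi> y *\<^sub>R f y)) \<partial>\<mu>)"
    by (rule integral_norm_bound_ennreal[OF True])
  also have "\<dots> \<le> (\<integral>\<^sup>+y. ennreal (\<psi> y) + ennreal B\<psi> * g y \<partial>\<mu>)"
  proof (rule nn_integral_mono_AE)
    show "AE y in \<mu>. ennreal (cmod (\<psi> y *\<^sub>R f y)) \<le> ennreal (\<psi> y) + ennreal B\<psi> * g y"
      using g(1)
    proof eventually_elim
      case (elim y)
      have "ennreal (cmod (\<psi> y *\<^sub>R f y)) = ennreal (\<psi> y) * ennreal (cmod (f y))"
        by (simp add: ennreal_mult)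
      also have "\<dots> \<le> ennreal (\<psi> y) * (1 + g y)" by (intro mult_left_mono elim) auto
      also have "\<dots> \<le> ennreal (\<psi> y) + ennreal B\<psi> * g y"
        by (auto simp: distrib_left intro!: add_left_mono mult_right_mono ennreal_leI \<psi>_le)
      finally show ?case .
    qed
  qed
  also have "\<dots> = (\<integral>\<^sup>+y. ennreal (\<psi> y) \<partial>\<mu>) + ennreal B\<psi> * (\<integral>\<^sup>+y. g y \<partial>\<mu>)"
    by (simp add: nn_integral_add nn_integral_cmult)
  also have "(\<integral>\<^sup>+y. ennreal (\<psi> y) \<partial>\<mu>) = ennreal (LINT y|\<mu>. \<psi> y)"
    by (rule nn_integral_eq_integral[OF \<psi>_integrable]) simp
  also have "ennreal (LINT y|\<mu>. \<psi> y) + ennreal B\<psi> * (\<integral>\<^sup>+y. g y \<partial>\<mu>) \<le> ennreal (LINT y|\<mu>. \<psi> y) + ennreal B\<psi> * 1"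
    by (intro add_left_mono mult_left_mono g) auto
  also have "\<dots> = ennreal ((LINT y|\<mu>. \<psi> y) + B\<psi>)" using B_pos by simp
  finally show ?thesis using B_pos integral_\<psi>_pos by (subst (asm) ennreal_le_iff) auto
next
  case False
  then show ?thesis using B_pos integral_\<psi>_pos by (simp add: not_integrable_integral_eq)
qed

text \<open>Let \<open>a\<close> be the integral of \<open>\<phi>\<close> with respect to \<open>\<sigma>\<close>. Integrating the asymptotics over \<open>\<sigma>\<close> shows that numerator
  and denominator are \<open>\<kappa> a\<close> times the integrals of \<open>\<psi> f\<close> and \<open>\<psi>\<close>, up to an error of order \<open>e\<^bsup>-\<gamma> t\<^esup>\<close>. The
  denominator is at least \<open>a / sup \<phi>\<close>, hence at least of order \<open>e\<^bsup>-\<gamma> t / 2\<^esup>\<close> by the choice of \<open>S\<close>. Dividing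
  costs half of the rate.\<close>

proposition quasi_ergodic_error_le:
  obtains C where "0 < C"
    "\<And>t (p :: ennreal) S. T + t1 < t \<Longrightarrow> 1 \<le> p \<Longrightarrow> closed S \<Longrightarrow> (\<And>x. x \<in> S \<Longrightarrow> exp (- (\<gamma> / 2) * t) \<le> \<phi> x) \<Longrightarrow>
       quasi_ergodic_error \<mu> u (normalized_measure \<mu> \<psi>) p S t \<le> ennreal (C * exp (- (\<gamma> / 2) * t))"
proof -
  obtain D where D: "0 < D" "\<And>f t x. f \<in> L1_Linf_ball \<mu> \<Longrightarrow> T + t1 < t \<Longrightarrow>
    cmod (exp (lam * t) *\<^sub>R semi \<mu> u t f x - (\<kappa> * \<phi> x) *\<^sub>R (LINT y|\<mu>. \<psi> y *\<^sub>R f y)) \<le> D * exp (- \<gamma> * t)"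
    using semi_asymptotics by blast
  define I where "I = (LINT y|\<mu>. \<psi> y)"
  have I: "0 < I" unfolding I_def by (rule integral_\<psi>_pos)
  define C where "C = D * B\<phi> * (2 + B\<psi> / I)"
  show ?thesis
  proof (rule that)
    show "0 < C" unfolding C_def using D(1) B_pos I by (simp add: add_pos_pos)
    fix t and p :: ennreal and S assume t: "T + t1 < t" and p: "1 \<le> p" and S: "closed S"
      and S_large: "\<And>x. x \<in> S \<Longrightarrow> exp (- (\<gamma> / 2) * t) \<le> \<phi> x"
    have t_pos: "0 < t" using t const_bounds by simp
    show "quasi_ergodic_error \<mu> u (normalized_measure \<mu> \<psi>) p S t \<le> ennreal (C * exp (- (\<gamma> / 2) * t))"
      unfolding quasi_ergodic_error_def
    proof (intro SUP_least ennreal_leI)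
      fix \<sigma> and f :: "'a \<Rightarrow> complex"
      assume \<sigma>: "\<sigma> \<in> probs_supported_in S" and "f \<in> {f. f \<in> Lp_space \<mu> p \<and> Lp_norm \<mu> p f \<le> 1}"
      then have f: "f \<in> L1_Linf_ball \<mu>" using Lp_ball_subset_L1_Linf_ball[OF p] by auto
      then have f_meas: "f \<in> borel_measurable \<mu>" unfolding L1_Linf_ball_def by auto
      have sets_\<sigma>: "sets \<sigma> = sets borel" and "prob_space \<sigma>" and supp_\<sigma>: "measure_support \<sigma> \<subseteq> S"
        using \<sigma> unfolding probs_supported_in_def by auto
      interpret \<sigma>: prob_space \<sigma> by fact
      note int = integrable_Cb[OF \<open>prob_space \<sigma>\<close> sets_\<sigma>]
      have int_\<phi>: "integrable \<sigma> \<phi>" by (rule int[OF \<phi>_Cb])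
      have int_f: "integrable \<sigma> (semi \<mu> u t f)" by (rule int[OF semi_continuous_version(1)[OF t f]])
      have int_1: "integrable \<sigma> (semi1 \<mu> u t)" by (rule int[OF semi_one(2)[OF t_pos]])
      define a where "a = (LINT x|\<sigma>. \<phi> x)"
      define J where "J = (LINT y|\<mu>. \<psi> y *\<^sub>R f y)"
      define z where "z = exp (lam * t) *\<^sub>R (LINT x|\<sigma>. semi \<mu> u t f x)"
      define b where "b = exp (lam * t) * (LINT x|\<sigma>. semi1 \<mu> u t x)"
      define \<delta> where "\<delta> = D * exp (- \<gamma> * t)"
      have "exp (- (\<gamma> / 2) * t) = (LINT x|\<sigma>. exp (- (\<gamma> / 2) * t))" by (simp add: \<sigma>.prob_space)
      also have "\<dots> \<le> a"
        unfolding a_def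
      proof (rule integral_mono_AE[OF _ int_\<phi>])
        show "AE x in \<sigma>. exp (- (\<gamma> / 2) * t) \<le> \<phi> x"
          using AE_in_closed_support[OF sets_\<sigma> supp_\<sigma> S] by eventually_elim (rule S_large)
      qed simp
      finally have a: "exp (- (\<gamma> / 2) * t) \<le> a" .
      then have a_pos: "0 < a" by (rule less_le_trans[OF exp_gt_zero])
      have z_close: "cmod (z - of_real (\<kappa> * a) * J) \<le> \<delta>"
      proof -
        have int2: "integrable \<sigma> (\<lambda>x. exp (lam * t) *\<^sub>R semi \<mu> u t f x)" "integrable \<sigma> (\<lambda>x. (\<kappa> * \<phi> x) *\<^sub>R J)"
          using int_f int_\<phi> by auto
        have "z - of_real (\<kappa> * a) * J = (LINT x|\<sigma>. exp (lam * t) *\<^sub>R semi \<mu> u t f x) - (LINT x|\<sigma>. (\<kappa> * \<phi> x) *\<^sub>R J)"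
          unfolding z_def a_def using int_\<phi> by (simp add: scaleR_conv_of_real)
        also have "\<dots> = (LINT x|\<sigma>. exp (lam * t) *\<^sub>R semi \<mu> u t f x - (\<kappa> * \<phi> x) *\<^sub>R J)"
          by (rule Bochner_Integration.integral_diff[OF int2, symmetric])
        also have "cmod \<dots> \<le> (LINT x|\<sigma>. cmod (exp (lam * t) *\<^sub>R semi \<mu> u t f x - (\<kappa> * \<phi> x) *\<^sub>R J))"
          by (rule integral_norm_bound)
        also have "\<dots> \<le> (LINT x|\<sigma>. \<delta>)"
          unfolding \<delta>_def J_def
          by (rule integral_mono) (use int2 D(2)[OF f t] in \<open>auto simp: J_def\<close>)
        finally show ?thesis by (simp add: \<sigma>.prob_space)
      qed
      have b_close: "\<bar>b - \<kappa> * a * I\<bar> \<le> \<delta>"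
      proof -
        have int2: "integrable \<sigma> (\<lambda>x. exp (lam * t) * semi1 \<mu> u t x)" "integrable \<sigma> (\<lambda>x. \<kappa> * \<phi> x * I)"
          using int_1 int_\<phi> by auto
        have "b - \<kappa> * a * I = (LINT x|\<sigma>. exp (lam * t) * semi1 \<mu> u t x) - (LINT x|\<sigma>. \<kappa> * \<phi> x * I)"
          unfolding b_def a_def by simp
        also have "\<dots> = (LINT x|\<sigma>. exp (lam * t) * semi1 \<mu> u t x - \<kappa> * \<phi> x * I)"
          by (rule Bochner_Integration.integral_diff[OF int2, symmetric])
        also have "\<bar>\<dots>\<bar> \<le> (LINT x|\<sigma>. \<bar>exp (lam * t) * semi1 \<mu> u t x - \<kappa> * \<phi> x * I\<bar>)"
          by (rule integral_abs_bound)
        also have "\<dots> \<le> (LINT x|\<sigma>. \<delta>)"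
          unfolding \<delta>_def I_def
          by (rule integral_mono)
            (use int2 semi1_asymptotics[OF D(2)[OF L1_Linf_ball_one t] t_pos] in \<open>auto simp: I_def\<close>)
        finally show ?thesis by (simp add: \<sigma>.prob_space)
      qed
      have b_lower: "a / B\<phi> \<le> b"
      proof -
        have "a \<le> (LINT x|\<sigma>. B\<phi> * exp (lam * t) * semi1 \<mu> u t x)"
          unfolding a_def using int_\<phi> int_1 by (intro integral_mono \<phi>_le_semi1 t_pos) auto
        also have "\<dots> = B\<phi> * b" unfolding b_def by simp
        finally show ?thesis using B_pos by (simp add: divide_le_eq mult.commute)
      qed
      then have b_pos: "0 < b" using a_pos B_pos by (meson divide_pos_pos less_le_trans)
      have m: "(LINT x|normalized_measure \<mu> \<psi>. f x) = J / of_real I"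
      proof -
        have "(LINT x|normalized_measure \<mu> \<psi>. f x) = (LINT x|\<mu>. (\<psi> x / I) *\<^sub>R f x)"
          unfolding normalized_measure_def I_def[symmetric] using I f_meas
          by (intro integral_density) auto
        also have "\<dots> = (LINT x|\<mu>. inverse I *\<^sub>R (\<psi> x *\<^sub>R f x))" by (simp add: field_simps)
        also have "\<dots> = J / of_real I"
          unfolding J_def integral_scaleR_right by (simp add: scaleR_conv_of_real field_simps)
        finally show ?thesis .
      qed
      have quot: "(LINT x|\<sigma>. semi \<mu> u t f x) / of_real (LINT x|\<sigma>. semi1 \<mu> u t x) = z / of_real b"
        unfolding z_def b_def by (simp add: scaleR_conv_of_real)
      have "cmod (z / of_real b - J / of_real I) \<le> \<delta> * (1 + cmod J / I) / b"
        by (rule cmod_quotient_diff_le[OF I b_pos z_close b_close])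
      also have "\<dots> \<le> \<delta> * (2 + B\<psi> / I) / (exp (- (\<gamma> / 2) * t) / B\<phi>)"
      proof (intro frac_le mult_left_mono)
        have "cmod J / I \<le> (I + B\<psi>) / I"
          using cmod_integral_\<psi>_le[OF f] I unfolding J_def I_def by (intro divide_right_mono) auto
        also have "\<dots> = 1 + B\<psi> / I" using I by (simp add: add_divide_distrib)
        finally show "1 + cmod J / I \<le> 2 + B\<psi> / I" by simp
        show "exp (- (\<gamma> / 2) * t) / B\<phi> \<le> b"
          using a B_pos b_lower by (meson divide_right_mono less_imp_le order_trans)
      qed (use D(1) B_pos I in \<open>auto simp: \<delta>_def\<close>)
      also have "\<dots> = C * (exp (- \<gamma> * t) / exp (- (\<gamma> / 2) * t))"
        unfolding C_def \<delta>_def by (simp add: field_simps)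
      also have "exp (- \<gamma> * t) / exp (- (\<gamma> / 2) * t) = exp (- (\<gamma> / 2) * t)"
        unfolding exp_diff[symmetric] by (simp add: field_simps)
      finally show "cmod ((LINT x|\<sigma>. semi \<mu> u t f x) / complex_of_real (LINT x|\<sigma>. semi1 \<mu> u t x)
          - (LINT x|normalized_measure \<mu> \<psi>. f x)) \<le> C * exp (- (\<gamma> / 2) * t)"
        unfolding m quot .
    qed
  qed
qed

end

section \<open>Nonnegativity of the kernel and positivity of the overlap of the ground states\<close>

text \<open>Positivity of \<open>U\<^sub>t 1\<^sub>B\<close> for the countably many finite unions \<open>B\<close> of base sets of finite measure holds
  off a single null set of points \<open>x\<close>. For the remaining \<open>x\<close> the integrals of \<open>u t x\<close> over all open sets are
  nonnegative; convergence of \<open>U\<^sub>t 1\<close> makes \<open>u t x\<close> integrable.\<close>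

lemma kernel_nonneg_of_positivity_preserving:
  fixes \<mu> :: "'a::polish_space measure"
  assumes sets: "sets \<mu> = sets borel" and lf: "locally_finite_measure \<mu>"
    and conv: "kernel_converges \<mu> u t (\<lambda>_. 1 :: complex)"
    and pos: "positivity_preserving \<mu> u t"
  shows "AE x in \<mu>. AE y in \<mu>. 0 \<le> u t x y"
proof -
  obtain B where B: "countable B" "\<And>b. b \<in> B \<Longrightarrow> open b" "\<And>b. b \<in> B \<Longrightarrow> emeasure \<mu> b < \<infinity>"
    "\<And>S x. open S \<Longrightarrow> x \<in> S \<Longrightarrow> \<exists>b\<in>B. x \<in> b \<and> b \<subseteq> S"
    using locally_finite_countable_base[OF lf sets] by metis
  define FF where "FF = {F. finite F \<and> F \<subseteq> B}"
  have "countable FF" unfolding FF_def by (rule countable_Collect_finite_subset[OF B(1)])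
  have "AE x in \<mu>. 0 \<le> (LINT y:\<Union>F|\<mu>. u t x y)" if "F \<in> FF" for F
  proof -
    have F: "finite F" "F \<subseteq> B" using that unfolding FF_def by auto
    have F_sets: "b \<in> sets \<mu>" if "b \<in> F" for b using that F B(2) sets by auto
    then have [measurable]: "\<Union>F \<in> sets \<mu>" using F(1) by (intro sets.finite_Union) auto
    have "emeasure \<mu> (\<Union>F) \<le> (\<Sum>b\<in>F. emeasure \<mu> b)"
      using emeasure_subadditive_finite[of F "\<lambda>b. b" \<mu>] F(1) F_sets by auto
    also have "\<dots> < \<infinity>" using F B(3) by (auto simp: less_top)
    finally have fin: "emeasure \<mu> (\<Union>F) < \<infinity>" .
    have "(\<lambda>y. norm (indicator (\<Union>F) y :: real) powr enn2real 2) = indicator (\<Union>F)"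
      by (auto simp: fun_eq_iff split: split_indicator)
    then have "(indicator (\<Union>F) :: 'a \<Rightarrow> real) \<in> Lp_space \<mu> 2"
      using fin unfolding Lp_space_def by auto
    then have "AE x in \<mu>. 0 \<le> kernel_op \<mu> u t (indicator (\<Union>F) :: 'a \<Rightarrow> real) x"
      using pos unfolding positivity_preserving_def by (metis (mono_tags) AE_I2 indicator_pos_le)
    then show ?thesis
      unfolding kernel_op_def set_lebesgue_integral_def by (simp add: mult.commute)
  qed
  then have "AE x in \<mu>. \<forall>F\<in>FF. 0 \<le> (LINT y:\<Union>F|\<mu>. u t x y)"
    using \<open>countable FF\<close> by (simp add: AE_ball_countable)
  moreover have "AE x in \<mu>. integrable \<mu> (\<lambda>y. u t x y *\<^sub>R (1 :: complex))"
    using conv unfolding kernel_converges_def .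
  ultimately show ?thesis
  proof eventually_elim
    case (elim x)
    have int: "integrable \<mu> (\<lambda>y. u t x y)" using integrable_Re[OF elim(2)] by simp
    show ?case
    proof (rule AE_nonneg_of_open_set_integrals[OF sets int])
      fix S :: "'a set" assume "open S"
      show "0 \<le> (LINT y:S|\<mu>. u t x y)"
        by (rule set_integral_nonneg_of_countable_base[OF sets int B(1,2,4) _ \<open>open S\<close>])
          (use elim(1) in \<open>auto simp: FF_def\<close>)
    qed
  qed
qed

text \<open>Here \<open>Lp_norm \<mu> 2 \<phi> = 1\<close> also provides square integrability: for a function that is not square
  integrable the defining integral, and thus the value of \<open>Lp_norm\<close>, would be \<open>0\<close>.\<close>

lemma overlap_pos:
  fixes \<phi> \<psi> :: "'a \<Rightarrow> real"
  assumes [measurable]: "\<phi> \<in> borel_measurable \<mu>" "\<psi> \<in> borel_measurable \<mu>"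
    and norm: "Lp_norm \<mu> 2 \<phi> = 1" "Lp_norm \<mu> 2 \<psi> = 1"
    and pos: "\<And>x. 0 < \<phi> x" "\<And>x. 0 < \<psi> x"
  shows "0 < (LINT x|\<mu>. \<phi> x * \<psi> x)"
proof -
  have int2: "integrable \<mu> (\<lambda>x. (f x)\<^sup>2)" "(LINT x|\<mu>. (f x)\<^sup>2) \<noteq> 0"
    if "Lp_norm \<mu> 2 f = 1" for f :: "'a \<Rightarrow> real"
  proof -
    have "(\<lambda>x. norm (f x) powr 2) = (\<lambda>x. (f x)\<^sup>2)" by (auto simp: fun_eq_iff powr_numeral)
    then have "(LINT x|\<mu>. (f x)\<^sup>2) powr (1 / 2) = 1" using that unfolding Lp_norm_def by simp
    then show ne: "(LINT x|\<mu>. (f x)\<^sup>2) \<noteq> 0" by auto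
    then show "integrable \<mu> (\<lambda>x. (f x)\<^sup>2)" using not_integrable_integral_eq by blast
  qed
  have int: "integrable \<mu> (\<lambda>x. \<phi> x * \<psi> x)"
  proof (rule Bochner_Integration.integrable_bound[where f = "\<lambda>x. (\<phi> x)\<^sup>2 + (\<psi> x)\<^sup>2"])
    show "integrable \<mu> (\<lambda>x. (\<phi> x)\<^sup>2 + (\<psi> x)\<^sup>2)" using int2 norm by auto
    have "norm (\<phi> x * \<psi> x) \<le> norm ((\<phi> x)\<^sup>2 + (\<psi> x)\<^sup>2)" for x
      using sum_squares_bound[of "\<phi> x" "\<psi> x"] mult_pos_pos[OF pos, of x x] by simp
    then show "AE x in \<mu>. norm (\<phi> x * \<psi> x) \<le> norm ((\<phi> x)\<^sup>2 + (\<psi> x)\<^sup>2)" by simp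
  qed simp
  have nonneg: "0 \<le> \<phi> x * \<psi> x" for x using pos[of x] by simp
  have "(LINT x|\<mu>. \<phi> x * \<psi> x) \<noteq> 0"
  proof
    assume "(LINT x|\<mu>. \<phi> x * \<psi> x) = 0"
    then have "AE x in \<mu>. \<phi> x * \<psi> x = 0"
      using integral_nonneg_eq_0_iff_AE[OF int] nonneg by simp
    then have "AE x in \<mu>. (\<phi> x)\<^sup>2 = 0"
    proof eventually_elim
      case (elim x)
      then show ?case using pos[of x] by auto
    qed
    then have "(LINT x|\<mu>. (\<phi> x)\<^sup>2) = 0" by (rule integral_eq_zero_AE)
    then show False using int2(2)[OF norm(1)] by simp
  qed
  moreover have "0 \<le> (LINT x|\<mu>. \<phi> x * \<psi> x)" using nonneg by (intro integral_nonneg_AE) auto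
  ultimately show ?thesis by linarith
qed

section \<open>The exhausting family adapted to the ground states\<close>

lemma h_fun_le:
  assumes "x \<in> K t"
  shows "h_fun \<phi> \<psi> K t \<le> ereal (\<phi> x)" "h_fun \<phi> \<psi> K t \<le> ereal (\<psi> x)"
  unfolding h_fun_def using assms by (auto intro: INF_lower min.coboundedI1 min.coboundedI2)

lemma h_fun_antimono:
  assumes "exhausting_family a K" "a \<le> s" "s \<le> t"
  shows "h_fun \<phi> \<psi> K t \<le> h_fun \<phi> \<psi> K s"
proof -
  have "K s \<subseteq> K t" using assms unfolding exhausting_family_def by (cases "s = t") auto
  then show ?thesis unfolding h_fun_def by (intro min.mono INF_superset_mono) auto
qed

lemma h_fun_pos:
  fixes \<phi> \<psi> :: "'a::topological_space \<Rightarrow> real"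
  assumes K: "compact (K t)"
    and cont: "continuous_on UNIV \<phi>" "continuous_on UNIV \<psi>" and pos: "\<And>x. 0 < \<phi> x" "\<And>x. 0 < \<psi> x"
  shows "0 < h_fun \<phi> \<psi> K t"
proof -
  have *: "0 < (INF x\<in>K t. ereal (f x))"
    if f: "continuous_on UNIV f" "\<And>x. 0 < f x" for f :: "'a \<Rightarrow> real"
  proof (cases "K t = {}")
    case False
    then obtain x where x: "x \<in> K t" "\<And>y. y \<in> K t \<Longrightarrow> f x \<le> f y"
      using continuous_attains_inf[OF K False continuous_on_subset[OF f(1)]] by auto
    have "0 < ereal (f x)" using f(2) by simp
    also have "ereal (f x) \<le> (INF x\<in>K t. ereal (f x))" using x by (intro INF_greatest) auto
    finally show ?thesis .
  qed (simp add: top_ereal_def)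
  show ?thesis unfolding h_fun_def using *[OF cont(1) pos(1)] *[OF cont(2) pos(2)] by simp
qed

text \<open>Left continuity is what makes \<open>h (\<eta> t)\<close> at least \<open>exp (- \<gamma> t)\<close>: the infimum defining
  \<open>\<eta> t\<close> is approached from the left by points where \<open>h\<close> has not yet dropped below this level.\<close>

lemma h_eta_lower:
  assumes h_pos: "0 < h t0" and \<gamma>: "0 < \<gamma>" and t: "t0_tilde t0 \<gamma> h \<le> t"
    and left: "\<forall>s>t0. continuous (at_left s) h"
    and drop: "\<exists>s\<ge>t0. h s < ereal (exp (- \<gamma> * t))"
  shows "t0 \<le> eta t0 \<gamma> h t" "ereal (exp (- \<gamma> * t)) \<le> h (eta t0 \<gamma> h t)"
proof -
  define e where "e = ereal (exp (- \<gamma> * t))"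
  define D where "D = {s. t0 \<le> s \<and> h s < e}"
  have eta: "eta t0 \<gamma> h t = Inf D" unfolding eta_def gen_inverse_def D_def e_def by simp
  have D: "D \<noteq> {}" "bdd_below D" using drop unfolding D_def e_def by (auto intro!: bdd_belowI[of _ t0])
  show ge: "t0 \<le> eta t0 \<gamma> h t" unfolding eta using D(1) by (intro cInf_greatest) (auto simp: D_def)
  have before: "ereal (exp (- \<gamma> * t)) \<le> h s" if "t0 \<le> s" "s < eta t0 \<gamma> h t" for s
  proof (rule ccontr)
    assume "\<not> ereal (exp (- \<gamma> * t)) \<le> h s"
    then have "s \<in> D" using that unfolding D_def e_def by auto
    then show False using that cInf_lower[OF _ D(2), of s] unfolding eta by auto
  qed
  have start: "e \<le> h t0"
  proof (cases "h t0")
    case (real r)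
    then have r: "0 < r" using h_pos by simp
    have "- (1 / \<gamma>) * ln r \<le> t" using t unfolding t0_tilde_def real by simp
    then have "- \<gamma> * t \<le> ln r" using \<gamma> by (simp add: field_simps)
    then have "exp (- \<gamma> * t) \<le> exp (ln r)" by simp
    then show ?thesis unfolding real e_def using r by simp
  qed (use h_pos in auto)
  show "ereal (exp (- \<gamma> * t)) \<le> h (eta t0 \<gamma> h t)"
  proof (cases "eta t0 \<gamma> h t = t0")
    case True
    then show ?thesis using start unfolding e_def by simp
  next
    case False
    then have gt: "t0 < eta t0 \<gamma> h t" using ge by simp
    then have "(h \<longlongrightarrow> h (eta t0 \<gamma> h t)) (at_left (eta t0 \<gamma> h t))"
      using left by (simp add: continuous_within)
    moreover have "eventually (\<lambda>s. ereal (exp (- \<gamma> * t)) \<le> h s) (at_left (eta t0 \<gamma> h t))"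
      using eventually_at_left_real[OF gt] by eventually_elim (intro before, auto)
    ultimately show ?thesis by (rule tendsto_lowerbound) simp
  qed
qed

text \<open>Since \<open>h\<close> is positive and antitone, it falls below \<open>e\<^bsup>-\<gamma> t\<^esup>\<close> only after any prescribed time \<open>s\<close>, once
  \<open>t\<close> is large; so the \<open>K (\<eta> t)\<close> still exhaust the space. The assumption \<open>vanish\<close> makes \<open>h\<close> fall below
  every positive level: otherwise \<open>\<eta> t\<close> would be the infimum of an empty set of reals.\<close>

proposition exhausting_family_eta:
  fixes \<phi> \<psi> :: "'a::topological_space \<Rightarrow> real"
  assumes K: "exhausting_family t0 K" and \<gamma>: "0 < \<gamma>"
    and cont: "continuous_on UNIV \<phi>" "continuous_on UNIV \<psi>" and pos: "\<And>x. 0 < \<phi> x" "\<And>x. 0 < \<psi> x"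
    and left: "\<forall>t>t0. continuous (at_left t) (h_fun \<phi> \<psi> K)"
    and vanish: "\<And>\<epsilon>. 0 < \<epsilon> \<Longrightarrow> \<exists>x. \<phi> x < \<epsilon> \<or> \<psi> x < \<epsilon>"
  defines "h \<equiv> h_fun \<phi> \<psi> K"
  shows "exhausting_family (t0_tilde t0 \<gamma> h) (\<lambda>t. K (eta t0 \<gamma> h t))"
    and "\<And>t x. t0_tilde t0 \<gamma> h \<le> t \<Longrightarrow> x \<in> K (eta t0 \<gamma> h t) \<Longrightarrow> exp (- \<gamma> * t) \<le> \<phi> x \<and> exp (- \<gamma> * t) \<le> \<psi> x"
proof -
  let ?tt = "t0_tilde t0 \<gamma> h" and ?\<eta> = "eta t0 \<gamma> h"
  have K_compact: "\<forall>t\<ge>t0. compact (K t)" and K_mono: "\<forall>t s. t0 \<le> t \<longrightarrow> t < s \<longrightarrow> K t \<subseteq> K s"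
    and K_cover: "(\<Union>t\<in>{t0..}. K t) = UNIV" and K_absorb: "\<forall>C. compact C \<longrightarrow> (\<exists>t\<ge>t0. C \<subseteq> K t)"
    using K unfolding exhausting_family_def by - (elim conjE, assumption)+
  have compact_K: "compact (K t)" if "t0 \<le> t" for t using K_compact that by simp
  have mono_K: "K s \<subseteq> K t" if "t0 \<le> s" "s \<le> t" for s t
    using K_mono that by (cases "s = t") simp_all
  have h_pos: "0 < h t" if "t0 \<le> t" for t
    unfolding h_def using compact_K[OF that] cont pos by (rule h_fun_pos)
  have drop: "\<exists>s\<ge>t0. h s < ereal (exp (- \<gamma> * t))" for t
  proof -
    obtain x where x: "\<phi> x < exp (- \<gamma> * t) \<or> \<psi> x < exp (- \<gamma> * t)" using vanish[of "exp (- \<gamma> * t)"] by auto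
    obtain s where s: "t0 \<le> s" "x \<in> K s" using K_cover by blast
    then have "h s < ereal (exp (- \<gamma> * t))"
      using h_fun_le[of x K s \<phi> \<psi>] x unfolding h_def by (auto intro: le_less_trans)
    then show ?thesis using s by auto
  qed
  have lower: "t0 \<le> ?\<eta> t" "ereal (exp (- \<gamma> * t)) \<le> h (?\<eta> t)" if "?tt \<le> t" for t
    using h_eta_lower[OF h_pos[OF order_refl] \<gamma> that left[folded h_def] drop] by simp_all
  have escape: "\<exists>t\<ge>?tt. K s \<subseteq> K (?\<eta> t)" if s: "t0 \<le> s" for s
  proof -
    obtain r where r: "0 < r" "ereal r \<le> h s"
      using ereal_dense2[OF h_pos[OF s]] by (auto simp: zero_ereal_def)
    obtain t where t: "?tt \<le> t" "exp (- \<gamma> * t) < r"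
    proof
      show "?tt \<le> max ?tt ((1 - ln r) / \<gamma>)" by simp
      have "(1 - ln r) / \<gamma> \<le> max ?tt ((1 - ln r) / \<gamma>)" by simp
      then have "- \<gamma> * max ?tt ((1 - ln r) / \<gamma>) \<le> ln r - 1"
        using \<gamma> by (simp add: divide_le_eq mult.commute del: max.cobounded2)
      then have "- \<gamma> * max ?tt ((1 - ln r) / \<gamma>) < ln r" by simp
      then have "exp (- \<gamma> * max ?tt ((1 - ln r) / \<gamma>)) < exp (ln r)" by (simp only: exp_less_cancel_iff)
      then show "exp (- \<gamma> * max ?tt ((1 - ln r) / \<gamma>)) < r" using r by simp
    qed
    have "s \<le> ?\<eta> t"
    proof -
      obtain D where D: "D = {s'. t0 \<le> s' \<and> h s' < ereal (exp (- \<gamma> * t))}" by simp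
      have "s \<le> Inf D"
      proof (rule cInf_greatest)
        show "D \<noteq> {}" using drop[of t] unfolding D by auto
        fix s' assume s': "s' \<in> D"
        show "s \<le> s'"
        proof (rule ccontr)
          assume "\<not> s \<le> s'"
          then have "h s \<le> h s'" using h_fun_antimono[OF K, of s' s] s' unfolding h_def D by auto
          then have "ereal r \<le> h s'" using r(2) by (rule order_trans[rotated])
          moreover have "h s' < ereal (exp (- \<gamma> * t))" using s' unfolding D by simp
          ultimately have "ereal r < ereal (exp (- \<gamma> * t))" by (rule le_less_trans)
          then show False using t by simp
        qed
      qed
      then show ?thesis unfolding eta_def gen_inverse_def D .
    qed
    then show ?thesis using t(1) mono_K[OF s] by blast
  qed
  show "exhausting_family ?tt (\<lambda>t. K (?\<eta> t))"
    unfolding exhausting_family_def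
  proof (intro conjI allI impI)
    show "0 \<le> ?tt" unfolding t0_tilde_def by auto
    show "compact (K (?\<eta> t))" if "?tt \<le> t" for t using compact_K lower(1) that by blast
    show "K (?\<eta> t) \<subseteq> K (?\<eta> s)" if "?tt \<le> t" "t < s" for t s
    proof (rule mono_K[OF lower(1)[OF that(1)]])
      show "?\<eta> t \<le> ?\<eta> s" unfolding eta_def gen_inverse_def
      proof (rule cInf_superset_mono)
        show "{r. t0 \<le> r \<and> h r < ereal (exp (- \<gamma> * s))} \<noteq> {}" using drop[of s] by auto
        show "bdd_below {r. t0 \<le> r \<and> h r < ereal (exp (- \<gamma> * t))}" by (auto intro!: bdd_belowI[of _ t0])
        have "exp (- \<gamma> * s) < exp (- \<gamma> * t)" using \<gamma> that by simp
        then show "{r. t0 \<le> r \<and> h r < ereal (exp (- \<gamma> * s))} \<subseteq> {r. t0 \<le> r \<and> h r < ereal (exp (- \<gamma> * t))}"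
          by (auto intro: less_trans)
      qed
    qed
    show "(\<Union>t\<in>{?tt..}. K (?\<eta> t)) = UNIV"
    proof (intro set_eqI iffI UNIV_I)
      fix x
      obtain s where "t0 \<le> s" "x \<in> K s" using K_cover by blast
      then show "x \<in> (\<Union>t\<in>{?tt..}. K (?\<eta> t))" using escape[of s] by auto
    qed
    show "\<exists>t\<ge>?tt. C \<subseteq> K (?\<eta> t)" if C: "compact C" for C
    proof -
      obtain s where "t0 \<le> s" "C \<subseteq> K s" using K_absorb C by blast
      then show ?thesis using escape[of s] by blast
    qed
  qed
  show "exp (- \<gamma> * t) \<le> \<phi> x \<and> exp (- \<gamma> * t) \<le> \<psi> x" if "?tt \<le> t" "x \<in> K (?\<eta> t)" for t x
  proof -
    have "ereal (exp (- \<gamma> * t)) \<le> ereal (\<phi> x)"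
      by (rule order_trans[OF lower(2)[OF that(1)]])
        (unfold h_def, rule h_fun_le(1)[where \<psi> = \<psi>], rule that(2)[unfolded h_def])
    moreover have "ereal (exp (- \<gamma> * t)) \<le> ereal (\<psi> x)"
      by (rule order_trans[OF lower(2)[OF that(1)]])
        (unfold h_def, rule h_fun_le(2)[where \<phi> = \<phi>], rule that(2)[unfolded h_def])
    ultimately show ?thesis by simp
  qed
qed

section \<open>Progressive domination and quasi-ergodicity of both semigroups\<close>

theorem theorem4p6:
  fixes \<mu> :: "'a::polish_space measure"
    and u :: "real \<Rightarrow> 'a \<Rightarrow> 'a \<Rightarrow> real"
    and t0 t1 lambda0 \<gamma> :: real
    and \<phi>0 \<psi>0 :: "'a \<Rightarrow> real"
    and K :: "real \<Rightarrow> 'a set"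
  defines "us \<equiv> adj_kernel u"
    and "U \<equiv> kernel_semigroup \<mu> u"
    and "Us \<equiv> kernel_semigroup \<mu> (adj_kernel u)"
    and "h \<equiv> h_fun \<phi>0 \<psi>0 K"
    and "\<eta> \<equiv> eta t0 \<gamma> (h_fun \<phi>0 \<psi>0 K)"
    and "tt0 \<equiv> t0_tilde t0 \<gamma> (h_fun \<phi>0 \<psi>0 K)"
  assumes M_locally_compact: "locally compact (UNIV :: 'a set)"
    and M_not_compact: "\<not> compact (UNIV :: 'a set)"
    and mu_borel: "sets \<mu> = sets borel"
    and mu_locally_finite: "locally_finite_measure \<mu>"
    and mu_full_support: "measure_support \<mu> = UNIV"
    and kernel_measurable: "measurable_kernel \<mu> u"
    and kernel_conv: "\<forall>t>0. \<forall>f\<in>L2 \<mu>. kernel_converges \<mu> u t f \<and> kernel_converges \<mu> us t f"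
    and semigroup: "C0_semigroup_L2 \<mu> U"
    and pos_preserving: "\<forall>t>0. positivity_preserving \<mu> u t"
    and adjoint: "\<forall>t\<ge>0. adjoint_ops_L2 \<mu> (U t) (Us t)"
    and t0_pos: "0 < t0"
    and compact_ops: "\<forall>t>0. compact_op_L2 \<mu> (U t)"
    and pos_improving: "positivity_improving \<mu> u t0"
    and Feller: "strong_Feller \<mu> u" "strong_Feller \<mu> us"
    and ultracontractive: "bounded_L2_Linf \<mu> (U t0)" "bounded_L2_Linf \<mu> (Us t0)"
    and decay: "\<forall>t\<ge>t0. \<forall>\<epsilon>>0. \<exists>C. compact C \<and>
                  (\<forall>x\<in>- C. semi1 \<mu> u t x \<le> \<epsilon> \<or> semi1 \<mu> us t x \<le> \<epsilon>)"
    and ground_states: "ground_state \<mu> U lambda0 \<phi>0" "ground_state \<mu> Us lambda0 \<psi>0"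
    and gamma_pos: "0 < \<gamma>"
    and gamma: "\<exists>C0>0. \<forall>t>2 * t0. AE (x, y) in \<mu> \<Otimes>\<^sub>M \<mu>.
                  \<bar>exp (lambda0 * t) * u t x y - inverse (LINT z|\<mu>. \<phi>0 z * \<psi>0 z) * \<phi>0 x * \<psi>0 y\<bar>
                    \<le> C0 * exp (- \<gamma> * t)"
    and strictly_pos: "\<forall>x. 0 < \<phi>0 x" "\<forall>x. 0 < \<psi>0 x"
    and exhausting: "exhausting_family t0 K"
    and h_left_continuous: "\<forall>t>t0. continuous (at_left t) h"
    and t1: "t0 \<le> t1"
    and heat_content_finite: "heat_content \<mu> u t1 < \<infinity>"
  shows "pGSD_both \<mu> u lambda0 \<phi>0 \<psi>0 tt0 (\<lambda>t. K (\<eta> t)) \<and>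
    (\<forall>p::ennreal. 1 \<le> p \<longrightarrow>
       (\<exists>C>0. \<forall>t. 6 * t1 < t \<longrightarrow> 2 * tt0 \<le> t \<longrightarrow>
          quasi_ergodic_error \<mu> u (normalized_measure \<mu> \<psi>0) p (K (\<eta> (t / 2))) t
            \<le> ennreal (C * exp (- (\<gamma> / 2) * t)) \<and>
          quasi_ergodic_error \<mu> us (normalized_measure \<mu> \<phi>0) p (K (\<eta> (t / 2))) t
            \<le> ennreal (C * exp (- (\<gamma> / 2) * t))))"
proof -
  define \<kappa> where "\<kappa> = inverse (LINT z|\<mu>. \<phi>0 z * \<psi>0 z)"
  have t1_pos: "0 < t1" using t0_pos t1 by simp
  have Cb: "\<phi>0 \<in> Cb" "\<psi>0 \<in> Cb" and norms: "Lp_norm \<mu> 2 \<phi>0 = 1" "Lp_norm \<mu> 2 \<psi>0 = 1"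
    using ground_states unfolding ground_state_def by auto
  have pos: "0 < \<phi>0 x" "0 < \<psi>0 x" for x using strictly_pos by auto
  have one: "(\<lambda>_. 1 :: complex) \<in> Lp_space \<mu> \<infinity>"
    unfolding Lp_space_def by (auto intro!: exI[of _ 1])
  have "sigma_finite_measure \<mu>" by (rule locally_finite_imp_sigma_finite[OF mu_locally_finite mu_borel])
  then interpret measurable_kernel_family \<mu> u
    using kernel_measurable by (intro measurable_kernel_family.intro measurable_kernel_family_axioms.intro)
  interpret nonneg_kernel \<mu> u
  proof
    fix t :: real assume t: "0 < t"
    have "kernel_converges \<mu> u t (\<lambda>_. 1 :: complex)"
      using Feller(1) one t unfolding strong_Feller_def by blast
    then show "AE x in \<mu>. AE y in \<mu>. 0 \<le> u t x y"
      using t pos_preserving by (intro kernel_nonneg_of_positivity_preserving mu_borel mu_locally_finite) auto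
  qed (rule mu_borel)
  interpret nonneg_Feller_kernel \<mu> u
  proof
    show chapman_kolmogorov
      using kernel_conv semigroup unfolding U_def by (intro chapman_kolmogorov_of_L2_semigroup) auto
  qed (use mu_full_support Feller in \<open>auto simp: us_def\<close>)
  have cont: "continuous_on UNIV \<phi>0" "continuous_on UNIV \<psi>0" using Cb by (auto simp: Cb_def)
  have \<kappa>_pos: "0 < \<kappa>"
    unfolding \<kappa>_def using overlap_pos[OF measurable_continuous[OF cont(1)] measurable_continuous[OF cont(2)] norms pos]
    by simp
  obtain C0 where C0: "0 < C0" "\<And>t. 2 * t0 < t \<Longrightarrow> AE (x, y) in \<mu> \<Otimes>\<^sub>M \<mu>.
      \<bar>exp (lambda0 * t) * u t x y - \<kappa> * \<phi>0 x * \<psi>0 y\<bar> \<le> C0 * exp (- \<gamma> * t)"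
    using gamma unfolding \<kappa>_def by blast
  interpret U: ground_state_kernel \<mu> u lambda0 \<kappa> \<gamma> C0 "2 * t0" t1 \<phi>0 \<psi>0
  proof
    show "AE x in \<mu>. AE y in \<mu>. \<bar>exp (lambda0 * t) * u t x y - \<kappa> * \<phi>0 x * \<psi>0 y\<bar> \<le> C0 * exp (- \<gamma> * t)"
      if "2 * t0 < t" for t
      using pair.AE_pair[OF C0(2)[OF that]] by simp
    have "(\<integral>\<^sup>+x. P t1 (\<lambda>_. 1) x \<partial>\<mu>) = heat_content \<mu> u t1"
      unfolding heat_content_def by (intro nn_integral_cong_AE semi_one(3) t1_pos)
    then show "(\<integral>\<^sup>+x. P t1 (\<lambda>_. 1) x \<partial>\<mu>) < \<infinity>" using heat_content_finite by simp
  qed (use \<kappa>_pos gamma_pos C0 t0_pos t1_pos Cb pos in auto)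
  interpret Us: ground_state_kernel \<mu> us lambda0 \<kappa> \<gamma> C0 "2 * t0" t1 \<psi>0 \<phi>0
    unfolding us_def by (rule U.ground_state_kernel_adj)
  \<comment> \<open>Outside a compact set, which is not the whole space, one of the functions \<open>U\<^sub>t 1\<close> and \<open>U\<^sub>t\<^sup>* 1\<close> is
    small at time \<open>t0\<close>, and they dominate multiples of the ground states.\<close>
  have vanish: "\<exists>x. \<phi>0 x < \<epsilon> \<or> \<psi>0 x < \<epsilon>" if \<epsilon>: "0 < \<epsilon>" for \<epsilon>
  proof -
    define M where "M = max (U.B\<phi> * exp (lambda0 * t0)) (Us.B\<phi> * exp (lambda0 * t0))"
    have M: "0 < M" "U.B\<phi> * exp (lambda0 * t0) \<le> M" "Us.B\<phi> * exp (lambda0 * t0) \<le> M"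
      using U.B_pos unfolding M_def by (auto simp: less_max_iff_disj)
    have "0 < \<epsilon> / (2 * M)" using \<epsilon> M(1) by simp
    from decay[rule_format, OF order_refl this]
    obtain C where C: "compact C" "\<forall>x\<in>- C. semi1 \<mu> u t0 x \<le> \<epsilon> / (2 * M) \<or> semi1 \<mu> us t0 x \<le> \<epsilon> / (2 * M)"
      by (elim exE conjE) (rule that)
    have "C \<noteq> UNIV" using C(1) M_not_compact by auto
    then obtain x where x: "x \<notin> C" by auto
    have "\<epsilon> / 2 < \<epsilon>" using \<epsilon> by simp
    have "\<phi>0 x \<le> M * semi1 \<mu> u t0 x"
      using U.\<phi>_le_semi1[OF t0_pos, of x] mult_right_mono[OF M(2) semi_one(4)[OF t0_pos, of x]] by simp
    moreover have "\<psi>0 x \<le> M * semi1 \<mu> us t0 x"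
      using Us.\<phi>_le_semi1[OF t0_pos, of x] mult_right_mono[OF M(3) Us.semi_one(4)[OF t0_pos, of x]] by simp
    moreover have "M * r \<le> \<epsilon> / 2" if "r \<le> \<epsilon> / (2 * M)" for r
      using mult_left_mono[OF that less_imp_le[OF M(1)]] M(1) by simp
    moreover have "semi1 \<mu> u t0 x \<le> \<epsilon> / (2 * M) \<or> semi1 \<mu> us t0 x \<le> \<epsilon> / (2 * M)"
      using C(2) x by (simp del: le_divide_eq)
    ultimately have "\<phi>0 x \<le> \<epsilon> / 2 \<or> \<psi>0 x \<le> \<epsilon> / 2" by (elim disjE) (blast intro: order_trans)+
    then have "\<phi>0 x < \<epsilon> \<or> \<psi>0 x < \<epsilon>"
      using \<open>\<epsilon> / 2 < \<epsilon>\<close> by (elim disjE) (simp_all only: le_less_trans simp_thms)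
    then show ?thesis by (rule exI)
  qed
  have large: "exp (- \<gamma> * t) \<le> \<phi>0 x \<and> exp (- \<gamma> * t) \<le> \<psi>0 x" if "tt0 \<le> t" "x \<in> K (\<eta> t)" for t x
    unfolding tt0_def \<eta>_def
    by (rule exhausting_family_eta(2)[OF exhausting gamma_pos cont pos h_left_continuous[unfolded h_def] _
          that[unfolded tt0_def \<eta>_def]]) (rule vanish)
  have family: "exhausting_family tt0 (\<lambda>t. K (\<eta> t))"
    unfolding tt0_def \<eta>_def
    by (rule exhausting_family_eta(1)[OF exhausting gamma_pos cont pos h_left_continuous[unfolded h_def]]) (rule vanish)
  obtain C1 where C1: "0 < C1" "\<And>t x. 2 * t0 + t1 < t \<Longrightarrow> exp (- \<gamma> * t) \<le> \<phi>0 x \<Longrightarrow>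
      semi1 \<mu> u t x \<le> C1 * exp (- lambda0 * t) * \<phi>0 x"
    by (rule U.semi1_le_ground_state) blast
  obtain C2 where C2: "0 < C2" "\<And>t x. 2 * t0 + t1 < t \<Longrightarrow> exp (- \<gamma> * t) \<le> \<psi>0 x \<Longrightarrow>
      semi1 \<mu> us t x \<le> C2 * exp (- lambda0 * t) * \<psi>0 x"
    by (rule Us.semi1_le_ground_state) blast
  have pGSD: "pGSD_both \<mu> u lambda0 \<phi>0 \<psi>0 tt0 (\<lambda>t. K (\<eta> t))"
    unfolding pGSD_both_def
  proof (intro conjI family exI ballI allI impI)
    show "0 < max C1 C2" using C1(1) by simp
    show "0 < 2 * t0 + t1 + 1" using t0_pos t1_pos by simp
    fix t x assume t: "max (2 * t0 + t1 + 1) tt0 \<le> t" and x: "x \<in> K (\<eta> t)"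
    have "semi1 \<mu> u t x \<le> C1 * exp (- lambda0 * t) * \<phi>0 x"
      using t x by (intro C1(2) large[THEN conjunct1]) auto
    also have "\<dots> \<le> max C1 C2 * exp (- lambda0 * t) * \<phi>0 x" by (intro mult_right_mono) auto
    finally show "semi1 \<mu> u t x \<le> max C1 C2 * exp (- lambda0 * t) * \<phi>0 x" .
    have "semi1 \<mu> us t x \<le> C2 * exp (- lambda0 * t) * \<psi>0 x"
      using t x by (intro C2(2) large[THEN conjunct2]) auto
    also have "\<dots> \<le> max C1 C2 * exp (- lambda0 * t) * \<psi>0 x" by (intro mult_right_mono) auto
    finally show "semi1 \<mu> (adj_kernel u) t x \<le> max C1 C2 * exp (- lambda0 * t) * \<psi>0 x"
      unfolding us_def .
  qed
  obtain E1 where E1: "0 < E1" "\<And>t (p :: ennreal) S. 2 * t0 + t1 < t \<Longrightarrow> 1 \<le> p \<Longrightarrow> closed S \<Longrightarrow>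
      (\<And>x. x \<in> S \<Longrightarrow> exp (- (\<gamma> / 2) * t) \<le> \<phi>0 x) \<Longrightarrow>
      quasi_ergodic_error \<mu> u (normalized_measure \<mu> \<psi>0) p S t \<le> ennreal (E1 * exp (- (\<gamma> / 2) * t))"
    by (rule U.quasi_ergodic_error_le) (rule that; blast)
  obtain E2 where E2: "0 < E2" "\<And>t (p :: ennreal) S. 2 * t0 + t1 < t \<Longrightarrow> 1 \<le> p \<Longrightarrow> closed S \<Longrightarrow>
      (\<And>x. x \<in> S \<Longrightarrow> exp (- (\<gamma> / 2) * t) \<le> \<psi>0 x) \<Longrightarrow>
      quasi_ergodic_error \<mu> us (normalized_measure \<mu> \<phi>0) p S t \<le> ennreal (E2 * exp (- (\<gamma> / 2) * t))"
    by (rule Us.quasi_ergodic_error_le) (rule that; blast)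
  have QE: "quasi_ergodic_error \<mu> u (normalized_measure \<mu> \<psi>0) p (K (\<eta> (t / 2))) t
        \<le> ennreal (max E1 E2 * exp (- (\<gamma> / 2) * t)) \<and>
      quasi_ergodic_error \<mu> us (normalized_measure \<mu> \<phi>0) p (K (\<eta> (t / 2))) t
        \<le> ennreal (max E1 E2 * exp (- (\<gamma> / 2) * t))"
    if p: "1 \<le> p" and t: "6 * t1 < t" "2 * tt0 \<le> t" for p :: ennreal and t
  proof -
    \<comment> \<open>By \<open>t0 \<le> t1\<close>, the time bound \<open>6 t1\<close> exceeds the threshold \<open>2 t0 + t1\<close> of the two estimates.\<close>
    have t': "2 * t0 + t1 < t" "tt0 \<le> t / 2" using t t1 t1_pos by linarith+
    have "\<forall>t\<ge>tt0. compact (K (\<eta> t))" using family unfolding exhausting_family_def by (elim conjE)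
    then have "compact (K (\<eta> (t / 2)))" using t'(2) by simp
    then have closed: "closed (K (\<eta> (t / 2)))" by (rule compact_imp_closed)
    have large': "exp (- (\<gamma> / 2) * t) \<le> \<phi>0 x" "exp (- (\<gamma> / 2) * t) \<le> \<psi>0 x" if "x \<in> K (\<eta> (t / 2))" for x
      using large[OF t'(2) that] by simp_all
    have mono: "ennreal (E * exp (- (\<gamma> / 2) * t)) \<le> ennreal (max E1 E2 * exp (- (\<gamma> / 2) * t))"
      if "E \<le> max E1 E2" for E
      by (intro ennreal_leI mult_right_mono that) simp
    show ?thesis
      using E1(2)[OF t'(1) p closed large'(1)] E2(2)[OF t'(1) p closed large'(2)] mono[of E1] mono[of E2]
      by (auto intro: order_trans)
  qed
  have "0 < max E1 E2" using E1(1) by simp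
  with pGSD QE show ?thesis by blast
qed

end
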